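(* Let $R_n$ be the rook monoid on $n$ elements. Then, as $n\to\infty$, the Fourier transform of an arbitrary $\mathbb{C}$-valued function on $R_n$ may be computed in $O(|R_n|\log^3|R_n|)$ operations; that is, \[ \mathcal{C}(R_n)=O(|R_n|\log^3|R_n|). \]
   Context: The rook monoid $R_n$ is the (inverse) semigroup of all injective partial functions from $\{1,\ldots,n\}$ to itself under composition of partial functions; equivalently, all $n\times n$ $0/1$-matrices with at most one $1$ in each row and each column, under matrix multiplication. For a finite inverse semigroup $S$, $\mathbb{C}S$ is the complex semigroup algebra with basis $\{s\}_{s\in S}$; a function $f:S\to\mathbb{C}$ is identified with $\sum_{s\in S}f(s)s$. A representation of $\mathbb{C}S$ of dimension $d_\rho$ is an algebra homomorphism $\rho:\mathbb{C}S\to M_{d_\rho}(\mathbb{C})$; it is irreducible if it is nonzero and simple as a left $\mathbb{C}S$-module; two representations are equivalent if they are conjugate by an invertible matrix. A complete set $\mathcal{Y}$ of inequivalent irreducible representations contains exactly one representation from each equivalence class of irreducible representations. The Fourier transform of $f$ relative to $\mathcal{Y}$ is $\bigoplus_{\rho\in\mathcal{Y}}\sum_{s\in S}f(s)\rho(s)\in\bigoplus_{\rho\in\mathcal{Y}}M_{d_\rho}(\mathbb{C})$. Complexity: an operation is a complex multiplication followed by a complex addition, i.e. the computation of $uv+z$ where each of $u,v,z$ is an input, a constant (such as an entry of a precomputed representation matrix), or the result of an earlier operation. Only operations are counted: copying, storing and rearranging numbers is free. $\mathcal{T}_{\mathcal{Y}}(S)$ is the maximum number of operations needed to compute the Fourier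 transform relative to $\mathcal{Y}$ of an arbitrary $f=\sum_{s}f(s)s$ (given by its values $f(s)$), all representations in $\mathcal{Y}$ being precomputed and stored, and $\mathcal{C}(S)=\min_{\mathcal{Y}}\mathcal{T}_{\mathcal{Y}}(S)$ over all complete sets $\mathcal{Y}$ of inequivalent irreducible representations of $\mathbb{C}S$. *)

theory Defs
  imports Complex_Main "HOL-Library.Extended_Nat" "HOL-Library.Landau_Symbols"
    "HOL-Algebra.Group" "Jordan_Normal_Form.Matrix"
begin

definition rook_monoid :: "nat \<Rightarrow> (nat \<rightharpoonup> nat) monoid" where
  "rook_monoid n =
    \<lparr> carrier = {g. dom g \<subseteq> {1..n} \<and> ran g \<subseteq> {1..n} \<and> inj_on g (dom g)},
      mult = (\<lambda>g h. g \<circ>\<^sub>m h),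
      one = (\<lambda>x. if x \<in> {1..n} then Some x else None) \<rparr>"


subsection \<open>Semigroup algebra and representations\<close>

text \<open>
  The notions below use only the carrier and the multiplication of \<open>S\<close>, never its unit, so they
  make sense for any finite semigroup.
\<close>

definition salg_carrier :: "('s, 'm) monoid_scheme \<Rightarrow> ('s \<Rightarrow> complex) set" where
  "salg_carrier S = {f. \<forall>x. x \<notin> carrier S \<longrightarrow> f x = 0}"

definition salg_mult ::
  "('s, 'm) monoid_scheme \<Rightarrow> ('s \<Rightarrow> complex) \<Rightarrow> ('s \<Rightarrow> complex) \<Rightarrow> ('s \<Rightarrow> complex)" where
  "salg_mult S f g =
    (\<lambda>x. \<Sum>(s, t) \<in> {(s, t). s \<in> carrier S \<and> t \<in> carrier S \<and> s \<otimes>\<^bsub>S\<^esub> t = x}. f s * g t)"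

definition salg_basis :: "'s \<Rightarrow> ('s \<Rightarrow> complex)" where
  "salg_basis s = (\<lambda>x. if x = s then 1 else 0)"

type_synonym 's rep = "('s \<Rightarrow> complex) \<Rightarrow> complex mat"

text \<open>
  The dimension is read off from the image of an element of the algebra. Only the values of a
  representation on \<^term>\<open>salg_carrier S\<close> matter.
\<close>

definition rep_dim :: "'s rep \<Rightarrow> nat" where
  "rep_dim \<rho> = dim_row (\<rho> (\<lambda>_. 0))"

text \<open>Preservation of a unit is not required; it is automatic for irreducible representations.\<close>

definition representation :: "('s, 'm) monoid_scheme \<Rightarrow> 's rep \<Rightarrow> bool" where
  "representation S \<rho> \<longleftrightarrow>
    (\<forall>a \<in> salg_carrier S. \<rho> a \<in> carrier_mat (rep_dim \<rho>) (rep_dim \<rho>)) \<and>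
    (\<forall>a \<in> salg_carrier S. \<forall>b \<in> salg_carrier S. \<rho> (\<lambda>x. a x + b x) = \<rho> a + \<rho> b) \<and>
    (\<forall>c. \<forall>a \<in> salg_carrier S. \<rho> (\<lambda>x. c * a x) = c \<cdot>\<^sub>m \<rho> a) \<and>
    (\<forall>a \<in> salg_carrier S. \<forall>b \<in> salg_carrier S. \<rho> (salg_mult S a b) = \<rho> a * \<rho> b)"

definition rep_submodule :: "('s, 'm) monoid_scheme \<Rightarrow> 's rep \<Rightarrow> complex vec set \<Rightarrow> bool" where
  "rep_submodule S \<rho> W \<longleftrightarrow>
    W \<subseteq> carrier_vec (rep_dim \<rho>) \<and> 0\<^sub>v (rep_dim \<rho>) \<in> W \<and>
    (\<forall>v \<in> W. \<forall>w \<in> W. v + w \<in> W) \<and>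
    (\<forall>c. \<forall>w \<in> W. c \<cdot>\<^sub>v w \<in> W) \<and>
    (\<forall>a \<in> salg_carrier S. \<forall>w \<in> W. \<rho> a *\<^sub>v w \<in> W)"

definition irreducible_rep :: "('s, 'm) monoid_scheme \<Rightarrow> 's rep \<Rightarrow> bool" where
  "irreducible_rep S \<rho> \<longleftrightarrow>
    representation S \<rho> \<and>
    (\<exists>a \<in> salg_carrier S. \<rho> a \<noteq> 0\<^sub>m (rep_dim \<rho>) (rep_dim \<rho>)) \<and>
    (\<forall>W. rep_submodule S \<rho> W \<longrightarrow> W = {0\<^sub>v (rep_dim \<rho>)} \<or> W = carrier_vec (rep_dim \<rho>))"

text \<open>Conjugation by one and the same \<open>P\<close> for all \<open>a\<close>; \<open>Q\<close> is its inverse.\<close>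

definition equivalent_reps :: "('s, 'm) monoid_scheme \<Rightarrow> 's rep \<Rightarrow> 's rep \<Rightarrow> bool" where
  "equivalent_reps S \<rho> \<sigma> \<longleftrightarrow>
    (\<exists>P Q. \<forall>a \<in> salg_carrier S. similar_mat_wit (\<rho> a) (\<sigma> a) P Q)"

definition complete_irreps :: "('s, 'm) monoid_scheme \<Rightarrow> 's rep set \<Rightarrow> bool" where
  "complete_irreps S Y \<longleftrightarrow>
    (\<forall>\<rho> \<in> Y. irreducible_rep S \<rho>) \<and>
    (\<forall>\<rho>. irreducible_rep S \<rho> \<longrightarrow> (\<exists>!\<sigma>. \<sigma> \<in> Y \<and> equivalent_reps S \<rho> \<sigma>))"

definition fourier_transform ::
  "('s, 'm) monoid_scheme \<Rightarrow> 's rep set \<Rightarrow> ('s \<Rightarrow> complex) \<Rightarrow> 's rep \<Rightarrow> complex mat" where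
  "fourier_transform S Y f = (\<lambda>\<rho> \<in> Y. mat (rep_dim \<rho>) (rep_dim \<rho>)
      (\<lambda>(i, j). \<Sum>s \<in> carrier S. f s * (\<rho> (salg_basis s) $$ (i, j))))"


subsection \<open>Operation counts\<close>

text \<open>
  A straight-line program is a list of operations \<open>(u, v, z)\<close>, each computing \<open>u * v + z\<close>;
  \<^term>\<open>Result i\<close> refers to the \<open>i\<close>-th operation (counted from 0).
\<close>

datatype 's operand = Input 's | Constant complex | Result nat

type_synonym 's program = "('s operand \<times> 's operand \<times> 's operand) list"

primrec operand_value :: "('s \<Rightarrow> complex) \<Rightarrow> complex list \<Rightarrow> 's operand \<Rightarrow> complex" where
  "operand_value f rs (Input s) = f s"
| "operand_value f rs (Constant c) = c"
| "operand_value f rs (Result i) = rs ! i"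

fun run_from :: "('s \<Rightarrow> complex) \<Rightarrow> complex list \<Rightarrow> 's program \<Rightarrow> complex list" where
  "run_from f rs [] = rs"
| "run_from f rs ((u, v, z) # p) =
    run_from f
      (rs @ [operand_value f rs u * operand_value f rs v + operand_value f rs z]) p"

definition run :: "('s \<Rightarrow> complex) \<Rightarrow> 's program \<Rightarrow> complex list" where
  "run f p = run_from f [] p"

text \<open>The operands available once \<open>k\<close> operations have been performed:\<close>

primrec available :: "('s, 'm) monoid_scheme \<Rightarrow> nat \<Rightarrow> 's operand \<Rightarrow> bool" where
  "available S k (Input s) \<longleftrightarrow> s \<in> carrier S"
| "available S k (Constant c) \<longleftrightarrow> True"
| "available S k (Result i) \<longleftrightarrow> i < k"

definition wf_program :: "('s, 'm) monoid_scheme \<Rightarrow> 's program \<Rightarrow> bool" where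
  "wf_program S p \<longleftrightarrow>
    (\<forall>k < length p. case p ! k of (u, v, z) \<Rightarrow>
      available S k u \<and> available S k v \<and> available S k z)"

text \<open>
  The program, including its constants and the places where the outputs are found, may depend on
  \<open>S\<close> and \<open>Y\<close> but not on \<open>f\<close>.
\<close>

definition computes_ft :: "('s, 'm) monoid_scheme \<Rightarrow> 's rep set \<Rightarrow> 's program \<Rightarrow> bool" where
  "computes_ft S Y p \<longleftrightarrow>
    wf_program S p \<and>
    (\<forall>\<rho> \<in> Y. \<forall>i < rep_dim \<rho>. \<forall>j < rep_dim \<rho>.
      \<exists>out. available S (length p) out \<and>
        (\<forall>f \<in> salg_carrier S.
          operand_value f (run f p) out = fourier_transform S Y f \<rho> $$ (i, j)))"

text \<open>
  A program performs the same number of operations on every input \<open>f\<close>, so the maximum over \<open>f\<close> is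
  its length. With values in \<^typ>\<open>enat\<close>, the infimum of the empty set is infinite, and an infimum of
  a nonempty set is attained.
\<close>

definition ft_cost :: "('s, 'm) monoid_scheme \<Rightarrow> 's rep set \<Rightarrow> enat" where
  "ft_cost S Y = (INF p \<in> {p. computes_ft S Y p}. enat (length p))"

definition ft_complexity :: "('s, 'm) monoid_scheme \<Rightarrow> enat" where
  "ft_complexity S = (INF Y \<in> {Y. complete_irreps S Y}. ft_cost S Y)"

end

theory Submission
  imports Defs "HOL-Computational_Algebra.Fundamental_Theorem_Algebra" "HOL-Library.Poly_Mapping" "HOL-Combinatorics.Perm"
begin

text \<open>
  Restricting partial injections identifies the algebra of the rook monoid with a sum of matrix
  algebras over the group algebras of the symmetric groups \<open>S\<^sub>k\<close>, with one block for each pair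
  \<open>(A, B)\<close> of \<open>k\<close>-element subsets; the change of basis is a zeta transform for the order by
  restriction, which costs \<open>O(n\<^sup>2)\<close> operations per element when the points of the domain are treated
  one after the other. It remains to compute Fourier transforms on \<open>S\<^sub>k\<close> with \<open>k\<^sup>3 k!\<close> operations.

  For this, bases adapted to the chain of symmetric groups are chosen by splitting minimal projections
  of \<open>\<complex>S\<^sub>k\<close> into minimal projections of the next group algebra. Basis vectors are then
  paths in a Bratteli diagram, and the transposition \<open>\<sigma>\<close> of the last two points, which commutes with
  the group two levels below, has few nonzero entries. Transforming a module induced from
  \<open>S\<^sub>k\<close> to the next group reduces, by \<open>S\<^sub>k\<^sub>+\<^sub>1 = S\<^sub>k \<union> S\<^sub>k\<sigma>S\<^sub>k\<close>, to
  the same problem one level down followed by a sparse step, and dimension counts in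
  place of the explicit branching rule bound the number of terms.

  Since \<open>ln |R\<^sub>n| \<ge> n ln 2\<close>, the resulting \<open>O(n\<^sup>3 |R\<^sub>n|)\<close> suffices.
\<close>


subsection \<open>Straight-line programs\<close>

text \<open>The complexity is a minimum over all complete sets, so bases may be chosen at will and
  no explicit matrices for the symmetric groups enter. Left ideals of minimal projections serve as
  simple modules and elements \<open>p * x * q\<close> as homomorphisms, so Schur's lemma is built
  into \<open>minimal\<close>; semisimplicity comes from positivity of the involution. Matrices
  appear only when the resulting matrix coefficients have to be shown to give a complete set.

  The obstacle is sparsity. A step of the transform costs one operation for each way to pass from
  one label to another through a common label one level below, and without the branching rule it is
  not clear that there are few such ways. A bound linear in \<open>n\<close> is obtained from the
  dimensions alone.

  The exponent 3 has the following origin. A module induced from level \<open>n\<close> has at most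
  \<open>n + 1\<close> outputs per dimension of the original module, each a sum of at most
  \<open>n + 1\<close> terms. This quadratic cost is paid on every level; summing over paths then
  meets only the sum of the squared dimensions, which is at most \<open>n!\<close>.\<close>

definition computes :: "('s, 'm) monoid_scheme \<Rightarrow> 's program \<Rightarrow> (('s \<Rightarrow> complex) \<Rightarrow> complex) \<Rightarrow> bool" where
  "computes S p v \<longleftrightarrow> (\<exists>out. available S (length p) out \<and>
     (\<forall>f \<in> salg_carrier S. operand_value f (run f p) out = v f))"

text \<open>Quantifying over every prefix \<open>p\<close> makes costs composable: values computed
  once stay available, so the bounds of consecutive stages add even when the stages share
  intermediate results. Only the appended part \<open>q\<close> is charged.\<close>

definition ext_cost :: "('s, 'm) monoid_scheme \<Rightarrow> nat \<Rightarrow> (('s \<Rightarrow> complex) \<Rightarrow> complex) set \<Rightarrow>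
    (('s \<Rightarrow> complex) \<Rightarrow> complex) set \<Rightarrow> bool" where
  "ext_cost S c V W \<longleftrightarrow>
     (\<forall>p. wf_program S p \<and> (\<forall>v \<in> V. computes S p v) \<longrightarrow>
       (\<exists>q. wf_program S (p @ q) \<and> length q \<le> c \<and> (\<forall>w \<in> W. computes S (p @ q) w)))"

lemma run_from_append: "run_from f rs (p @ q) = run_from f (run_from f rs p) q"
  by (induction f rs p rule: run_from.induct) auto

lemma run_from_extends: "\<exists>ys. run_from f rs p = rs @ ys \<and> length ys = length p"
proof (induction f rs p rule: run_from.induct)
  case (2 f rs u v z p)
  then show ?case by force
qed simp

lemma length_run: "length (run f p) = length p"
  using run_from_extends[of f "[]" p] by (auto simp: run_def)

lemma run_append: "\<exists>ys. run f (p @ q) = run f p @ ys"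
  using run_from_extends[of f "run f p" q] by (auto simp: run_def run_from_append)

lemma available_mono: "available S k x \<Longrightarrow> k \<le> l \<Longrightarrow> available S l x"
  by (cases x) auto

lemma operand_value_append:
  "available S (length p) x \<Longrightarrow> operand_value f (run f (p @ q)) x = operand_value f (run f p) x"
  using run_append[of f p q] by (cases x) (auto simp: nth_append length_run)

lemma computes_append: "computes S p v \<Longrightarrow> computes S (p @ q) v"
  unfolding computes_def
  by (metis operand_value_append available_mono length_append le_add1)

lemma ext_cost_mono:
  "ext_cost S c V W \<Longrightarrow> V \<subseteq> V' \<Longrightarrow> W' \<subseteq> W \<Longrightarrow> c \<le> c' \<Longrightarrow> ext_cost S c' V' W'"
  unfolding ext_cost_def by (meson order_trans subsetD)

lemma ext_cost_subset: "W \<subseteq> V \<Longrightarrow> ext_cost S c V W"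
  unfolding ext_cost_def by (intro allI impI exI[of _ "[]"]) auto

lemma ext_cost_trans:
  assumes "ext_cost S c V W" and "ext_cost S d (V \<union> W) U"
  shows "ext_cost S (c + d) V (V \<union> W \<union> U)"
  unfolding ext_cost_def
proof (intro allI impI)
  fix p assume p: "wf_program S p \<and> (\<forall>v\<in>V. computes S p v)"
  then obtain q where q: "wf_program S (p @ q)" "length q \<le> c" "\<forall>w\<in>W. computes S (p @ q) w"
    using assms(1) unfolding ext_cost_def by blast
  have "\<forall>v\<in>V \<union> W. computes S (p @ q) v"
    using p q(3) computes_append by blast
  then obtain r where r: "wf_program S ((p @ q) @ r)" "length r \<le> d"
      "\<forall>w\<in>U. computes S ((p @ q) @ r) w"
    using assms(2) q(1) unfolding ext_cost_def by blast
  then have "\<forall>w\<in>V \<union> W \<union> U. computes S ((p @ q) @ r) w"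
    using \<open>\<forall>v\<in>V \<union> W. _ v\<close> computes_append by blast
  then show "\<exists>q. wf_program S (p @ q) \<and> length q \<le> c + d \<and> (\<forall>w\<in>V \<union> W \<union> U. computes S (p @ q) w)"
    using r q(2) by (intro exI[of _ "q @ r"]) auto
qed

lemma ext_cost_UN:
  assumes "finite I" and "\<And>i. i \<in> I \<Longrightarrow> ext_cost S (c i) V (W i)"
  shows "ext_cost S (\<Sum>i\<in>I. c i) V (\<Union>i\<in>I. W i)"
  using assms
proof (induction I rule: finite_induct)
  case empty
  then show ?case by (auto intro: ext_cost_subset)
next
  case (insert i I)
  have "ext_cost S (c i) (V \<union> (\<Union>i\<in>I. W i)) (W i)"
    using insert.prems by (blast intro: ext_cost_mono)
  from ext_cost_trans[OF insert.IH this] show ?case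
    using insert by (auto intro: ext_cost_mono simp: add.commute)
qed

text \<open>An operation \<open>u * v + z\<close> with constant \<open>u\<close> adds one term to
  the running sum, and the empty sum is the constant 0, which is free. Hence exactly one operation
  per term.\<close>

lemma ext_cost_lincomb:
  assumes "finite J" and "\<And>j. j \<in> J \<Longrightarrow> v j \<in> V"
  shows "ext_cost S (card J) V {\<lambda>f. \<Sum>j\<in>J. k j * v j f}"
  using assms
proof (induction J rule: finite_induct)
  case empty
  have "computes S p (\<lambda>f. 0)" for p
    unfolding computes_def by (rule exI[of _ "Constant 0"]) auto
  then show ?case unfolding ext_cost_def by (auto intro: exI[of _ "[]"])
next
  case (insert i J)
  let ?s = "\<lambda>f. \<Sum>j\<in>J. k j * v j f"
  have "ext_cost S 1 (V \<union> {?s}) {\<lambda>f. \<Sum>j\<in>insert i J. k j * v j f}"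
    unfolding ext_cost_def
  proof (intro allI impI)
    fix p assume p: "wf_program S p \<and> (\<forall>v\<in>V \<union> {?s}. computes S p v)"
    then obtain x y where x: "available S (length p) x"
        "\<And>f. f \<in> salg_carrier S \<Longrightarrow> operand_value f (run f p) x = v i f"
      and y: "available S (length p) y"
        "\<And>f. f \<in> salg_carrier S \<Longrightarrow> operand_value f (run f p) y = ?s f"
      using insert.prems[of i] by (fastforce simp: computes_def)
    let ?p = "p @ [(Constant (k i), x, y)]"
    have "wf_program S ?p"
      using p x y unfolding wf_program_def by (auto simp: nth_append less_Suc_eq)
    moreover have "run f ?p = run f p @ [k i * operand_value f (run f p) x + operand_value f (run f p) y]" for f
      by (simp add: run_def run_from_append)
    then have "computes S ?p (\<lambda>f. \<Sum>j\<in>insert i J. k j * v j f)"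
      unfolding computes_def using x y insert.hyps
      by (intro exI[of _ "Result (length p)"]) (auto simp: nth_append length_run)
    ultimately show "\<exists>q. wf_program S (p @ q) \<and> length q \<le> 1 \<and>
        (\<forall>w\<in>{\<lambda>f. \<Sum>j\<in>insert i J. k j * v j f}. computes S (p @ q) w)"
      by (intro exI[of _ "[(Constant (k i), x, y)]"]) auto
  qed
  moreover have "ext_cost S (card J) V {?s}" using insert by auto
  ultimately show ?case
    using ext_cost_trans[of S "card J" V "{?s}" 1] insert.hyps
    by (force intro: ext_cost_mono)
qed

lemma ft_cost_le:
  assumes "ext_cost S c ((\<lambda>s f. f s) ` carrier S) W"
    and "\<And>\<rho> i j. \<lbrakk>\<rho> \<in> Y; i < rep_dim \<rho>; j < rep_dim \<rho>\<rbrakk> \<Longrightarrow>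
      (\<lambda>f. fourier_transform S Y f \<rho> $$ (i, j)) \<in> W"
  shows "ft_cost S Y \<le> enat c"
proof -
  have "wf_program S []" by (simp add: wf_program_def)
  moreover have "computes S [] v" if v: "v \<in> (\<lambda>s f. f s) ` carrier S" for v
  proof -
    obtain s where "s \<in> carrier S" "v = (\<lambda>f. f s)" using v by blast
    then show ?thesis unfolding computes_def by (intro exI[of _ "Input s"]) auto
  qed
  ultimately obtain q where q: "wf_program S q" "length q \<le> c" "\<forall>w\<in>W. computes S q w"
    using assms(1) unfolding ext_cost_def by (metis append_Nil)
  then have "computes_ft S Y q"
    using assms(2) unfolding computes_ft_def computes_def by fast
  then show ?thesis
    unfolding ft_cost_def using q(2) by (meson INF_lower2 enat_ord_simps(1) mem_Collect_eq)
qed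


subsection \<open>Minimal projections in finite-dimensional star-algebras\<close>

text \<open>The last axiom is positivity of the involution. It excludes nilpotents among normal
  elements and makes normal idempotents self-adjoint, and is thereby the source of
  semisimplicity.\<close>

locale star_algebra = vector_space scl for scl :: "complex \<Rightarrow> 'r::ring_1 \<Rightarrow> 'r" (infixr \<open>*s\<close> 75) +
  fixes st :: "'r \<Rightarrow> 'r"
  assumes scl_mult_left [simp]: "(c *s x) * y = c *s (x * y)"
    and scl_mult_right [simp]: "x * (c *s y) = c *s (x * y)"
    and st_add [simp]: "st (x + y) = st x + st y"
    and st_mult [simp]: "st (x * y) = st y * st x"
    and st_st [simp]: "st (st x) = x"
    and st_scl [simp]: "st (c *s x) = cnj c *s st x"
    and st_mult_self_eq_0: "st x * x = 0 \<Longrightarrow> x = 0"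
begin

lemma st_0 [simp]: "st 0 = 0"
  using st_add[of 0 0] by (simp del: st_add)

lemma st_minus [simp]: "st (- x) = - st x"
  using st_add[of x "- x"] by (simp add: add_eq_0_iff2 del: st_add)

lemma st_diff [simp]: "st (x - y) = st x - st y"
  using st_add[of x "- y"] by simp

definition subalgebra :: "'r set \<Rightarrow> bool" where
  "subalgebra B \<longleftrightarrow> 1 \<in> B \<and> (\<forall>x\<in>B. \<forall>y\<in>B. x + y \<in> B \<and> x * y \<in> B) \<and>
     (\<forall>c. \<forall>x\<in>B. c *s x \<in> B) \<and> (\<forall>x\<in>B. st x \<in> B) \<and> (\<exists>F. finite F \<and> B \<subseteq> span F)"

lemma subalgebraD:
  assumes "subalgebra B"
  shows "1 \<in> B" and "\<And>x y. x \<in> B \<Longrightarrow> y \<in> B \<Longrightarrow> x + y \<in> B"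
    and "\<And>x y. x \<in> B \<Longrightarrow> y \<in> B \<Longrightarrow> x * y \<in> B" and "\<And>c x. x \<in> B \<Longrightarrow> c *s x \<in> B"
    and "\<And>x. x \<in> B \<Longrightarrow> st x \<in> B" and "\<And>x y. x \<in> B \<Longrightarrow> y \<in> B \<Longrightarrow> x - y \<in> B"
    and "0 \<in> B" and "\<exists>F. finite F \<and> B \<subseteq> span F"
proof -
  show *: "1 \<in> B" "\<And>x y. x \<in> B \<Longrightarrow> y \<in> B \<Longrightarrow> x + y \<in> B"
    "\<And>x y. x \<in> B \<Longrightarrow> y \<in> B \<Longrightarrow> x * y \<in> B" "\<And>c x. x \<in> B \<Longrightarrow> c *s x \<in> B"
    "\<And>x. x \<in> B \<Longrightarrow> st x \<in> B" "\<exists>F. finite F \<and> B \<subseteq> span F"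
    using assms by (auto simp: subalgebra_def)
  show "0 \<in> B" using *(4)[of 1 0] *(1) by simp
  show "x - y \<in> B" if "x \<in> B" "y \<in> B" for x y
    using *(2)[OF that(1) *(4)[OF that(2), of "-1"]] by simp
qed

definition projection :: "'r \<Rightarrow> bool" where
  "projection p \<longleftrightarrow> st p = p \<and> p * p = p"

text \<open>The corner \<open>p * B * p\<close> is the endomorphism ring of the left ideal of
  \<open>p\<close>; demanding that it be the scalars is Schur's lemma for a simple module over the
  complex numbers.\<close>

definition minimal :: "'r set \<Rightarrow> 'r \<Rightarrow> bool" where
  "minimal B p \<longleftrightarrow> p \<in> B \<and> projection p \<and> p \<noteq> 0 \<and> (\<forall>x\<in>B. \<exists>c. p * x * p = c *s p)"

text \<open>Multiplying a linear relation by \<open>l i\<close> on the left and \<open>r i\<close>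
  on the right isolates the coefficient of \<open>w i\<close>, so the \<open>w i\<close> are
  independent. This bounds both the size of orthogonal families of projections and the dimensions of
  induced modules.\<close>

lemma biorthogonal_card_le:
  assumes "finite I" and "finite F" and "\<And>i. i \<in> I \<Longrightarrow> w i \<in> span F"
    and nz: "\<And>i. i \<in> I \<Longrightarrow> l i * w i * r i \<noteq> 0"
    and z: "\<And>i j. i \<in> I \<Longrightarrow> j \<in> I \<Longrightarrow> i \<noteq> j \<Longrightarrow> l i * w j * r i = 0"
  shows "card I \<le> card F"
proof -
  have inj: "inj_on w I"
    using nz z by (metis inj_onI)
  have "independent (w ` I)"
  proof
    assume "dependent (w ` I)"
    then obtain u i where i: "i \<in> I" "u (w i) \<noteq> 0" and s: "(\<Sum>v\<in>w ` I. u v *s v) = 0"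
      using \<open>finite I\<close> by (auto simp: dependent_finite)
    have "0 = l i * (\<Sum>j\<in>I. u (w j) *s w j) * r i"
      using s inj by (simp add: sum.reindex)
    also have "\<dots> = (\<Sum>j\<in>I. u (w j) *s (l i * w j * r i))"
      by (simp add: sum_distrib_left sum_distrib_right)
    also have "\<dots> = (\<Sum>j\<in>I. if j = i then u (w i) *s (l i * w i * r i) else 0)"
      using z i by (intro sum.cong) auto
    also have "\<dots> = u (w i) *s (l i * w i * r i)"
      using i \<open>finite I\<close> by simp
    finally show False using i nz by auto
  qed
  moreover have "w ` I \<subseteq> span F" using assms by auto
  ultimately have "card (w ` I) \<le> card F"
    using independent_span_bound[OF \<open>finite F\<close>] by blast
  then show ?thesis using inj by (simp add: card_image)
qed

text \<open>Evaluation takes place in the corner algebra with unit \<open>p\<close>, so the constant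
  term is multiplied by \<open>p\<close> instead of 1.\<close>

definition peval :: "'r \<Rightarrow> 'r \<Rightarrow> complex poly \<Rightarrow> 'r" where
  "peval p a P = fold_coeffs (\<lambda>c z. c *s p + a * z) P 0"

lemma peval_0 [simp]: "peval p a 0 = 0"
  by (simp add: peval_def)

lemma peval_pCons [simp]: "peval p a (pCons c P) = c *s p + a * peval p a P"
  by (cases "c = 0 \<and> P = 0") (auto simp: peval_def)

lemma peval_add [simp]: "peval p a (P + Q) = peval p a P + peval p a Q"
  by (induction P Q rule: poly_induct2) (simp_all add: algebra_simps scale_left_distrib)

lemma peval_smult [simp]: "peval p a (smult c P) = c *s peval p a P"
  by (induction P) (simp_all add: scale_right_distrib)

lemma peval_sum: "peval p a (\<Sum>i\<in>I. P i) = (\<Sum>i\<in>I. peval p a (P i))"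
  by (induction I rule: infinite_finite_induct) auto

lemma peval_diff [simp]: "peval p a (P - Q) = peval p a P - peval p a Q"
  by (metis add_diff_cancel_right' diff_add_cancel peval_add)

lemma peval_linear_factor: "peval p a ([:-l, 1:] * Q) = a * peval p a Q - l *s peval p a Q"
  by (simp add: mult_pCons_left)

lemma peval_commute:
  assumes "z * p = p * z" and "z * a = a * z"
  shows "z * peval p a P = peval p a P * z"
proof (induction P)
  case (pCons c P)
  have "z * (a * peval p a P) = a * peval p a P * z"
    by (metis assms(2) mult.assoc pCons.IH)
  then show ?case using assms(1) by (simp add: algebra_simps)
qed simp

lemma peval_in:
  assumes "subalgebra B" and "p \<in> B" and "a \<in> B"
  shows "peval p a P \<in> B"
  by (induction P) (auto intro!: subalgebraD[OF assms(1)] assms)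

text \<open>Otherwise evaluation would be injective, and the first \<open>card F + 1\<close> powers
  would be independent inside the span of \<open>F\<close>.\<close>

lemma peval_annihilator:
  assumes "subalgebra B" and "p \<in> B" and "a \<in> B"
  obtains P where "P \<noteq> 0" and "peval p a P = 0"
proof (rule ccontr)
  assume "\<not> thesis"
  with that have nz: "P = 0" if "peval p a P = 0" for P
    using \<open>peval p a P = 0\<close> by blast
  obtain F where F: "finite F" "B \<subseteq> span F" using assms(1) subalgebraD(8) by blast
  define w where "w i = peval p a (monom 1 i)" for i
  have inj: "inj_on w {..card F}"
  proof (rule inj_onI)
    fix i j assume "w i = w j"
    then have "peval p a (monom 1 i + smult (-1) (monom 1 j)) = 0"
      unfolding peval_add peval_smult w_def by simp
    then have "monom (1::complex) i + smult (-1) (monom 1 j) = 0" by (rule nz)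
    then have "monom (1::complex) i = monom 1 j" by simp
    then show "i = j" by (metis degree_monom_eq zero_neq_one)
  qed
  have "independent (w ` {..card F})"
  proof
    assume "dependent (w ` {..card F})"
    then obtain u i where i: "i \<le> card F" "u (w i) \<noteq> 0" and s: "(\<Sum>v\<in>w ` {..card F}. u v *s v) = 0"
      by (auto simp: dependent_finite)
    have "0 = (\<Sum>j\<le>card F. u (w j) *s w j)"
      using s inj by (simp add: sum.reindex)
    also have "\<dots> = peval p a (\<Sum>j\<le>card F. smult (u (w j)) (monom 1 j))"
      by (simp only: peval_sum peval_smult w_def)
    finally have "(\<Sum>j\<le>card F. smult (u (w j)) (monom 1 j)) = 0" by (metis nz)
    then have "coeff (\<Sum>j\<le>card F. smult (u (w j)) (monom 1 j)) i = 0" by simp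
    then show False using i by (simp add: coeff_sum if_distrib cong: if_cong)
  qed
  moreover have "w ` {..card F} \<subseteq> span F" using F(2) peval_in[OF assms] by (auto simp: w_def)
  ultimately have "card (w ` {..card F}) \<le> card F"
    using independent_span_bound[OF F(1)] by blast
  then show False using inj by (simp add: card_image)
qed

text \<open>If \<open>y = p * x * p\<close> is not a scalar multiple of \<open>p\<close>, then
  neither can both of its self-adjoint parts \<open>h\<close> and \<open>k\<close> be, because
  \<open>2 *s y = h - \<i> *s k\<close>.\<close>

lemma nonminimal_selfadjoint:
  assumes B: "subalgebra B" and p: "p \<in> B" "projection p" "p \<noteq> 0" "\<not> minimal B p"
  obtains a where "a \<in> B" "st a = a" "p * a = a" "a * p = a" "\<And>c. a \<noteq> c *s p"
proof -
  note cl = subalgebraD[OF B]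
  have pp: "st p = p" "p * p = p" using p by (auto simp: projection_def)
  obtain x where x: "x \<in> B" "\<And>c. p * x * p \<noteq> c *s p" using p by (auto simp: minimal_def)
  define y where "y = p * x * p"
  have y: "y \<in> B" "p * y = y" "y * p = y" unfolding y_def using cl p x
    by (auto simp: pp mult.assoc simp flip: mult.assoc) (simp add: mult.assoc pp)
  have y': "p * st y = st y" "st y * p = st y" using y(2,3) pp by (metis st_mult)+
  define h where "h = y + st y"
  define k where "k = \<i> *s (y - st y)"
  have hk: "h \<in> B" "st h = h" "p * h = h" "h * p = h" "k \<in> B" "st k = k" "p * k = k" "k * p = k"
    using cl y y' by (auto simp: h_def k_def algebra_simps)
  have "\<not> (\<exists>c d. h = c *s p \<and> k = d *s p)"
  proof
    assume "\<exists>c d. h = c *s p \<and> k = d *s p"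
    then obtain c d where "h = c *s p" "k = d *s p" by blast
    moreover have "h - \<i> *s k = 2 *s y"
      by (simp add: h_def k_def scale_left_distrib[of 1 1, simplified])
    ultimately have "2 *s y = (c - \<i> * d) *s p"
      by (simp add: scale_left_diff_distrib)
    then have "(1/2) *s (2 *s y) = (1/2) *s ((c - \<i> * d) *s p)" by simp
    then have "y = ((c - \<i> * d) / 2) *s p" by simp
    then show False using x(2) unfolding y_def by metis
  qed
  then show ?thesis using that hk by blast
qed

text \<open>With \<open>n = st q * q\<close>, normality gives
  \<open>n * q = st q * n = n * n = n\<close>. Hence \<open>st (q - n) * (q - n) = 0\<close>, and
  positivity yields \<open>q = n\<close>, which is self-adjoint.\<close>

lemma normal_idempotent_selfadjoint:
  assumes "q * q = q" and "st q * q = q * st q"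
  shows "st q = q"
proof -
  define n where "n = st q * q"
  have qq: "st q * st q = st q" using assms(1) by (metis st_mult)
  have n: "n * q = n" "st q * n = n" "n * n = n"
    unfolding n_def using assms qq by (metis mult.assoc)+
  have "st (q - n) * (q - n) = 0"
    using n by (simp add: n_def algebra_simps)
  then have "q = n" using st_mult_self_eq_0[of "q - n"] by simp
  moreover have "st n = n" by (simp add: n_def)
  ultimately show ?thesis by simp
qed

text \<open>
  A self-adjoint element \<open>a\<close> of the corner of \<open>p\<close> that is not a multiple of \<open>p\<close> has a minimal polynomial
  \<open>(X - l) Q\<close>. Then \<open>w = Q(a)\<close> is an eigenvector, \<open>w * w\<close> is a multiple of \<open>w\<close>, nonzero by
  normality, and \<open>w\<close> can be rescaled to a projection.
\<close>

lemma split_projection: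
  assumes B: "subalgebra B" and p: "p \<in> B" "projection p" "p \<noteq> 0" "\<not> minimal B p"
  obtains q where "q \<in> B" "projection q" "q \<noteq> 0" "q \<noteq> p" "p * q = q" "q * p = q"
proof -
  note cl = subalgebraD[OF B]
  have pp: "st p = p" "p * p = p" using p by (auto simp: projection_def)
  obtain a where a: "a \<in> B" "st a = a" "p * a = a" "a * p = a" "\<And>c. a \<noteq> c *s p"
    using nonminimal_selfadjoint[OF assms] by blast
  let ?e = "peval p a"
  have ep: "p * ?e P = ?e P" "?e P * p = ?e P" for P
  proof -
    show 1: "p * ?e P = ?e P"
      by (induction P) (simp_all add: algebra_simps pp a flip: mult.assoc)
    then show "?e P * p = ?e P"
      using peval_commute[of p p a P] a by simp
  qed
  have ea: "?e P * a = a * ?e P" for P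
    using peval_commute[of a p a P] a by simp
  \<comment> \<open>As \<open>a\<close> and \<open>p\<close> are self-adjoint, the adjoint of
    \<open>?e P\<close> commutes with them too, and therefore with every polynomial in
    \<open>a\<close>.\<close>
  have normal: "st (?e P) * ?e P = ?e P * st (?e P)" for P
    by (rule peval_commute; metis a(2) ea ep pp(1) st_mult)
  obtain P where P: "P \<noteq> 0" "?e P = 0" and least: "\<And>Q. Q \<noteq> 0 \<Longrightarrow> ?e Q = 0 \<Longrightarrow> degree P \<le> degree Q"
    using peval_annihilator[OF B p(1) a(1)] ex_has_least_nat[of "\<lambda>P. P \<noteq> 0 \<and> ?e P = 0" _ degree] by metis
  have "degree P \<noteq> 0"
  proof
    assume "degree P = 0"
    then obtain c where "P = [:c:]" by (metis degree_eq_zeroE)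
    then show False using P p by auto
  qed
  then obtain l where "poly P l = 0"
    using fundamental_theorem_of_algebra[of P] by (auto simp: constant_degree)
  then obtain Q where Q: "P = [:-l, 1:] * Q" by (metis dvdE poly_eq_0_iff_dvd)
  then have "Q \<noteq> 0" using P by auto
  moreover have "degree P = Suc (degree Q)"
    using \<open>Q \<noteq> 0\<close> unfolding Q by (subst degree_mult_eq) auto
  ultimately have w0: "?e Q \<noteq> 0" using least[of Q] by auto
  define w where "w = ?e Q"
  have aw: "a * w = l *s w" using P(2) by (simp only: Q peval_linear_factor w_def) simp
  have "?e R * w = poly R l *s w" for R
    by (induction R) (simp_all add: scale_left_distrib mult.assoc aw algebra_simps ep w_def[symmetric],
        simp add: w_def ep)
  then have ww: "w * w = poly Q l *s w" using w_def by metis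
  have "w * w \<noteq> 0"
  proof
    assume "w * w = 0"
    then have "st (st w * w) * (st w * w) = 0"
      using normal[of Q] by (simp add: w_def mult.assoc) (metis mult.assoc mult_zero_right)
    then show False using st_mult_self_eq_0 w0 w_def by blast
  qed
  then have c: "poly Q l \<noteq> 0" using ww by auto
  define q where "q = (1 / poly Q l) *s w"
  have "q * q = q" using c ww by (simp add: q_def)
  moreover have "st q * q = q * st q" using normal[of Q] by (simp add: q_def w_def)
  ultimately have "projection q" using normal_idempotent_selfadjoint by (simp add: projection_def)
  moreover have "q \<in> B" using cl peval_in[OF B p(1) a(1)] by (simp add: q_def w_def)
  moreover have "q \<noteq> 0" using c w0 by (simp add: q_def w_def)
  moreover have "p * q = q" "q * p = q" using ep by (simp_all add: q_def w_def)
  moreover have "q \<noteq> p"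
  proof
    assume "q = p"
    then have "a = l *s p" using aw a(4) by (metis q_def scale_left_commute scl_mult_right)
    then show False using a(5) by blast
  qed
  ultimately show thesis using that by blast
qed

text \<open>Among the orthogonal families of nonzero projections with sum \<open>p\<close>, whose
  sizes are bounded by the dimension, take a largest one. A member that is not minimal could be
  split in two, giving a larger family.\<close>

lemma minimal_decomposition:
  assumes B: "subalgebra B" and p: "p \<in> B" "projection p" "p \<noteq> 0"
  obtains Q where "finite Q" "\<And>q. q \<in> Q \<Longrightarrow> minimal B q \<and> p * q = q \<and> q * p = q"
    "\<And>q q'. q \<in> Q \<Longrightarrow> q' \<in> Q \<Longrightarrow> q \<noteq> q' \<Longrightarrow> q * q' = 0" "\<Sum>Q = p"
proof -
  note cl = subalgebraD[OF B]
  define good where "good Q \<longleftrightarrow> finite Q \<and> (\<forall>q\<in>Q. q \<in> B \<and> projection q \<and> q \<noteq> 0 \<and> p * q = q \<and> q * p = q) \<and>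
      (\<forall>q\<in>Q. \<forall>q'\<in>Q. q \<noteq> q' \<longrightarrow> q * q' = 0) \<and> \<Sum>Q = p" for Q
  obtain F where F: "finite F" "B \<subseteq> span F" using cl(8) by blast
  have "card Q \<le> card F" if "good Q" for Q
    using that F by (intro biorthogonal_card_le[of Q F "\<lambda>x. x" "\<lambda>x. x" "\<lambda>x. x"])
      (auto simp: good_def projection_def)
  moreover have "good {p}" using p by (auto simp: good_def projection_def)
  ultimately obtain Q where Q: "good Q" and max: "\<And>Q'. good Q' \<Longrightarrow> card Q' \<le> card Q"
    using ex_has_greatest_nat[of good "{p}" card "Suc (card F)"] by (metis le_imp_less_Suc)
  have "minimal B q" if q: "q \<in> Q" for q
  proof (rule ccontr)
    assume "\<not> minimal B q"
    then obtain r where r: "r \<in> B" "projection r" "r \<noteq> 0" "r \<noteq> q" "q * r = r" "r * q = r"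
      using split_projection[OF B, of q] Q q by (auto simp: good_def)
    have qq: "q \<in> B" "st q = q" "q * q = q" "p * q = q" "q * p = q"
      and fin: "finite Q" using Q q by (auto simp: good_def projection_def)
    have rr: "st r = r" "r * r = r" using r by (auto simp: projection_def)
    define s where "s = q - r"
    have s: "s \<in> B" "projection s" "s \<noteq> 0" "p * s = s" "s * p = s" "p * r = r" "r * p = r"
       "q * s = s" "s * q = s" "r * s = 0" "s * r = 0"
      using cl qq r rr by (auto simp: s_def projection_def algebra_simps)
        (metis mult.assoc r(5,6) qq(4,5))+
    have orth: "q' * r = 0" "q' * s = 0" "r * q' = 0" "s * q' = 0" if "q' \<in> Q" "q' \<noteq> q" for q'
    proof -
      have "q' * q = 0" "q * q' = 0" using Q that q by (auto simp: good_def)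
      then show "q' * r = 0" "q' * s = 0" "r * q' = 0" "s * q' = 0"
        using r(5,6) s(8,9) by (metis mult.assoc mult_zero_left mult_zero_right)+
    qed
    have nr: "r \<notin> Q - {q}" "s \<notin> Q - {q}" using orth(1)[of r] orth(2)[of s] r s rr
      by (auto simp: projection_def)
    have rs: "r \<noteq> s" using s(10) rr r(3) by auto
    define Q' where "Q' = insert r (insert s (Q - {q}))"
    have "\<Sum>Q' = r + (s + \<Sum>(Q - {q}))" unfolding Q'_def using nr rs fin by simp
    also have "\<dots> = \<Sum>Q" using sum.remove[OF fin q, of "\<lambda>x. x"] by (simp add: s_def)
    finally have "good Q'" using Q r s orth unfolding good_def Q'_def by auto
    moreover have "card Q' = Suc (card Q)"
    proof -
      define K where "K = Q - {q}"
      have "card Q = Suc (card K)" unfolding K_def by (rule card.remove[OF fin q])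
      moreover have "Q' = insert r (insert s K)" "r \<notin> K" "s \<notin> K" "finite K"
        using nr fin by (simp_all only: Q'_def K_def finite_Diff) simp_all
      ultimately show ?thesis using rs by simp
    qed
    ultimately show False using max by force
  qed
  then show thesis using Q by (intro that[of Q]) (simp_all add: good_def)
qed

section \<open>Isomorphisms between minimal projections\<close>

lemma minimal_corner_scalar:
  "minimal B p \<Longrightarrow> x \<in> B \<Longrightarrow> p * x = x \<Longrightarrow> x * p = x \<Longrightarrow> \<exists>c. x = c *s p"
  unfolding minimal_def by metis

text \<open>By minimality \<open>st x * x = c *s q\<close> and \<open>x * st x = d *s p\<close>.
  Evaluating \<open>x * st x * x\<close> in two ways gives \<open>c = d\<close>, nonzero by
  positivity, so \<open>st x\<close> divided by \<open>c\<close> is the inverse. Every nonzero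
  homomorphism is thus an isomorphism.\<close>

lemma minimal_isometry:
  assumes B: "subalgebra B" and p: "minimal B p" and q: "minimal B q"
    and x: "x \<in> B" "p * x = x" "x * q = x" "x \<noteq> 0"
  obtains y where "y \<in> B" "q * y = y" "y * p = y" "y * x = q" "x * y = p"
proof -
  note cl = subalgebraD[OF B]
  have pp: "st p = p" "p * p = p" "p \<in> B" and qq: "st q = q" "q * q = q" "q \<in> B"
    using p q by (auto simp: minimal_def projection_def)
  have x': "q * st x = st x" "st x * p = st x" using x pp qq by (metis st_mult)+
  obtain c where c: "st x * x = c *s q"
    using minimal_corner_scalar[OF q, of "st x * x"] cl x x' by (metis mult.assoc)
  then have c0: "c \<noteq> 0" using st_mult_self_eq_0[of x] x(4) by auto
  obtain d where d: "x * st x = d *s p"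
    using minimal_corner_scalar[OF p, of "x * st x"] cl x x' by (metis mult.assoc)
  have "d *s x = x * st x * x" by (simp add: d x)
  also have "\<dots> = c *s x" by (simp add: mult.assoc c x)
  finally have "d = c" using x(4) by simp
  with c0 c d cl x x' show thesis
    by (intro that[of "(1 / c) *s st x"]) auto
qed

text \<open>This produces one level of the Bratteli diagram. The members of \<open>\<Lambda>\<close>
  come from a smaller algebra and split further in \<open>B\<close>; \<open>tgt\<close> remembers
  the projection that was split, \<open>src\<close> picks a representative of each isomorphism
  class, and \<open>u\<close>, \<open>v\<close> identify a piece with its representative.\<close>

lemma refine_projections:
  assumes B: "subalgebra B" and fin: "finite \<Lambda>"
    and \<Lambda>: "\<And>p. p \<in> \<Lambda> \<Longrightarrow> p \<in> B \<and> projection p \<and> p \<noteq> 0"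
    and orth: "\<And>p p'. p \<in> \<Lambda> \<Longrightarrow> p' \<in> \<Lambda> \<Longrightarrow> p \<noteq> p' \<Longrightarrow> p * p' = 0"
  shows "\<exists>E tgt src u v. finite E \<and>
    (\<forall>q\<in>E. minimal B q \<and> tgt q \<in> \<Lambda> \<and> tgt q * q = q \<and> q * tgt q = q) \<and>
    (\<forall>p\<in>\<Lambda>. \<Sum>{q \<in> E. tgt q = p} = p) \<and>
    (\<forall>q\<in>E. \<forall>q'\<in>E. q \<noteq> q' \<longrightarrow> q * q' = 0) \<and>
    (\<forall>q\<in>E. src q \<in> E \<and> src (src q) = src q) \<and>
    (\<forall>q\<in>E. \<forall>q'\<in>E. src q \<noteq> src q' \<longrightarrow> (\<forall>x\<in>B. src q * x * src q' = 0)) \<and>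
    (\<forall>q\<in>E. u q \<in> B \<and> v q \<in> B \<and> q * u q = u q \<and> u q * src q = u q \<and>
       src q * v q = v q \<and> v q * q = v q \<and> v q * u q = src q \<and> u q * v q = q)"
proof -
  note cl = subalgebraD[OF B]
  let ?split = "\<lambda>p Q. finite Q \<and> (\<forall>q\<in>Q. minimal B q \<and> p * q = q \<and> q * p = q) \<and>
      (\<forall>q\<in>Q. \<forall>q'\<in>Q. q \<noteq> q' \<longrightarrow> q * q' = 0) \<and> \<Sum>Q = p"
  have "\<forall>p\<in>\<Lambda>. \<exists>Q. ?split p Q"
  proof
    fix p assume "p \<in> \<Lambda>"
    with \<Lambda> have "p \<in> B" "projection p" "p \<noteq> 0" by auto
    from minimal_decomposition[OF B this] show "\<exists>Q. ?split p Q" by metis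
  qed
  then obtain Q where "\<forall>p\<in>\<Lambda>. ?split p (Q p)" by metis
  then have Q: "\<And>p. p \<in> \<Lambda> \<Longrightarrow> finite (Q p)" "\<And>p. p \<in> \<Lambda> \<Longrightarrow> \<Sum>(Q p) = p"
     "\<And>p q. p \<in> \<Lambda> \<Longrightarrow> q \<in> Q p \<Longrightarrow> minimal B q \<and> p * q = q \<and> q * p = q"
     "\<And>p q q'. p \<in> \<Lambda> \<Longrightarrow> q \<in> Q p \<Longrightarrow> q' \<in> Q p \<Longrightarrow> q \<noteq> q' \<Longrightarrow> q * q' = 0"
    by auto
  have mul0: "q * q' = 0" if "p \<in> \<Lambda>" "p' \<in> \<Lambda>" "p \<noteq> p'" "q \<in> Q p" "q' \<in> Q p'" for p p' q q'
  proof -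
    have "q * q' = q * p * (p' * q')" using Q(3) that by auto
    also have "\<dots> = q * (p * p') * q'" by (simp add: mult.assoc)
    finally show ?thesis using orth[of p p'] that by simp
  qed
  define E where "E = (\<Union>p\<in>\<Lambda>. Q p)"
  have E: "finite E" using Q(1) fin by (auto simp: E_def)
  have min: "minimal B q" if "q \<in> E" for q using that Q(3) by (auto simp: E_def)
  have qq: "q * q = q" "q \<noteq> 0" "q \<in> B" if "q \<in> E" for q
    using min[OF that] by (auto simp: minimal_def projection_def)
  define tgt where "tgt q = (SOME p. p \<in> \<Lambda> \<and> q \<in> Q p)" for q
  have tgt: "tgt q \<in> \<Lambda> \<and> q \<in> Q (tgt q)" if "q \<in> E" for q
    unfolding tgt_def by (rule someI_ex) (use that in \<open>auto simp: E_def\<close>)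
  have tgt_eq: "tgt q = p" if "p \<in> \<Lambda>" "q \<in> Q p" for p q
    using mul0[of p "tgt q" q q] tgt[of q] that qq[of q] unfolding E_def by (metis UN_I)
  have fib: "{q \<in> E. tgt q = p} = Q p" if "p \<in> \<Lambda>" for p
    using that tgt tgt_eq by (auto simp: E_def)
  have Eorth: "q * q' = 0" if "q \<in> E" "q' \<in> E" "q \<noteq> q'" for q q'
    using tgt[OF that(1)] tgt[OF that(2)] mul0 Q(4) that by metis
  \<comment> \<open>\<open>R\<close> holds when there is a nonzero homomorphism, hence by
    \<open>minimal_isometry\<close> an isomorphism, which is what makes it an equivalence relation
    on \<open>E\<close>.\<close>
  define R where "R q q' \<longleftrightarrow> (\<exists>x\<in>B. q * x * q' \<noteq> 0)" for q q'
  have iso: "\<exists>u v. u \<in> B \<and> v \<in> B \<and> q * u = u \<and> u * q' = u \<and> q' * v = v \<and> v * q = v \<and> v * u = q' \<and> u * v = q"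
    if "q \<in> E" "q' \<in> E" "R q q'" for q q'
  proof -
    obtain x where x: "x \<in> B" "q * x * q' \<noteq> 0" using \<open>R q q'\<close> R_def by blast
    have *: "q * x * q' \<in> B" "q * (q * x * q') = q * x * q'" "q * x * q' * q' = q * x * q'"
      using cl x qq that by (auto simp: mult.assoc) (simp add: qq flip: mult.assoc)
    obtain y where y: "y \<in> B" "q' * y = y" "y * q = y" "y * (q * x * q') = q'" "(q * x * q') * y = q"
      by (rule minimal_isometry[OF B min[OF \<open>q \<in> E\<close>] min[OF \<open>q' \<in> E\<close>] * x(2)])
    show ?thesis
    proof (rule exI[of _ "q * x * q'"], rule exI[of _ y])
      show "q * x * q' \<in> B \<and> y \<in> B \<and> q * (q * x * q') = q * x * q' \<and> q * x * q' * q' = q * x * q' \<and>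
         q' * y = y \<and> y * q = y \<and> y * (q * x * q') = q' \<and> q * x * q' * y = q"
        by (intro conjI; fact * y)
    qed
  qed
  have R_if: "R q q'" if "q \<in> E" "q' \<in> E" "u \<in> B" "v \<in> B" "q * u * q' * v * q = q" for q q' u v
    unfolding R_def using that qq by (intro bexI[of _ u]) auto
  have R_refl: "R q q" if "q \<in> E" for q
    using R_if[of q q 1 1] that cl qq by auto
  have R_sym: "R q' q" if q: "q \<in> E" "q' \<in> E" "R q q'" for q q'
  proof -
    obtain u v where "u \<in> B" "v \<in> B" "q * u = u" "u * q' = u" "q' * v = v" "v * q = v" "v * u = q'"
      using iso[OF q] by blast
    then show ?thesis using R_if[of q' q v u] q qq by (auto simp: mult.assoc)
  qed
  have R_trans: "R q q''" if q: "q \<in> E" "q' \<in> E" "q'' \<in> E" "R q q'" "R q' q''" for q q' q''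
  proof -
    obtain u v where u: "u \<in> B" "v \<in> B" "q * u = u" "u * q' = u" "q' * v = v" "v * q = v" "u * v = q"
      using iso[OF q(1,2,4)] by blast
    obtain u' v' where u': "u' \<in> B" "v' \<in> B" "q' * u' = u'" "u' * q'' = u'" "q'' * v' = v'" "v' * q' = v'"
         "u' * v' = q'"
      using iso[OF q(2,3,5)] by blast
    have "q * (u * u') * q'' * (v' * v) * q = u * (u' * v') * v"
      using u u' by (metis mult.assoc)
    also have "\<dots> = q" using u u' by simp
    finally show ?thesis using R_if[of q q'' "u * u'" "v' * v"] q u u' cl by blast
  qed
  \<comment> \<open>For \<open>R\<close>-related projections the chosen predicates coincide, so
    \<open>src\<close> depends only on the class.\<close>
  define src where "src q = (SOME q'. q' \<in> E \<and> R q q')" for q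
  have src: "src q \<in> E \<and> R q (src q)" if "q \<in> E" for q
    unfolding src_def by (rule someI[of _ q]) (use that R_refl in auto)
  have src_cong: "src q = src q'" if "q \<in> E" "q' \<in> E" "R q q'" for q q'
  proof -
    have "(\<lambda>r. r \<in> E \<and> R q r) = (\<lambda>r. r \<in> E \<and> R q' r)"
      using that R_sym R_trans by (intro ext) meson
    then show ?thesis by (simp add: src_def)
  qed
  have "\<forall>q\<in>E. \<exists>u v. u \<in> B \<and> v \<in> B \<and> q * u = u \<and> u * src q = u \<and> src q * v = v \<and> v * q = v \<and> v * u = src q \<and> u * v = q"
    using iso src by blast
  then obtain u v where uv: "\<forall>q\<in>E. u q \<in> B \<and> v q \<in> B \<and> q * u q = u q \<and> u q * src q = u q \<and>
       src q * v q = v q \<and> v q * q = v q \<and> v q * u q = src q \<and> u q * v q = q"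
    by metis
  have "src q * x * src q' = 0" if "q \<in> E" "q' \<in> E" "src q \<noteq> src q'" "x \<in> B" for q q' x
    using that src src_cong R_def by (metis (no_types, opaque_lifting))
  moreover have "src (src q) = src q" if "q \<in> E" for q
    using that src src_cong by metis
  moreover have "\<forall>q\<in>E. minimal B q \<and> tgt q \<in> \<Lambda> \<and> tgt q * q = q \<and> q * tgt q = q"
    using min tgt Q(3) by blast
  moreover have "\<forall>p\<in>\<Lambda>. \<Sum>{q \<in> E. tgt q = p} = p" using fib Q(2) by simp
  ultimately show ?thesis
    using E Eorth src uv
    by (rule_tac x = E in exI, rule_tac x = tgt in exI, rule_tac x = src in exI,
        rule_tac x = u in exI, rule_tac x = v in exI) (intro conjI; blast)
qed

end


subsection \<open>Towers of group algebras\<close>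

text \<open>The axioms keep just what the fast transform exploits: \<open>t (Suc n)\<close>
  represents the cosets of \<open>G n\<close> in \<open>G (Suc n)\<close>, each representative
  except the last is one from the level below times a single \<open>\<sigma> n\<close>, and
  \<open>\<sigma> (Suc n)\<close> commutes with the group two levels below.\<close>

locale group_tower = star_algebra scl st
  for scl :: "complex \<Rightarrow> 'r::ring_1 \<Rightarrow> 'r" (infixr \<open>*s\<close> 75) and st +
  fixes G :: "nat \<Rightarrow> 'r set" and \<sigma> :: "nat \<Rightarrow> 'r" and t :: "nat \<Rightarrow> nat \<Rightarrow> 'r"
  assumes finite_G: "finite (G n)"
    and G_0: "G 0 = {1}"
    and one_G: "1 \<in> G n"
    and mult_G: "g \<in> G n \<Longrightarrow> h \<in> G n \<Longrightarrow> g * h \<in> G n"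
    and st_G: "g \<in> G n \<Longrightarrow> st g \<in> G n"
    and \<sigma>_G: "\<sigma> (Suc n) \<in> G (Suc (Suc n))"
    and \<sigma>_commute: "g \<in> G n \<Longrightarrow> g * \<sigma> (Suc n) = \<sigma> (Suc n) * g"
    and t_last: "t (Suc n) n = 1"
    and t_less: "j < n \<Longrightarrow> t (Suc n) j = t n j * \<sigma> n"
    and bij_G: "bij_betw (\<lambda>(j, h). t (Suc n) j * h) ({..<Suc n} \<times> G n) (G (Suc n))"
begin

lemma t_mult_G: "j < Suc n \<Longrightarrow> h \<in> G n \<Longrightarrow> t (Suc n) j * h \<in> G (Suc n)"
  using bij_betw_apply[OF bij_G, of "(j, h)" n] by auto

lemma t_G: "j < Suc n \<Longrightarrow> t (Suc n) j \<in> G (Suc n)"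
  using t_mult_G[of j n 1] one_G by simp

lemma G_mono: "G n \<subseteq> G (Suc n)"
  using t_mult_G[of n n] t_last by auto

lemma sum_G_Suc: "sum f (G (Suc n)) = (\<Sum>j<Suc n. \<Sum>h\<in>G n. f (t (Suc n) j * h))"
  by (simp only: sum.reindex_bij_betw[OF bij_G, symmetric] sum.cartesian_product case_prod_unfold)

definition B :: "nat \<Rightarrow> 'r set" where "B n = span (G n)"

lemma G_subset_B: "g \<in> G n \<Longrightarrow> g \<in> B n"
  by (simp add: B_def span_base)

lemma B_mono: "z \<in> B n \<Longrightarrow> z \<in> B (Suc n)"
  unfolding B_def using span_mono[OF G_mono] by blast

lemma B_mult:
  assumes "x \<in> B n" "y \<in> B n"
  shows "x * y \<in> B n"
proof -
  have 1: "g * y \<in> B n" if "g \<in> G n" for g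
    using assms(2) unfolding B_def
  proof (induction y rule: span_induct_alt)
    case (step c x y)
    then show ?case using mult_G[OF that]
      by (simp add: distrib_left span_add span_scale span_base)
  qed (simp add: span_zero)
  show ?thesis
    using assms(1) unfolding B_def[of n]
  proof (induction x rule: span_induct_alt)
    case (step c x z)
    then show ?case using 1
      by (simp add: distrib_right B_def span_add span_scale)
  qed (simp add: span_zero)
qed

lemma B_st: "x \<in> B n \<Longrightarrow> st x \<in> B n"
  unfolding B_def
proof (induction x rule: span_induct_alt)
  case (step c x y)
  then show ?case using st_G by (simp add: span_add span_scale span_base)
qed (simp add: span_zero)

lemma subalgebra_B: "subalgebra (B n)"
  unfolding subalgebra_def using B_mult B_st finite_G[of n] one_G[of n]
  by (auto simp: B_def span_add span_scale span_base)

lemmas B_1 = subalgebraD(1)[OF subalgebra_B]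
  and B_scl = subalgebraD(4)[OF subalgebra_B]

lemma B_sum: "(\<And>i. i \<in> I \<Longrightarrow> f i \<in> B n) \<Longrightarrow> sum f I \<in> B n"
  unfolding B_def by (rule span_sum)

lemma \<sigma>_commute_B: "z \<in> B n \<Longrightarrow> z * \<sigma> (Suc n) = \<sigma> (Suc n) * z"
  unfolding B_def
  by (induction z rule: span_induct_alt) (auto simp: \<sigma>_commute distrib_left distrib_right)

end

text \<open>
  A Bratteli diagram of the tower. The labels in \<open>\<Lambda> n\<close> are minimal projections representing the
  simple modules of \<open>B n\<close>; the edges in \<open>E n\<close> are minimal projections of \<open>B (Suc n)\<close> that refine
  the labels of level \<open>n\<close>, and \<open>u\<close>, \<open>v\<close> are mutually inverse isomorphisms between an edge and the
  label of level \<open>Suc n\<close> in its class.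
\<close>

locale bratteli = group_tower +
  fixes \<Lambda> E :: "nat \<Rightarrow> 'a set" and src tgt u v :: "nat \<Rightarrow> 'a \<Rightarrow> 'a"
  assumes \<Lambda>_0: "\<Lambda> 0 = {1}"
    and \<Lambda>_Suc: "\<Lambda> (Suc n) = src n ` E n"
    and \<Lambda>_minimal: "p \<in> \<Lambda> n \<Longrightarrow> minimal (B n) p"
    and \<Lambda>_hom: "p \<in> \<Lambda> n \<Longrightarrow> p' \<in> \<Lambda> n \<Longrightarrow> p \<noteq> p' \<Longrightarrow> x \<in> B n \<Longrightarrow> p * x * p' = 0"
    and finite_E: "finite (E n)"
    and tgt_\<Lambda>: "q \<in> E n \<Longrightarrow> tgt n q \<in> \<Lambda> n"
    and tgt_mult: "q \<in> E n \<Longrightarrow> tgt n q * q = q" "q \<in> E n \<Longrightarrow> q * tgt n q = q"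
    and sum_tgt: "p \<in> \<Lambda> n \<Longrightarrow> \<Sum>{q \<in> E n. tgt n q = p} = p"
    and E_orth: "q \<in> E n \<Longrightarrow> q' \<in> E n \<Longrightarrow> q \<noteq> q' \<Longrightarrow> q * q' = 0"
    and u_B: "q \<in> E n \<Longrightarrow> u n q \<in> B (Suc n)" and v_B: "q \<in> E n \<Longrightarrow> v n q \<in> B (Suc n)"
    and u_mult: "q \<in> E n \<Longrightarrow> q * u n q = u n q" "q \<in> E n \<Longrightarrow> u n q * src n q = u n q"
    and v_mult: "q \<in> E n \<Longrightarrow> src n q * v n q = v n q" "q \<in> E n \<Longrightarrow> v n q * q = v n q"
    and v_u: "q \<in> E n \<Longrightarrow> v n q * u n q = src n q"
    and u_v: "q \<in> E n \<Longrightarrow> u n q * v n q = q"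

lemma (in group_tower) bratteli_exists:
  "\<exists>\<Lambda> E src tgt u v. bratteli scl st G \<sigma> t \<Lambda> E src tgt u v"
proof -
  define good where "good n \<Lambda> \<longleftrightarrow> finite \<Lambda> \<and> (\<forall>p\<in>\<Lambda>. minimal (B n) p) \<and>
      (\<forall>p\<in>\<Lambda>. \<forall>p'\<in>\<Lambda>. p \<noteq> p' \<longrightarrow> (\<forall>x\<in>B n. p * x * p' = 0))" for n \<Lambda>
  define refines where "refines n \<Lambda> E tgt src u v \<longleftrightarrow> finite E \<and>
    (\<forall>q\<in>E. minimal (B (Suc n)) q \<and> tgt q \<in> \<Lambda> \<and> tgt q * q = q \<and> q * tgt q = q) \<and>
    (\<forall>p\<in>\<Lambda>. \<Sum>{q \<in> E. tgt q = p} = p) \<and>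
    (\<forall>q\<in>E. \<forall>q'\<in>E. q \<noteq> q' \<longrightarrow> q * q' = 0) \<and>
    (\<forall>q\<in>E. src q \<in> E \<and> src (src q) = src q) \<and>
    (\<forall>q\<in>E. \<forall>q'\<in>E. src q \<noteq> src q' \<longrightarrow> (\<forall>x\<in>B (Suc n). src q * x * src q' = 0)) \<and>
    (\<forall>q\<in>E. u q \<in> B (Suc n) \<and> v q \<in> B (Suc n) \<and> q * u q = u q \<and> u q * src q = u q \<and>
       src q * v q = v q \<and> v q * q = v q \<and> v q * u q = src q \<and> u q * v q = q)"
    for n \<Lambda> E and tgt src u v :: "'r \<Rightarrow> 'r"
  have refine: "\<exists>E tgt src u v. refines n \<Lambda> E tgt src u v" if good: "good n \<Lambda>" for n \<Lambda>
    unfolding refines_def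
  proof (rule refine_projections[OF subalgebra_B])
    show "finite \<Lambda>" using good by (simp add: good_def)
    show "p \<in> B (Suc n) \<and> projection p \<and> p \<noteq> 0" if "p \<in> \<Lambda>" for p
      using good that B_mono by (auto simp: good_def minimal_def)
    show "p * p' = 0" if "p \<in> \<Lambda>" "p' \<in> \<Lambda>" "p \<noteq> p'" for p p'
    proof -
      have "p * 1 * p' = 0" using good that B_1 unfolding good_def by blast
      then show ?thesis by simp
    qed
  qed
  have good_Suc: "good (Suc n) (src ` E)" if "refines n \<Lambda> E tgt src u v" for n \<Lambda> E tgt src u v
    using that unfolding refines_def good_def by auto
  define labels where "labels s = (\<lambda>(E, tgt, src, u, v). src ` E) s"
    for s :: "'r set \<times> ('r \<Rightarrow> 'r) \<times> ('r \<Rightarrow> 'r) \<times> ('r \<Rightarrow> 'r) \<times> ('r \<Rightarrow> 'r)"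
  have "\<exists>f. \<forall>n. good n (labels (f n)) \<and> (n = 0 \<longrightarrow> labels (f n) = {1}) \<and>
      (\<lambda>(E, tgt, src, u, v). refines n (labels (f n)) E tgt src u v) (f (Suc n))"
  proof (rule dependent_nat_choice[where P = "\<lambda>n s. good n (labels s) \<and> (n = 0 \<longrightarrow> labels s = {1})"
        and Q = "\<lambda>n s s'. (\<lambda>(E, tgt, src, u, v). refines n (labels s) E tgt src u v) s'", simplified conj_assoc])
    have "x \<in> B 0 \<Longrightarrow> \<exists>c. x = c *s 1" for x
      unfolding B_def G_0 span_singleton by auto
    moreover have "st 1 = 1" by (metis mult.left_neutral mult.right_neutral st_mult st_st)
    ultimately have "good 0 {1}"
      using B_1 by (auto simp: good_def minimal_def projection_def)
    \<comment> \<open>Only the label set {1} of the initial state matters; the other components are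
      placeholders.\<close>
    then show "\<exists>s. good 0 (labels s) \<and> (0 = (0::nat) \<longrightarrow> labels s = {1})"
      by (intro exI[of _ "({1}, id, id, id, id)"]) (auto simp: labels_def)
  next
    fix s n assume "good n (labels s) \<and> (n = 0 \<longrightarrow> labels s = {1})"
    then obtain E tgt src u v where r: "refines n (labels s) E tgt src u v" using refine by blast
    then show "\<exists>s'. good (Suc n) (labels s') \<and> (Suc n = 0 \<longrightarrow> labels s' = {1}) \<and>
       (case s' of (E, tgt, src, u, v) \<Rightarrow> refines n (labels s) E tgt src u v)"
      using good_Suc by (intro exI[of _ "(E, tgt, src, u, v)"]) (auto simp: labels_def)
  qed
  then obtain f where f': "\<forall>n. good n (labels (f n)) \<and> (n = 0 \<longrightarrow> labels (f n) = {1}) \<and>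
      (\<lambda>(E, tgt, src, u, v). refines n (labels (f n)) E tgt src u v) (f (Suc n))" by (rule exE)
  have f: "\<And>n. good n (labels (f n))" "labels (f 0) = {1}"
    "\<And>n. (\<lambda>(E, tgt, src, u, v). refines n (labels (f n)) E tgt src u v) (f (Suc n))"
    by (rule f'[THEN spec, THEN conjunct1],
        rule f'[THEN spec, THEN conjunct2, THEN conjunct1, THEN mp, OF refl],
        rule f'[THEN spec, THEN conjunct2, THEN conjunct2])
  \<comment> \<open>The state \<open>f (Suc n)\<close> describes the edges between the levels
    \<open>n\<close> and \<open>Suc n\<close>, hence the shift of the index.\<close>
  define E tgt src u v where "E n = fst (f (Suc n))" and "tgt n = fst (snd (f (Suc n)))"
    and "src n = fst (snd (snd (f (Suc n))))" and "u n = fst (snd (snd (snd (f (Suc n)))))"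
    and "v n = snd (snd (snd (snd (f (Suc n)))))" for n
  define \<Lambda> where "\<Lambda> n = labels (f n)" for n
  have r: "refines n (\<Lambda> n) (E n) (tgt n) (src n) (u n) (v n)" for n
    using f(3)[of n] by (simp add: E_def tgt_def src_def u_def v_def \<Lambda>_def case_prod_unfold)
  have \<Lambda>: "\<Lambda> (Suc n) = src n ` E n" for n
    by (simp add: \<Lambda>_def labels_def E_def src_def case_prod_unfold)
  have "bratteli scl st G \<sigma> t \<Lambda> E src tgt u v"
  proof (unfold_locales, goal_cases)
    case (4 p n p' x)
    then show ?case using f(1)[of n] by (auto simp: good_def \<Lambda>_def)
  qed (use f(2) \<Lambda> f(1) r in \<open>auto simp: refines_def good_def \<Lambda>_def[symmetric]\<close>)
  then show ?thesis by blast
qed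

context bratteli begin

section \<open>Paths in the Bratteli diagram and matrix coefficients in the path basis\<close>

primrec lab :: "nat \<Rightarrow> 'a list \<Rightarrow> 'a" where
  "lab 0 x = 1"
| "lab (Suc n) x = src n (hd x)"

primrec X :: "nat \<Rightarrow> 'a list set" where
  "X 0 = {[]}"
| "X (Suc n) = {q # x |q x. q \<in> E n \<and> x \<in> X n \<and> tgt n q = lab n x}"

text \<open>A path is stored with its top edge first. \<open>ket\<close> and \<open>bra\<close>
  compose the isomorphisms along it in the two directions, and the products
  \<open>ket n x * bra n y\<close> with equal labels are matrix units of \<open>B n\<close>.\<close>

primrec ket :: "nat \<Rightarrow> 'a list \<Rightarrow> 'a" where
  "ket 0 x = 1"
| "ket (Suc n) x = ket n (tl x) * u n (hd x)"

primrec bra :: "nat \<Rightarrow> 'a list \<Rightarrow> 'a" where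
  "bra 0 x = 1"
| "bra (Suc n) x = v n (hd x) * bra n (tl x)"

definition npaths :: "nat \<Rightarrow> 'a \<Rightarrow> nat" where
  "npaths n p = card {x \<in> X n. lab n x = p}"

lemma finite_X: "finite (X n)"
proof (induction n)
  case (Suc n)
  have "X (Suc n) \<subseteq> (\<lambda>(q, x). q # x) ` (E n \<times> X n)" by auto
  then show ?case using Suc finite_E by (meson finite_SigmaI finite_imageI finite_subset)
qed simp

lemma lab_\<Lambda>: "x \<in> X n \<Longrightarrow> lab n x \<in> \<Lambda> n"
  by (cases n) (auto simp: \<Lambda>_0 \<Lambda>_Suc)

lemma \<Lambda>_props: "p \<in> \<Lambda> n \<Longrightarrow> p * p = p" "p \<in> \<Lambda> n \<Longrightarrow> p \<noteq> 0" "p \<in> \<Lambda> n \<Longrightarrow> p \<in> B n"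
  using \<Lambda>_minimal[of p n] by (auto simp: minimal_def projection_def)

lemma src_\<Lambda>: "q \<in> E n \<Longrightarrow> src n q \<in> \<Lambda> (Suc n)"
  by (simp add: \<Lambda>_Suc)

lemma ket_B: "x \<in> X n \<Longrightarrow> ket n x \<in> B n"
  by (induction n arbitrary: x) (auto simp: B_1 intro!: B_mult intro: u_B B_mono)

lemma bra_B: "x \<in> X n \<Longrightarrow> bra n x \<in> B n"
  by (induction n arbitrary: x) (auto simp: B_1 intro!: B_mult intro: v_B B_mono)

lemma ket_lab: "x \<in> X n \<Longrightarrow> ket n x * lab n x = ket n x"
  by (cases n) (auto simp: mult.assoc u_mult)

lemma lab_bra: "x \<in> X n \<Longrightarrow> lab n x * bra n x = bra n x"
  by (cases n) (auto simp: v_mult simp flip: mult.assoc)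

lemma v_u_orth:
  assumes "q \<in> E n" "r \<in> E n"
  shows "v n q * u n r = (if q = r then src n q else 0)"
proof (cases "q = r")
  case False
  have "v n q * u n r = v n q * (q * r) * u n r"
    using assms by (metis u_mult(1) v_mult(2) mult.assoc)
  then show ?thesis using False E_orth assms by simp
qed (simp add: assms v_u)

lemma v_tgt: "q \<in> E n \<Longrightarrow> v n q * tgt n q = v n q"
  by (metis mult.assoc tgt_mult(2) v_mult(2))

lemma tgt_u: "q \<in> E n \<Longrightarrow> tgt n q * u n q = u n q"
  by (metis mult.assoc tgt_mult(1) u_mult(1))

lemma bra_ket: "x \<in> X n \<Longrightarrow> y \<in> X n \<Longrightarrow> bra n x * ket n y = (if x = y then lab n x else 0)"
proof (induction n arbitrary: x y)
  case (Suc n)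
  obtain q x' r y' where xy: "x = q # x'" "y = r # y'" "q \<in> E n" "r \<in> E n" "x' \<in> X n" "y' \<in> X n"
      "tgt n q = lab n x'" "tgt n r = lab n y'"
    using Suc.prems by auto
  have "bra (Suc n) x * ket (Suc n) y = v n q * (bra n x' * ket n y') * u n r"
    by (simp add: xy mult.assoc)
  then show ?case
    using xy Suc.IH[of x' y'] v_tgt[of q n] v_u_orth[of q n r] by auto
qed auto

lemma sum_X_Suc: "sum f (X (Suc n)) = (\<Sum>x\<in>X n. \<Sum>q\<in>{q \<in> E n. tgt n q = lab n x}. f (q # x))"
proof -
  have "bij_betw (\<lambda>(x, q). q # x) (SIGMA x:X n. {q \<in> E n. tgt n q = lab n x}) (X (Suc n))"
    by (auto simp: bij_betw_def inj_on_def)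
  then have "sum f (X (Suc n)) = (\<Sum>(x, q)\<in>(SIGMA x:X n. {q \<in> E n. tgt n q = lab n x}). f (q # x))"
    by (simp only: sum.reindex_bij_betw[symmetric] case_prod_unfold)
  then show ?thesis using finite_X finite_E by (simp add: sum.Sigma)
qed

text \<open>The resolution of the identity persists from level to level because the edges refining a
  label sum to that label. Inserting it between two factors turns products in \<open>B n\<close>
  into matrix products.\<close>

lemma sum_ket_bra: "(\<Sum>x\<in>X n. ket n x * bra n x) = 1"
proof (induction n)
  case (Suc n)
  have "(\<Sum>q\<in>{q \<in> E n. tgt n q = lab n x}. ket (Suc n) (q # x) * bra (Suc n) (q # x)) = ket n x * bra n x"
    if x: "x \<in> X n" for x
  proof -
    have "(\<Sum>q\<in>{q \<in> E n. tgt n q = lab n x}. ket (Suc n) (q # x) * bra (Suc n) (q # x))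
      = (\<Sum>q\<in>{q \<in> E n. tgt n q = lab n x}. ket n x * q * bra n x)"
    proof (rule sum.cong[OF refl])
      fix q assume "q \<in> {q \<in> E n. tgt n q = lab n x}"
      then have "u n q * v n q = q" by (simp add: u_v)
      then have "ket n x * (u n q * v n q) * bra n x = ket n x * q * bra n x" by simp
      then show "ket (Suc n) (q # x) * bra (Suc n) (q # x) = ket n x * q * bra n x"
        by (simp add: mult.assoc)
    qed
    also have "\<dots> = ket n x * \<Sum>{q \<in> E n. tgt n q = lab n x} * bra n x"
      by (simp add: sum_distrib_left sum_distrib_right)
    also have "\<dots> = ket n x * bra n x"
      using sum_tgt lab_\<Lambda>[OF x] ket_lab[OF x] by simp
    finally show ?thesis .
  qed
  then show ?case using Suc by (simp add: sum_X_Suc del: X.simps ket.simps bra.simps)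
qed simp

text \<open>The entry of \<open>z\<close> in row \<open>x\<close> and column \<open>y\<close> of the
  path basis. For \<open>z\<close> in \<open>B n\<close> the product lies between two labels, so by
  minimality it is a scalar multiple of \<open>lab n y\<close>, and zero if the labels
  differ.\<close>

definition coef :: "nat \<Rightarrow> 'a list \<Rightarrow> 'a list \<Rightarrow> 'a \<Rightarrow> complex" where
  "coef n x y z = (SOME c. bra n x * z * ket n y = c *s lab n y)"

lemma coef_eqI: "y \<in> X n \<Longrightarrow> bra n x * z * ket n y = c *s lab n y \<Longrightarrow> coef n x y z = c"
  unfolding coef_def using \<Lambda>_props(2)[OF lab_\<Lambda>[of y n]]
  by (intro some_equality) auto

lemma bra_mult_ket:
  assumes x: "x \<in> X n" and y: "y \<in> X n" and z: "z \<in> B n"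
  shows "bra n x * z * ket n y = coef n x y z *s lab n y"
proof -
  have zB: "bra n x * z * ket n y \<in> B n" using x y z B_mult bra_B ket_B by blast
  have "bra n x * z * ket n y = lab n x * (bra n x * z * ket n y) * lab n y"
    using lab_bra[OF x] ket_lab[OF y] by (simp add: mult.assoc) (simp flip: mult.assoc)
  then have "\<exists>c. bra n x * z * ket n y = c *s lab n y"
    using \<Lambda>_hom[OF lab_\<Lambda>[OF x] lab_\<Lambda>[OF y] _ zB] \<Lambda>_minimal[OF lab_\<Lambda>[OF y]] zB
    by (cases "lab n x = lab n y") (auto simp: minimal_def intro: exI[of _ 0])
  then show ?thesis using coef_eqI[OF y] by blast
qed

lemma coef_lab_neq:
  assumes "x \<in> X n" "y \<in> X n" "z \<in> B n" "lab n x \<noteq> lab n y"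
  shows "coef n x y z = 0"
proof -
  have zB: "bra n x * z * ket n y \<in> B n" using assms B_mult bra_B ket_B by blast
  have "bra n x * z * ket n y = lab n x * (bra n x * z * ket n y) * lab n y"
    using lab_bra assms(1) ket_lab assms(2) by (simp add: mult.assoc) (simp flip: mult.assoc)
  also have "\<dots> = 0" using \<Lambda>_hom zB assms lab_\<Lambda> by blast
  finally show ?thesis by (intro coef_eqI assms) simp
qed

lemma coef_one: "x \<in> X n \<Longrightarrow> y \<in> X n \<Longrightarrow> coef n x y 1 = (if x = y then 1 else 0)"
  by (rule coef_eqI) (auto simp: bra_ket)

lemma coef_mult:
  assumes x: "x \<in> X n" and y: "y \<in> X n" and z: "z \<in> B n" and z': "z' \<in> B n"
  shows "coef n x y (z * z') = (\<Sum>w\<in>X n. coef n x w z * coef n w y z')"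
proof (rule coef_eqI[OF y])
  have "bra n x * (z * z') * ket n y = bra n x * z * (\<Sum>w\<in>X n. ket n w * bra n w) * z' * ket n y"
    by (simp add: sum_ket_bra mult.assoc)
  also have "\<dots> = (\<Sum>w\<in>X n. (bra n x * z * ket n w) * (bra n w * z' * ket n y))"
    by (simp add: sum_distrib_left sum_distrib_right mult.assoc)
  also have "\<dots> = (\<Sum>w\<in>X n. (coef n x w z * coef n w y z') *s lab n y)"
  proof (rule sum.cong[OF refl])
    fix w assume w: "w \<in> X n"
    show "(bra n x * z * ket n w) * (bra n w * z' * ket n y) = (coef n x w z * coef n w y z') *s lab n y"
      using bra_mult_ket[OF x w z] bra_mult_ket[OF w y z'] coef_lab_neq[OF w y z'] \<Lambda>_props(1)[OF lab_\<Lambda>[OF y]]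
      by (cases "lab n w = lab n y") (auto simp: mult.commute)
  qed
  finally show "bra n x * (z * z') * ket n y = (\<Sum>w\<in>X n. coef n x w z * coef n w y z') *s lab n y"
    by (simp add: scale_sum_left)
qed

lemma coef_sum:
  assumes x: "x \<in> X n" and y: "y \<in> X n" and z: "\<And>i. i \<in> I \<Longrightarrow> z i \<in> B n"
  shows "coef n x y (\<Sum>i\<in>I. c i *s z i) = (\<Sum>i\<in>I. c i * coef n x y (z i))"
proof (rule coef_eqI[OF y])
  have "bra n x * (\<Sum>i\<in>I. c i *s z i) * ket n y = (\<Sum>i\<in>I. c i *s (bra n x * z i * ket n y))"
    by (simp add: sum_distrib_left sum_distrib_right)
  also have "\<dots> = (\<Sum>i\<in>I. c i *s coef n x y (z i) *s lab n y)"
    using bra_mult_ket[OF x y z] by (intro sum.cong) auto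
  finally show "bra n x * (\<Sum>i\<in>I. c i *s z i) * ket n y = (\<Sum>i\<in>I. c i * coef n x y (z i)) *s lab n y"
    by (simp add: scale_sum_left)
qed

lemma coef_faithful:
  assumes z: "z \<in> B n" and 0: "\<And>x y. x \<in> X n \<Longrightarrow> y \<in> X n \<Longrightarrow> lab n x = lab n y \<Longrightarrow> coef n x y z = 0"
  shows "z = 0"
proof -
  have "bra n x * z * ket n y = 0" if "x \<in> X n" "y \<in> X n" for x y
    using bra_mult_ket[OF that z] 0[OF that] coef_lab_neq[OF that z] by (cases "lab n x = lab n y") auto
  moreover have "z = (\<Sum>x\<in>X n. ket n x * bra n x) * z * (\<Sum>y\<in>X n. ket n y * bra n y)"
    by (simp add: sum_ket_bra)
  then have "z = (\<Sum>y\<in>X n. \<Sum>x\<in>X n. ket n x * (bra n x * z * ket n y) * bra n y)"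
    by (simp add: sum_distrib_left sum_distrib_right mult.assoc)
  ultimately show ?thesis by simp
qed

lemma coef_surjective:
  assumes "\<And>x y. x \<in> X n \<Longrightarrow> y \<in> X n \<Longrightarrow> lab n x \<noteq> lab n y \<Longrightarrow> c x y = 0"
  shows "\<exists>z\<in>B n. \<forall>x\<in>X n. \<forall>y\<in>X n. coef n x y z = c x y"
proof
  let ?z = "\<Sum>(x, y)\<in>X n \<times> X n. c x y *s (ket n x * bra n y)"
  show "?z \<in> B n" by (auto intro!: B_sum B_scl B_mult ket_B bra_B)
  show "\<forall>x\<in>X n. \<forall>y\<in>X n. coef n x y ?z = c x y"
  proof (intro ballI coef_eqI)
    fix x y assume x: "x \<in> X n" and y: "y \<in> X n"
    have "bra n x * ?z * ket n y = (\<Sum>(x', y')\<in>X n \<times> X n. c x' y' *s ((bra n x * ket n x') * (bra n y' * ket n y)))"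
      by (simp add: sum_distrib_left sum_distrib_right mult.assoc case_prod_unfold)
    also have "\<dots> = (\<Sum>(x', y')\<in>X n \<times> X n. if (x', y') = (x, y) then c x y *s (lab n x * lab n y) else 0)"
      using x y by (intro sum.cong) (auto simp: bra_ket)
    also have "\<dots> = c x y *s (lab n x * lab n y)"
      using x y finite_X by (subst (1) case_prod_unfold) simp
    also have "\<dots> = c x y *s lab n y"
      using assms[OF x y] \<Lambda>_props(1)[OF lab_\<Lambda>[OF y]] by (cases "lab n x = lab n y") auto
    finally show "bra n x * ?z * ket n y = c x y *s lab n y" .
  qed
qed

text \<open>The basis is adapted to the tower: an element of the lower algebra leaves the top edge
  alone, and the block it forms does not depend on that edge.\<close>

lemma coef_lower:
  assumes "q # x \<in> X (Suc n)" "r # y \<in> X (Suc n)" and z: "z \<in> B n"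
  shows "coef (Suc n) (q # x) (r # y) z = (if q = r then coef n x y z else 0)"
proof (rule coef_eqI[OF assms(2)])
  have a: "q \<in> E n" "r \<in> E n" "x \<in> X n" "y \<in> X n" "tgt n r = lab n y" "tgt n q = lab n x"
    using assms by auto
  have "bra (Suc n) (q # x) * z * ket (Suc n) (r # y) = v n q * (bra n x * z * ket n y) * u n r"
    by (simp add: mult.assoc)
  also have "\<dots> = coef n x y z *s (v n q * (tgt n r * u n r))"
    by (simp only: bra_mult_ket[OF a(3,4) z] a(5)) (simp add: mult.assoc)
  also have "\<dots> = (if q = r then coef n x y z else 0) *s src n r"
    by (simp only: tgt_u[OF a(2)] v_u_orth[OF a(1,2)]) simp
  finally show "bra (Suc n) (q # x) * z * ket (Suc n) (r # y) =
      (if q = r then coef n x y z else 0) *s lab (Suc n) (r # y)" by simp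
qed

definition swap_coef :: "nat \<Rightarrow> 'a \<Rightarrow> 'a \<Rightarrow> 'a \<Rightarrow> 'a \<Rightarrow> complex" where
  "swap_coef n q k r l = (SOME c. v (Suc n) q * v n k * \<sigma> (Suc n) * u n l * u (Suc n) r = c *s src (Suc n) r)"

text \<open>As \<open>\<sigma> (Suc n)\<close> commutes with \<open>bra n x\<close>, the factors
  \<open>bra n x\<close> and \<open>ket n y\<close> meet and collapse to a Kronecker delta. What
  remains involves only the two top edges on either side.\<close>

lemma coef_\<sigma>:
  assumes "q # k # x \<in> X (Suc (Suc n))" "r # l # y \<in> X (Suc (Suc n))"
  shows "coef (Suc (Suc n)) (q # k # x) (r # l # y) (\<sigma> (Suc n)) = (if x = y then swap_coef n q k r l else 0)"
proof -
  have a: "k \<in> E n" "l \<in> E n" "x \<in> X n" "y \<in> X n" "tgt n l = lab n y" "tgt n k = lab n x"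
    using assms by auto
  have "bra (Suc (Suc n)) (q # k # x) * \<sigma> (Suc n) * ket (Suc (Suc n)) (r # l # y)
      = v (Suc n) q * v n k * (bra n x * \<sigma> (Suc n)) * ket n y * u n l * u (Suc n) r"
    by (simp add: mult.assoc)
  also have "\<dots> = v (Suc n) q * v n k * \<sigma> (Suc n) * (bra n x * ket n y) * u n l * u (Suc n) r"
    by (simp add: \<sigma>_commute_B[OF bra_B[OF a(3)]] mult.assoc)
  also have "\<dots> = (if x = y then v (Suc n) q * v n k * \<sigma> (Suc n) * (tgt n l * u n l) * u (Suc n) r else 0)"
    by (simp add: bra_ket[OF a(3,4)] a(5,6) mult.assoc)
  finally have *: "bra (Suc (Suc n)) (q # k # x) * \<sigma> (Suc n) * ket (Suc (Suc n)) (r # l # y) =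
     (if x = y then v (Suc n) q * v n k * \<sigma> (Suc n) * u n l * u (Suc n) r else 0)"
    by (simp only: tgt_u[OF a(2)])
  show ?thesis
  proof (cases "x = y")
    case True
    \<comment> \<open>By \<open>*\<close> both choices are made from the same predicate, so they
      agree.\<close>
    then show ?thesis unfolding coef_def swap_coef_def using * by simp
  next
    case False
    then show ?thesis using * by (intro coef_eqI[OF assms(2)]) simp
  qed
qed

end


subsection \<open>Counting paths\<close>

context bratteli begin

text \<open>A label \<open>p\<close> reached by no path would have no homomorphism to any
  \<open>lab n x\<close>; then every \<open>bra n x * p\<close> vanishes, and the resolution of the
  identity kills \<open>p\<close>.\<close>

lemma npaths_pos:
  assumes p: "p \<in> \<Lambda> n"
  shows "npaths n p > 0"
proof (rule ccontr)
  assume "\<not> npaths n p > 0"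
  then have "{x \<in> X n. lab n x = p} = {}" using finite_X by (simp add: npaths_def)
  then have neq: "lab n x \<noteq> p" if "x \<in> X n" for x using that by blast
  have "bra n x * p = 0" if x: "x \<in> X n" for x
  proof -
    have "lab n x * bra n x * p = 0"
      using \<Lambda>_hom[OF lab_\<Lambda>[OF x] p neq[OF x] bra_B[OF x]] .
    then show ?thesis using lab_bra[OF x] by simp
  qed
  then have "(\<Sum>x\<in>X n. ket n x * bra n x) * p = 0"
    by (simp add: sum_distrib_right mult.assoc)
  then show False using \<Lambda>_props(2)[OF p] by (simp add: sum_ket_bra)
qed

lemma npaths_Suc: "npaths (Suc n) l = (\<Sum>q\<in>{q \<in> E n. src n q = l}. npaths n (tgt n q))"
proof -
  have "bij_betw (\<lambda>(q, x). q # x) (SIGMA q:{q \<in> E n. src n q = l}. {x \<in> X n. lab n x = tgt n q})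
      {x \<in> X (Suc n). lab (Suc n) x = l}"
    by (auto simp: bij_betw_def inj_on_def)
  from bij_betw_same_card[OF this] show ?thesis
    using finite_E finite_X by (simp add: npaths_def del: X.simps lab.simps)
qed

text \<open>
  Half of Frobenius reciprocity: the elements \<open>ket (Suc n) x * v n q\<close> form a linearly independent
  family in the left ideal of \<open>B (Suc n)\<close> generated by \<open>p\<close>, which the products of the coset
  representatives with the \<open>ket n r\<close> of label \<open>p\<close> span.
\<close>

lemma tower_index_bound:
  assumes p: "p \<in> \<Lambda> n"
  shows "(\<Sum>q\<in>{q \<in> E n. tgt n q = p}. npaths (Suc n) (src n q)) \<le> Suc n * npaths n p"
proof -
  define I where "I = (SIGMA q:{q \<in> E n. tgt n q = p}. {x \<in> X (Suc n). lab (Suc n) x = src n q})"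
  define F where "F = (\<lambda>(j, r). t (Suc n) j * ket n r) ` ({..<Suc n} \<times> {r \<in> X n. lab n r = p})"
  have F: "finite F" "card F \<le> Suc n * npaths n p"
  proof -
    show "finite F" unfolding F_def using finite_X by auto
    have "card F \<le> card ({..<Suc n} \<times> {r \<in> X n. lab n r = p})"
      unfolding F_def by (rule card_image_le) (use finite_X in auto)
    then show "card F \<le> Suc n * npaths n p" by (simp only: card_cartesian_product npaths_def card_lessThan)
  qed
  have low: "t (Suc n) j * h * p \<in> span F" if j: "j < Suc n" and h: "h \<in> G n" for j h
  proof -
    have hp: "h * p \<in> B n" using h p G_subset_B \<Lambda>_props B_mult by blast
    have "h * p = (\<Sum>r\<in>X n. ket n r * bra n r) * (h * p)" by (simp add: sum_ket_bra)
    also have "\<dots> = (\<Sum>r\<in>X n. ket n r * (bra n r * h * p))"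
      by (simp only: sum_distrib_right mult.assoc)
    finally have e: "t (Suc n) j * (h * p) = (\<Sum>r\<in>X n. t (Suc n) j * (ket n r * (bra n r * h * p)))"
      by (metis sum_distrib_left)
    have "t (Suc n) j * (ket n r * (bra n r * h * p)) \<in> span F" if r: "r \<in> X n" for r
    proof -
      have zB: "bra n r * h \<in> B n" using r h G_subset_B bra_B B_mult by blast
      have z: "bra n r * h * p = lab n r * (bra n r * h) * p"
        using lab_bra[OF r] by (simp flip: mult.assoc)
      show ?thesis
      proof (cases "lab n r = p")
        case True
        obtain c where "p * (bra n r * h) * p = c *s p"
          using \<Lambda>_minimal[OF p] zB unfolding minimal_def by blast
        then have "t (Suc n) j * (ket n r * (bra n r * h * p)) = c *s (t (Suc n) j * (ket n r * lab n r))"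
          using z True by simp
        also have "\<dots> = c *s (t (Suc n) j * ket n r)" using ket_lab[OF r] by simp
        also have "\<dots> \<in> span F"
          using j r True unfolding F_def by (intro span_scale span_base) auto
        finally show ?thesis .
      next
        case False
        then have "bra n r * h * p = 0" using z \<Lambda>_hom[OF lab_\<Lambda>[OF r] p _ zB] by simp
        then show ?thesis by (simp add: span_zero)
      qed
    qed
    then show ?thesis unfolding mult.assoc e by (intro span_sum)
  qed
  have inF: "z * p \<in> span F" if "z \<in> B (Suc n)" for z
    using that unfolding B_def
  proof (induction z rule: span_induct_alt)
    case (step c x y)
    obtain j h where "j < Suc n" "h \<in> G n" "x = t (Suc n) j * h"
      using bij_G[of n] step.hyps unfolding bij_betw_def by force
    then have "x * p \<in> span F" using low by simp
    then show ?case using step by (simp add: distrib_right span_add span_scale)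
  qed (simp add: span_zero)
  \<comment> \<open>\<open>bra (Suc n) x\<close> from the left and \<open>u n q\<close> from the
    right undo the two factors of a family member and annihilate all other members.\<close>
  let ?w = "\<lambda>(q, x). ket (Suc n) x * v n q" and ?l = "\<lambda>(q, x). bra (Suc n) x" and ?r = "\<lambda>(q, x). u n q"
  have "card I \<le> card F"
  proof (rule biorthogonal_card_le[where w = ?w and l = ?l and r = ?r])
    show "finite I" unfolding I_def using finite_E finite_X by (auto simp del: X.simps)
    show "finite F" by fact
    fix i assume i: "i \<in> I"
    then obtain q x where qx: "i = (q, x)" "q \<in> E n" "tgt n q = p" "x \<in> X (Suc n)" "lab (Suc n) x = src n q"
      unfolding I_def by blast
    have "ket (Suc n) x * v n q \<in> B (Suc n)" using qx ket_B v_B B_mult by blast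
    from inF[OF this] show "?w i \<in> span F"
      using v_tgt[OF qx(2)] qx(1,3) by (simp add: mult.assoc del: ket.simps)
    have eq: "bra (Suc n) x * (ket (Suc n) x' * v n q') * u n q =
        (if (q, x) = (q', x') then src n q else 0)" if "(q', x') \<in> I" for q' x'
    proof -
      have a: "q' \<in> E n" "x' \<in> X (Suc n)" using that by (auto simp: I_def)
      have "bra (Suc n) x * (ket (Suc n) x' * v n q') * u n q =
          (bra (Suc n) x * ket (Suc n) x') * (v n q' * u n q)" by (simp only: mult.assoc)
      also have "\<dots> = (if x = x' then lab (Suc n) x else 0) * (if q' = q then src n q' else 0)"
        by (simp only: bra_ket[OF qx(4) a(2)] v_u_orth[OF a(1) qx(2)])
      finally show ?thesis using \<Lambda>_props(1)[OF src_\<Lambda>[OF qx(2)]] qx(5) by auto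
    qed
    show "?l i * ?w i *
        ?r i \<noteq> 0"
      using eq[of q x] i qx(1) \<Lambda>_props(2)[OF src_\<Lambda>[OF qx(2)]] by simp
    fix j assume "j \<in> I" "i \<noteq> j"
    moreover obtain q' x' where "j = (q', x')" by fastforce
    ultimately show "?l i * ?w j *
        ?r i = 0"
      using eq[of q' x'] qx(1) by auto
  qed
  moreover have "card I = (\<Sum>q\<in>{q \<in> E n. tgt n q = p}. npaths (Suc n) (src n q))"
    unfolding I_def npaths_def using finite_E finite_X by (simp del: X.simps lab.simps)
  ultimately show ?thesis using F(2) by linarith
qed

text \<open>A label is met once for each of its paths, so the left side is the sum of the squared
  dimensions of the simple modules. Each level multiplies it by at most the index
  \<open>Suc n\<close>.\<close>

lemma sum_npaths_le: "(\<Sum>x\<in>X n. npaths n (lab n x)) \<le> fact n"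
proof (induction n)
  case 0
  then show ?case by (simp add: npaths_def)
next
  case (Suc n)
  have "(\<Sum>x\<in>X (Suc n). npaths (Suc n) (lab (Suc n) x)) =
     (\<Sum>x\<in>X n. \<Sum>q\<in>{q \<in> E n. tgt n q = lab n x}. npaths (Suc n) (src n q))"
    by (subst sum_X_Suc) simp
  also have "\<dots> \<le> (\<Sum>x\<in>X n. Suc n * npaths n (lab n x))"
    using tower_index_bound lab_\<Lambda> by (intro sum_mono) blast
  also have "\<dots> = Suc n * (\<Sum>x\<in>X n. npaths n (lab n x))" by (simp only: sum_distrib_left)
  also have "\<dots> \<le> Suc n * fact n" using Suc by (rule mult_le_mono2)
  finally show ?case by simp
qed

text \<open>These pairs index the terms contributed by the swap in
  \<open>induced_Suc\<close>.\<close>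

definition valleys :: "nat \<Rightarrow> 'a \<Rightarrow> 'a \<Rightarrow> ('a \<times> 'a) set" where
  "valleys n l m = {(k, k'). k \<in> E n \<and> k' \<in> E n \<and> src n k = l \<and> src n k' = m \<and> tgt n k = tgt n k'}"

lemma finite_valleys: "finite (valleys n l m)"
  by (rule finite_subset[of _ "E n \<times> E n"]) (auto simp: valleys_def finite_E)

lemma card_valleys_commute: "card (valleys n l m) = card (valleys n m l)"
  by (rule bij_betw_same_card[of prod.swap]) (auto simp: bij_betw_def valleys_def inj_on_def)

text \<open>Restricting the module of \<open>l\<close> to level \<open>n\<close> and inducing it
  back gives dimension at most \<open>Suc n * npaths (Suc n) l\<close>. Each valley accounts for one
  copy of the module of \<open>m\<close> in the result.\<close>

lemma card_valleys_mult_le: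
  assumes "l \<in> \<Lambda> (Suc n)"
  shows "card (valleys n l m) * npaths (Suc n) m \<le> Suc n * npaths (Suc n) l"
proof -
  have "valleys n l m = (SIGMA k:{k \<in> E n. src n k = l}. {k' \<in> E n. tgt n k' = tgt n k \<and> src n k' = m})"
    by (auto simp: valleys_def)
  then have "card (valleys n l m) * npaths (Suc n) m =
      (\<Sum>k\<in>{k \<in> E n. src n k = l}. card {k' \<in> E n. tgt n k' = tgt n k \<and> src n k' = m} * npaths (Suc n) m)"
    using finite_E by (simp add: sum_distrib_right)
  also have "\<dots> = (\<Sum>k\<in>{k \<in> E n. src n k = l}.
      \<Sum>k'\<in>{k' \<in> E n. tgt n k' = tgt n k \<and> src n k' = m}. npaths (Suc n) (src n k'))"
    by (intro sum.cong) auto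
  also have "\<dots> \<le> (\<Sum>k\<in>{k \<in> E n. src n k = l}.
      \<Sum>k'\<in>{k' \<in> E n. tgt n k' = tgt n k}. npaths (Suc n) (src n k'))"
    using finite_E by (intro sum_mono sum_mono2) auto
  also have "\<dots> \<le> (\<Sum>k\<in>{k \<in> E n. src n k = l}. Suc n * npaths n (tgt n k))"
    using tower_index_bound tgt_\<Lambda> by (intro sum_mono) blast
  also have "\<dots> = Suc n * npaths (Suc n) l" by (simp only: npaths_Suc sum_distrib_left)
  finally show ?thesis .
qed

text \<open>
  The preceding bound is not symmetric in \<open>l\<close> and \<open>m\<close>, but the set it bounds is; so it may be applied
  with the larger of the two dimensions on the left.
\<close>

lemma card_valleys_le:
  assumes l: "l \<in> \<Lambda> (Suc n)" and m: "m \<in> \<Lambda> (Suc n)"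
  shows "card (valleys n l m) \<le> Suc n"
proof -
  have *: "card (valleys n a b) \<le> Suc n" if "a \<in> \<Lambda> (Suc n)" "b \<in> \<Lambda> (Suc n)" "npaths (Suc n) a \<le> npaths (Suc n) b" for a b
  proof -
    have "card (valleys n a b) * npaths (Suc n) b \<le> Suc n * npaths (Suc n) b"
      using card_valleys_mult_le[OF that(1), of b] that(3) by (meson le_trans mult_le_mono2)
    then show ?thesis using npaths_pos[OF that(2)] mult_le_cancel2 by blast
  qed
  show ?thesis using *[OF l m] *[OF m l] card_valleys_commute[of n l m] by linarith
qed


subsection \<open>The fast Fourier transform along the tower\<close>

text \<open>
  The change of basis in a module induced from level \<open>n\<close> to level \<open>Suc n\<close>: the input \<open>y j r\<close> is the
  coordinate at \<open>r\<close> in the \<open>j\<close>-th coset. The vector along which the module is induced never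
  changes, so each such transform costs only the dimension of the module times a polynomial in \<open>n\<close>.
\<close>

definition induced :: "nat \<Rightarrow> 'a \<Rightarrow> (nat \<Rightarrow> 'a list \<Rightarrow> ('s \<Rightarrow> complex) \<Rightarrow> complex) \<Rightarrow> 'a list \<Rightarrow> 'a \<Rightarrow>
    ('s \<Rightarrow> complex) \<Rightarrow> complex" where
  "induced n p y x q = (\<lambda>f. \<Sum>j<Suc n. \<Sum>r\<in>{r \<in> X n. lab n r = p}. coef (Suc n) x (q # r) (t (Suc n) j) * y j r f)"

text \<open>A basis of the induced module: the edge \<open>q\<close> above \<open>p\<close> selects
  a simple summand, and \<open>x\<close> runs through the basis of that summand.\<close>

definition induced_index :: "nat \<Rightarrow> 'a \<Rightarrow> ('a list \<times> 'a) set" where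
  "induced_index n p = (SIGMA q:{q \<in> E n. tgt n q = p}. {x \<in> X (Suc n). lab (Suc n) x = src n q})\<inverse>"

lemma induced_index_iff:
  "(x, q) \<in> induced_index n p \<longleftrightarrow> q \<in> E n \<and> tgt n q = p \<and> x \<in> X (Suc n) \<and> lab (Suc n) x = src n q"
  by (auto simp: induced_index_def)

lemma finite_induced_index: "finite (induced_index n p)"
  unfolding induced_index_def using finite_E finite_X by (auto simp del: X.simps)

lemma card_induced_index: "p \<in> \<Lambda> n \<Longrightarrow> card (induced_index n p) \<le> Suc n * npaths n p"
proof -
  assume "p \<in> \<Lambda> n"
  moreover have "card (induced_index n p) = (\<Sum>q\<in>{q \<in> E n. tgt n q = p}. npaths (Suc n) (src n q))"
    unfolding induced_index_def card_inverse npaths_def using finite_E finite_X by (simp del: X.simps lab.simps)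
  ultimately show ?thesis using tower_index_bound by simp
qed

text \<open>
  \<open>t (Suc (Suc n)) j\<close> splits as \<open>t (Suc n) j * \<sigma> (Suc n)\<close>. The first factor is block diagonal, and the
  second commutes with \<open>B n\<close>, so that by Schur's lemma its entries only see the last two edges.
\<close>

lemma coef_t_lt:
  assumes "q' # x \<in> X (Suc (Suc n))" "q # k # r \<in> X (Suc (Suc n))" and j: "j < Suc n"
  shows "coef (Suc (Suc n)) (q' # x) (q # k # r) (t (Suc (Suc n)) j) =
    (\<Sum>k'\<in>{k' \<in> E n. tgt n k' = tgt n k}. coef (Suc n) x (k' # r) (t (Suc n) j) *
       (if src n k' = tgt (Suc n) q' then swap_coef n q' k' q k else 0))"
proof -
  let ?N = "Suc (Suc n)"
  have tB: "t (Suc n) j \<in> B (Suc n)" using t_G[OF j] G_subset_B by blast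
  have a: "x \<in> X (Suc n)" "q' \<in> E (Suc n)" "tgt (Suc n) q' = lab (Suc n) x"
    "r \<in> X n" "tgt n k = lab n r" "k \<in> E n" "k # r \<in> X (Suc n)" "lab (Suc n) (k # r) = src n k"
    using assms by auto
  let ?K = "{k' \<in> E n. tgt n k' = tgt n k \<and> src n k' = tgt (Suc n) q'}"
  let ?S = "{w \<in> X (Suc n). lab (Suc n) w = tgt (Suc n) q'}"
  have "coef ?N (q' # x) (q # k # r) (t ?N j) =
      coef ?N (q' # x) (q # k # r) (t (Suc n) j * \<sigma> (Suc n))"
    using t_less[OF j] by simp
  also have "\<dots> = (\<Sum>w\<in>X ?N. coef ?N (q' # x) w (t (Suc n) j) * coef ?N w (q # k # r) (\<sigma> (Suc n)))"
    using tB B_mono \<sigma>_G G_subset_B by (intro coef_mult assms(1,2)) blast+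
  also have "\<dots> = (\<Sum>w\<in>(\<lambda>w. q' # w) ` ?S. coef ?N (q' # x) w (t (Suc n) j) * coef ?N w (q # k # r) (\<sigma> (Suc n)))"
  proof (rule sum.mono_neutral_right[OF finite_X])
    show "(\<lambda>w. q' # w) ` ?S \<subseteq> X ?N" using a by auto
    show "\<forall>w\<in>X ?N - (\<lambda>w. q' # w) ` ?S. coef ?N (q' # x) w (t (Suc n) j) * coef ?N w (q # k # r) (\<sigma> (Suc n)) = 0"
    proof
      fix w assume w: "w \<in> X ?N - (\<lambda>w. q' # w) ` ?S"
      then obtain q2 w' where w': "w = q2 # w'" "w' \<in> X (Suc n)" "tgt (Suc n) q2 = lab (Suc n) w'"
        unfolding X.simps(2)[of "Suc n"] by blast
      then have "q2 \<noteq> q'" using w a by auto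
      then have "coef ?N (q' # x) w (t (Suc n) j) = 0"
        using coef_lower[OF assms(1) _ tB, of q2 w'] w w' by auto
      then show "coef ?N (q' # x) w (t (Suc n) j) * coef ?N w (q # k # r) (\<sigma> (Suc n)) = 0" by simp
    qed
  qed
  also have "\<dots> = (\<Sum>w\<in>?S. coef (Suc n) x w (t (Suc n) j) * coef ?N (q' # w) (q # k # r) (\<sigma> (Suc n)))"
  proof (rule sum.reindex_cong[of "(#) q'"])
    fix w assume "w \<in> ?S"
    then have "q' # w \<in> X ?N" using a by auto
    from coef_lower[OF assms(1) this tB]
    show "coef ?N (q' # x) (q' # w) (t (Suc n) j) * coef ?N (q' # w) (q # k # r) (\<sigma> (Suc n)) =
      coef (Suc n) x w (t (Suc n) j) * coef ?N (q' # w) (q # k # r) (\<sigma> (Suc n))" by simp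
  qed simp_all
  also have "\<dots> = (\<Sum>w\<in>(\<lambda>k'. k' # r) ` ?K.
     coef (Suc n) x w (t (Suc n) j) * coef ?N (q' # w) (q # k # r) (\<sigma> (Suc n)))"
  proof (rule sum.mono_neutral_right)
    show "finite ?S" using finite_X by (simp del: X.simps lab.simps)
    show "(\<lambda>k'. k' # r) ` ?K \<subseteq> ?S" using a by auto
    show "\<forall>w\<in>?S - (\<lambda>k'. k' # r) ` ?K.
       coef (Suc n) x w (t (Suc n) j) * coef ?N (q' # w) (q # k # r) (\<sigma> (Suc n)) = 0"
    proof
      fix w assume w: "w \<in> ?S - (\<lambda>k'. k' # r) ` ?K"
      then obtain k2 w' where w': "w = k2 # w'" "w' \<in> X n" "tgt n k2 = lab n w'" "k2 \<in> E n" by auto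
      then have "w' \<noteq> r" using w a by auto
      moreover have "q' # k2 # w' \<in> X ?N" using w w' a by auto
      ultimately have "coef ?N (q' # w) (q # k # r) (\<sigma> (Suc n)) = 0"
        using coef_\<sigma>[OF _ assms(2)] w' by auto
      then show "coef (Suc n) x w (t (Suc n) j) * coef ?N (q' # w) (q # k # r) (\<sigma> (Suc n)) = 0" by simp
    qed
  qed
  also have "\<dots> = (\<Sum>k'\<in>?K.
     coef (Suc n) x (k' # r) (t (Suc n) j) * swap_coef n q' k' q k)"
  proof (rule sum.reindex_cong[of "\<lambda>k'. k' # r"])
    fix k' assume "k' \<in> ?K"
    then have "q' # k' # r \<in> X ?N" using a by auto
    from coef_\<sigma>[OF this assms(2)]
    show "coef (Suc n) x (k' # r) (t (Suc n) j) * coef ?N (q' # k' # r) (q # k # r) (\<sigma> (Suc n)) =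
       coef (Suc n) x (k' # r) (t (Suc n) j) * swap_coef n q' k' q k" by simp
  qed (simp_all add: inj_on_def)
  also have "\<dots> = (\<Sum>k'\<in>{k' \<in> E n. tgt n k' = tgt n k}. coef (Suc n) x (k' # r) (t (Suc n) j) *
       (if src n k' = tgt (Suc n) q' then swap_coef n q' k' q k else 0))"
    using finite_E by (intro sum.mono_neutral_cong_left) auto
  finally show ?thesis .
qed

lemma sum_labelled_paths:
  "(\<Sum>r\<in>{r \<in> X (Suc n). lab (Suc n) r = p}. f r) =
   (\<Sum>k\<in>{k \<in> E n. src n k = p}. \<Sum>r\<in>{r \<in> X n. lab n r = tgt n k}. f (k # r))"
proof -
  have "bij_betw (\<lambda>(q, x). q # x) (SIGMA q:{q \<in> E n. src n q = p}. {x \<in> X n. lab n x = tgt n q})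
      {x \<in> X (Suc n). lab (Suc n) x = p}"
    by (auto simp: bij_betw_def inj_on_def)
  from sum.reindex_bij_betw[OF this, of f, symmetric] show ?thesis
    using finite_E finite_X by (simp add: sum.Sigma case_prod_unfold del: X.simps lab.simps)
qed

text \<open>The last coset representative is 1 and contributes the first term. The others factor
  through \<open>t (Suc n) j\<close>, so after splitting \<open>r\<close> into its top edge
  \<open>k\<close> and the rest, the sum over cosets and lower paths is again an induced transform,
  one level down. Only the choice of the edges \<open>k\<close> and \<open>k'\<close> is left
  outside.\<close>

lemma induced_Suc:
  assumes xq: "(q' # x, q) \<in> induced_index (Suc n) p"
  shows "induced (Suc n) p y (q' # x) q = (\<lambda>f. (if q = q' then y (Suc n) x f else 0) +
     (\<Sum>(k, k')\<in>valleys n p (tgt (Suc n) q'). swap_coef n q' k' q k * induced n (tgt n k) (\<lambda>j r. y j (k # r)) x k' f))"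
proof
  fix f
  let ?N = "Suc (Suc n)"
  let ?K = "{k \<in> E n. src n k = p}"
  let ?K' = "\<lambda>k. {k' \<in> E n. tgt n k' = tgt n k}"
  let ?R' = "\<lambda>k. {r \<in> X n. lab n r = tgt n k}"
  let ?M = "\<lambda>k k'. swap_coef n q' k' q k"
  let ?ind = "\<lambda>k k'. induced n (tgt n k) (\<lambda>j r. y j (k # r)) x k' f"
  let ?term = "\<lambda>j k r k'. coef (Suc n) x (k' # r) (t (Suc n) j) *
          (if src n k' = tgt (Suc n) q' then ?M k k' else 0) * y j (k # r) f"
  let ?R = "{r \<in> X (Suc n). lab (Suc n) r = p}"
  have a: "q \<in> E (Suc n)" "tgt (Suc n) q = p" "q' # x \<in> X ?N" "x \<in> X (Suc n)" "tgt (Suc n) q' = lab (Suc n) x"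
    using xq by (auto simp: induced_index_iff)
  have R: "q # r \<in> X ?N" if "r \<in> ?R" for r using that a by auto
  have "(\<Sum>r\<in>?R. coef ?N (q' # x) (q # r) (t ?N (Suc n)) * y (Suc n) r f) =
     (\<Sum>r\<in>?R. if r = x then (if q = q' then y (Suc n) x f else 0) else 0)"
    using R by (intro sum.cong) (auto simp: t_last coef_one[OF a(3)])
  also have "\<dots> = (if q = q' then y (Suc n) x f else 0)"
    using finite_X[of "Suc n"] a by (auto simp del: X.simps lab.simps)
  finally have last: "(\<Sum>r\<in>?R. coef ?N (q' # x) (q # r) (t ?N (Suc n)) * y (Suc n) r f) = \<dots>" .
  have "(\<Sum>j<Suc n. \<Sum>r\<in>?R. coef ?N (q' # x) (q # r) (t ?N j) * y j r f) =
     (\<Sum>j<Suc n. \<Sum>k\<in>?K. \<Sum>r\<in>?R' k.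
        \<Sum>k'\<in>?K' k. ?term j k r k')"
    unfolding sum_labelled_paths
  proof (intro sum.cong refl)
    fix j k r assume j: "j \<in> {..<Suc n}" and k: "k \<in> ?K"
      and r: "r \<in> ?R' k"
    have "q # k # r \<in> X ?N" using k r a by auto
    from coef_t_lt[OF a(3) this, of j] j
    show "coef ?N (q' # x) (q # k # r) (t ?N j) * y j (k # r) f =
      (\<Sum>k'\<in>?K' k. ?term j k r k')"
      by (simp add: sum_distrib_right)
  qed
  also have "\<dots> = (\<Sum>k\<in>?K. \<Sum>k'\<in>?K' k.
      \<Sum>j<Suc n. \<Sum>r\<in>?R' k. ?term j k r k')"
    by (rule trans[OF sum.swap], rule sum.cong[OF refl], rule trans[OF _ sum.swap])
      (intro sum.cong refl sum.swap)
  also have "\<dots> = (\<Sum>k\<in>?K. \<Sum>k'\<in>?K' k.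
      (if src n k' = tgt (Suc n) q' then ?M k k' * ?ind k k' else 0))"
    by (intro sum.cong refl) (simp add: induced_def sum_distrib_left mult.assoc mult.left_commute del: sum.lessThan_Suc)
  also have "\<dots> = (\<Sum>k\<in>?K. \<Sum>k'\<in>{k' \<in> E n. tgt n k' = tgt n k \<and> src n k' = tgt (Suc n) q'}.
      ?M k k' * ?ind k k')"
    using finite_E by (intro sum.cong refl sum.mono_neutral_cong_right) auto
  also have "\<dots> = (\<Sum>(k, k')\<in>(SIGMA k:?K. {k' \<in> E n. tgt n k' = tgt n k \<and> src n k' = tgt (Suc n) q'}).
      ?M k k' * ?ind k k')"
    using finite_E by (intro sum.Sigma) auto
  also have "(SIGMA k:?K. {k' \<in> E n. tgt n k' = tgt n k \<and> src n k' = tgt (Suc n) q'}) =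
      valleys n p (tgt (Suc n) q')"
    by (auto simp: valleys_def)
  finally have "(\<Sum>j<Suc n. \<Sum>r\<in>?R. coef ?N (q' # x) (q # r) (t ?N j) * y j r f) =
    (\<Sum>(k, k')\<in>valleys n p (tgt (Suc n) q'). ?M k k' * ?ind k k')" .
  then show "induced (Suc n) p y (q' # x) q f = (if q = q' then y (Suc n) x f else 0) +
     (\<Sum>(k, k')\<in>valleys n p (tgt (Suc n) q'). ?M k k' * ?ind k k')"
    unfolding induced_def[of "Suc n"] sum.lessThan_Suc[of _ "Suc n"] last by (simp add: add.commute)
qed

text \<open>The dimensions of the labels below \<open>p\<close> add up to
  \<open>npaths (Suc n) p\<close>, so the recursive calls cost \<open>Suc n ^ 3\<close> times that
  number. The at most \<open>Suc (Suc n) * npaths (Suc n) p\<close> outputs have at most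
  \<open>Suc n\<close> valley terms and one direct term each, and
  \<open>(n+1)^3 + (n+2)^2 \<le> (n+2)^3\<close>.\<close>

lemma induced_cost:
  assumes "p \<in> \<Lambda> n" and "\<And>j r. j < Suc n \<Longrightarrow> r \<in> X n \<Longrightarrow> lab n r = p \<Longrightarrow> y j r \<in> V"
  shows "ext_cost S (Suc n ^ 3 * npaths n p) V ((\<lambda>(x, q). induced n p y x q) ` induced_index n p)"
  using assms
proof (induction n arbitrary: p y)
  case 0
  have p: "p = 1" using 0 by (simp add: \<Lambda>_0)
  have "ext_cost S 1 V {induced 0 p y x q}" for x q
    using ext_cost_lincomb[of "{[]::'a list}" "y 0" V S "\<lambda>r. coef (Suc 0) x [q] (t (Suc 0) 0)"] 0(2)[of 0 "[]"]
    by (simp add: induced_def p)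
  then have "ext_cost S (\<Sum>i\<in>induced_index 0 p. 1) V (\<Union>i\<in>induced_index 0 p. {case i of (x, q) \<Rightarrow> induced 0 p y x q})"
    by (intro ext_cost_UN finite_induced_index) (auto split: prod.splits)
  then show ?case
    by (rule ext_cost_mono) (use card_induced_index[OF 0(1)] in auto)
next
  case (Suc n)
  let ?y = "\<lambda>k j r. y j (k # r)"
  let ?K = "{k \<in> E n. src n k = p}"
  let ?W = "\<lambda>k. (\<lambda>(x, q). induced n (tgt n k) (?y k) x q) ` induced_index n (tgt n k)"
  let ?W' = "\<Union>k\<in>?K. ?W k"
  let ?I = "induced_index (Suc n) p"
  have "ext_cost S (\<Sum>k\<in>?K. Suc n ^ 3 * npaths n (tgt n k)) V ?W'"
  proof (rule ext_cost_UN)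
    show "finite ?K" using finite_E by simp
    fix k assume k: "k \<in> ?K"
    show "ext_cost S (Suc n ^ 3 * npaths n (tgt n k)) V (?W k)"
    proof (rule Suc.IH)
      show "tgt n k \<in> \<Lambda> n" using k tgt_\<Lambda> by simp
      fix j r assume "j < Suc n" "r \<in> X n" "lab n r = tgt n k"
      then show "y j (k # r) \<in> V" using k by (intro Suc.prems) auto
    qed
  qed
  also have "(\<Sum>k\<in>?K. Suc n ^ 3 * npaths n (tgt n k)) = Suc n ^ 3 * npaths (Suc n) p"
    by (simp only: npaths_Suc sum_distrib_left)
  finally have 1: "ext_cost S (Suc n ^ 3 * npaths (Suc n) p) V ?W'" .
  have out: "ext_cost S (Suc (Suc n)) (V \<union> ?W') {case i of (x, q) \<Rightarrow> induced (Suc n) p y x q}"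
    if i: "i \<in> ?I" for i
  proof -
    obtain x' q where xq: "i = (x', q)" by fastforce
    then obtain q' x where x': "x' = q' # x" "x \<in> X (Suc n)" "tgt (Suc n) q' = lab (Suc n) x"
      and q': "q' \<in> E (Suc n)"
      using i by (auto simp: induced_index_iff)
    \<comment> \<open>\<open>None\<close> stands for the direct term of the trivial coset, present
      only for \<open>q = q'\<close>, and \<open>Some\<close> for the valley terms.\<close>
    let ?stay = "if q = q' then {None :: ('a \<times> 'a) option} else {}"
    let ?move = "Some ` valleys n p (tgt (Suc n) q')"
    let ?J = "?stay \<union> ?move"
    let ?c = "\<lambda>w. case w of None \<Rightarrow> 1 | Some (k, k') \<Rightarrow> swap_coef n q' k' q k"
    let ?v = "\<lambda>w. case w of None \<Rightarrow> y (Suc n) x | Some (k, k') \<Rightarrow> induced n (tgt n k) (?y k) x k'"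
    have ind: "(x', q) \<in> ?I" "(q' # x, q) \<in> ?I" using i xq x' by simp_all
    have finJ: "finite ?stay" "finite ?move" "finite ?J" using finite_valleys by auto
    have "ext_cost S (card ?J) (V \<union> ?W') {\<lambda>f. \<Sum>w\<in>?J. ?c w * ?v w f}"
    proof (rule ext_cost_lincomb)
      fix e assume e: "e \<in> ?J"
      show "?v e \<in> V \<union> ?W'"
      proof (cases e)
        case None
        then have "q = q'" using e by (auto split: if_splits)
        then have "lab (Suc n) x = p" using ind(2) x' by (auto simp: induced_index_iff)
        then have "y (Suc n) x \<in> V" using Suc.prems(2)[of "Suc n" x] x' by blast
        then show ?thesis using None by simp
      next
        case (Some kk)
        then obtain k k' where kk: "e = Some (k, k')" "(k, k') \<in> valleys n p (tgt (Suc n) q')"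
          using e by (cases kk) (auto split: if_splits)
        then have "k \<in> ?K" "(x, k') \<in> induced_index n (tgt n k)"
          using x' by (auto simp: valleys_def induced_index_iff simp del: X.simps lab.simps)
        then have "induced n (tgt n k) (?y k) x k' \<in> ?W'" by force
        then show ?thesis using kk(1) by simp
      qed
    qed (rule finJ)
    also have "(\<lambda>f. \<Sum>w\<in>?J. ?c w * ?v w f) = induced (Suc n) p y x' q"
    proof
      fix f
      have "(\<Sum>w\<in>?J. ?c w * ?v w f) = (\<Sum>w\<in>?stay. ?c w * ?v w f) + (\<Sum>w\<in>?move. ?c w * ?v w f)"
        by (rule sum.union_disjoint[OF finJ(1,2)]) auto
      also have "(\<Sum>w\<in>?move. ?c w * ?v w f) =
         (\<Sum>(k, k')\<in>valleys n p (tgt (Suc n) q'). swap_coef n q' k' q k * induced n (tgt n k) (?y k) x k' f)"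
        by (subst sum.reindex) (auto intro!: sum.cong)
      finally show "(\<Sum>w\<in>?J. ?c w * ?v w f) = induced (Suc n) p y x' q f"
        using induced_Suc[OF ind(2), of y] x'(1) by simp
    qed
    finally have *: "ext_cost S (card ?J) (V \<union> ?W') {induced (Suc n) p y x' q}" .
    have "card ?stay \<le> 1" by simp
    moreover have "card ?move \<le> Suc n"
      using card_valleys_le[OF Suc.prems(1) tgt_\<Lambda>[OF q']] by (simp add: card_image)
    ultimately have "card ?J \<le> Suc (Suc n)" using card_Un_le[of ?stay ?move] by linarith
    with * show ?thesis unfolding xq by (auto intro: ext_cost_mono)
  qed
  have "ext_cost S (\<Sum>i\<in>?I. Suc (Suc n)) (V \<union> ?W') (\<Union>i\<in>?I. {case i of (x, q) \<Rightarrow> induced (Suc n) p y x q})"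
    by (intro ext_cost_UN finite_induced_index out)
  from ext_cost_trans[OF 1 this] show ?case
  proof (rule ext_cost_mono)
    have "Suc n ^ 3 * npaths (Suc n) p + (\<Sum>i\<in>?I. Suc (Suc n)) \<le>
        Suc n ^ 3 * npaths (Suc n) p + (Suc (Suc n) * npaths (Suc n) p) * Suc (Suc n)"
      using card_induced_index[OF Suc.prems(1)] by (simp del: mult_Suc mult_Suc_right)
    also have "\<dots> = (Suc n ^ 3 + Suc (Suc n) ^ 2) * npaths (Suc n) p"
      by (simp add: algebra_simps power2_eq_square)
    also have "\<dots> \<le> Suc (Suc n) ^ 3 * npaths (Suc n) p"
      by (intro mult_le_mono1) (simp add: power3_eq_cube power2_eq_square algebra_simps)
    finally show "Suc n ^ 3 * npaths (Suc n) p + (\<Sum>i\<in>?I. Suc (Suc n)) \<le> Suc (Suc n) ^ 3 * npaths (Suc n) p" .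
  qed auto
qed

text \<open>Splitting the group into cosets gives \<open>Suc n\<close> transforms of the smaller
  group. A column \<open>b = q # T\<close> of the large transform then needs only the columns
  \<open>T\<close> of these, so each path \<open>T\<close> calls for one induced transform, and
  \<open>sum_npaths_le\<close> bounds their total cost.\<close>

lemma fft_cost:
  assumes "\<And>g. g \<in> G n \<Longrightarrow> x g \<in> V"
  shows "ext_cost S (n ^ 3 * fact n) V
    ((\<lambda>(a, b) f. \<Sum>g\<in>G n. coef n a b g * x g f) ` {(a, b). a \<in> X n \<and> b \<in> X n \<and> lab n a = lab n b})"
  using assms
proof (induction n arbitrary: x)
  case 0
  \<comment> \<open>At level 0 the budget is 0, so the only output must literally be an
    input.\<close>
  have "coef 0 [] [] 1 = 1" using coef_one[of "[]" 0 "[]"] by simp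
  then show ?case using 0[of 1] by (intro ext_cost_subset) (auto simp: G_0)
next
  case (Suc n)
  let ?P = "\<lambda>n. {(a, b). a \<in> X n \<and> b \<in> X n \<and> lab n a = lab n b}"
  let ?x = "\<lambda>j h. x (t (Suc n) j * h)"
  let ?F = "\<lambda>j a b f. \<Sum>h\<in>G n. coef n a b h * ?x j h f"
  let ?W = "\<lambda>j. (\<lambda>(a, b). ?F j a b) ` ?P n"
  let ?W' = "\<Union>j<Suc n. ?W j"
  let ?U = "\<lambda>T. (\<lambda>(a, q). induced n (lab n T) (\<lambda>j r. ?F j r T) a q) ` induced_index n (lab n T)"
  have 1: "ext_cost S (\<Sum>j<Suc n. n ^ 3 * fact n) V ?W'"
  proof (rule ext_cost_UN)
    fix j assume "j \<in> {..<Suc n}"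
    then show "ext_cost S (n ^ 3 * fact n) V (?W j)"
      using t_mult_G Suc.prems by (intro Suc.IH) auto
  qed simp
  have 2: "ext_cost S (\<Sum>T\<in>X n. Suc n ^ 3 * npaths n (lab n T)) (V \<union> ?W') (\<Union>T\<in>X n. ?U T)"
  proof (rule ext_cost_UN[OF finite_X induced_cost])
    fix T assume T: "T \<in> X n"
    show "lab n T \<in> \<Lambda> n" using lab_\<Lambda>[OF T] .
    fix j r assume "j < Suc n" "r \<in> X n" "lab n r = lab n T"
    then have "?F j r T \<in> ?W j" using T by auto
    then show "?F j r T \<in> V \<union> ?W'" using \<open>j < Suc n\<close> by blast
  qed
  from ext_cost_trans[OF 1 2] show ?case
  proof (rule ext_cost_mono)
    have "(\<Sum>j<Suc n. n ^ 3 * fact n) + (\<Sum>T\<in>X n. Suc n ^ 3 * npaths n (lab n T)) =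
        Suc n * (n ^ 3 * fact n) + Suc n ^ 3 * (\<Sum>T\<in>X n. npaths n (lab n T))"
      by (simp only: sum_distrib_left sum_constant card_lessThan of_nat_id)
    also have "\<dots> \<le> Suc n * (n ^ 3 * fact n) + Suc n ^ 3 * fact n"
      using sum_npaths_le by (intro add_left_mono mult_le_mono2)
    also have "\<dots> = Suc n * fact n * (n ^ 3 + Suc n ^ 2)"
      by (simp only: power2_eq_square power3_eq_cube) (simp add: algebra_simps)
    also have "\<dots> \<le> Suc n * fact n * Suc n ^ 3"
      by (intro mult_le_mono2) (simp add: power3_eq_cube power2_eq_square algebra_simps)
    also have "\<dots> = Suc n ^ 3 * fact (Suc n)" by simp
    finally show "(\<Sum>j<Suc n. n ^ 3 * fact n) + (\<Sum>T\<in>X n. Suc n ^ 3 * npaths n (lab n T)) \<le> Suc n ^ 3 * fact (Suc n)" .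
    show "(\<lambda>(a, b) f. \<Sum>g\<in>G (Suc n). coef (Suc n) a b g * x g f) ` ?P (Suc n) \<subseteq> V \<union> ?W' \<union> (\<Union>T\<in>X n. ?U T)"
    proof
      fix w assume "w \<in> (\<lambda>(a, b) f. \<Sum>g\<in>G (Suc n). coef (Suc n) a b g * x g f) ` ?P (Suc n)"
      then obtain a b where w: "w = (\<lambda>f. \<Sum>g\<in>G (Suc n). coef (Suc n) a b g * x g f)"
        and a: "a \<in> X (Suc n)" and b: "b \<in> X (Suc n)" and ab: "lab (Suc n) a = lab (Suc n) b"
        by (auto simp del: X.simps lab.simps)
      obtain q T where qT: "b = q # T" "q \<in> E n" "T \<in> X n" "tgt n q = lab n T" using b by auto
      have "(\<Sum>g\<in>G (Suc n). coef (Suc n) a b g * x g f) = induced n (lab n T) (\<lambda>j r. ?F j r T) a q f" for f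
      proof -
        have "(\<Sum>g\<in>G (Suc n). coef (Suc n) a b g * x g f) =
           (\<Sum>j<Suc n. \<Sum>h\<in>G n. \<Sum>r\<in>{r \<in> X n. lab n r = lab n T}.
              coef (Suc n) a (q # r) (t (Suc n) j) * (coef n r T h * ?x j h f))"
          unfolding sum_G_Suc
        proof (intro sum.cong refl)
          fix j h assume j: "j \<in> {..<Suc n}" and h: "h \<in> G n"
          have hB: "h \<in> B n" using G_subset_B h .
          have tB: "t (Suc n) j \<in> B (Suc n)" using t_G G_subset_B j by blast
          let ?R = "{r \<in> X n. lab n r = lab n T}"
          have "coef (Suc n) a b (t (Suc n) j * h) = (\<Sum>w\<in>X (Suc n). coef (Suc n) a w (t (Suc n) j) * coef (Suc n) w b h)"
            using coef_mult[OF a b tB B_mono[OF hB]] .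
          \<comment> \<open>\<open>h\<close> lies in the lower algebra and preserves the top edge
            \<open>q\<close> of the column.\<close>
          also have "\<dots> = (\<Sum>w\<in>(\<lambda>r. q # r) ` ?R. coef (Suc n) a w (t (Suc n) j) * coef (Suc n) w b h)"
          proof (rule sum.mono_neutral_right[OF finite_X])
            show "(\<lambda>r. q # r) ` ?R \<subseteq> X (Suc n)" using qT by auto
            show "\<forall>w\<in>X (Suc n) - (\<lambda>r. q # r) ` ?R. coef (Suc n) a w (t (Suc n) j) * coef (Suc n) w b h = 0"
            proof
              fix w assume w: "w \<in> X (Suc n) - (\<lambda>r. q # r) ` ?R"
              then obtain q2 r where r: "w = q2 # r" "r \<in> X n" "tgt n q2 = lab n r" by auto
              then have "q2 \<noteq> q" using w qT by auto
              then have "coef (Suc n) w b h = 0"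
                using coef_lower[of q2 r n q T h] w r qT(1) b hB by auto
              then show "coef (Suc n) a w (t (Suc n) j) * coef (Suc n) w b h = 0" by simp
            qed
          qed
          also have "\<dots> = (\<Sum>r\<in>?R. coef (Suc n) a (q # r) (t (Suc n) j) * coef n r T h)"
          proof (rule sum.reindex_cong[of "(#) q"])
            fix r assume "r \<in> ?R"
            then have "q # r \<in> X (Suc n)" using qT by auto
            from coef_lower[OF this b[unfolded qT(1)] hB]
            show "coef (Suc n) a (q # r) (t (Suc n) j) * coef (Suc n) (q # r) b h =
               coef (Suc n) a (q # r) (t (Suc n) j) * coef n r T h" by (simp add: qT(1))
          qed simp_all
          finally show "coef (Suc n) a b (t (Suc n) j * h) * x (t (Suc n) j * h) f =
             (\<Sum>r\<in>?R. coef (Suc n) a (q # r) (t (Suc n) j) * (coef n r T h * ?x j h f))"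
            by (simp add: sum_distrib_right mult.assoc)
        qed
        also have "\<dots> = induced n (lab n T) (\<lambda>j r. ?F j r T) a q f"
          unfolding induced_def sum_distrib_left by (intro sum.cong refl sum.swap)
        finally show ?thesis .
      qed
      then have "w = induced n (lab n T) (\<lambda>j r. ?F j r T) a q"
        unfolding w by blast
      moreover have "(a, q) \<in> induced_index n (lab n T)"
        using a ab qT by (simp add: induced_index_iff del: X.simps)
      ultimately have "w \<in> ?U T" by force
      then show "w \<in> V \<union> ?W' \<union> (\<Union>T\<in>X n. ?U T)" using qT(3) by blast
    qed
  qed simp
qed

end


subsection \<open>The group algebras of the symmetric groups\<close>

text \<open>
  The convolution product of \<^type>\<open>poly_mapping\<close> is formed along the addition of its index type,
  so composition of permutations is made available as a (noncommutative) addition.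
\<close>

instantiation perm :: (type) group_add
begin

definition zero_perm :: "'a perm" where "zero_perm = 1"
definition plus_perm :: "'a perm \<Rightarrow> 'a perm \<Rightarrow> 'a perm" where "plus_perm p q = p * q"
definition uminus_perm :: "'a perm \<Rightarrow> 'a perm" where "uminus_perm p = inverse p"
definition minus_perm :: "'a perm \<Rightarrow> 'a perm \<Rightarrow> 'a perm" where "minus_perm p q = p * inverse q"

instance
  by standard (simp_all add: zero_perm_def plus_perm_def uminus_perm_def minus_perm_def mult.assoc)

end

section \<open>The group algebra of an arbitrary group as a star-algebra\<close>

abbreviation (input) "pm_at \<equiv> Poly_Mapping.lookup"
abbreviation (input) "pm_keys \<equiv> Poly_Mapping.keys"
abbreviation (input) "pm_single \<equiv> Poly_Mapping.single"

definition pm_scale :: "complex \<Rightarrow> ('g::group_add \<Rightarrow>\<^sub>0 complex) \<Rightarrow> ('g \<Rightarrow>\<^sub>0 complex)" where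
  "pm_scale c x = pm_single 0 c * x"

lift_definition pm_star :: "('g::group_add \<Rightarrow>\<^sub>0 complex) \<Rightarrow> ('g \<Rightarrow>\<^sub>0 complex)" is "\<lambda>x g. cnj (x (- g))"
proof -
  fix x :: "'g \<Rightarrow> complex" assume "finite {g. x g \<noteq> 0}"
  moreover have "{g. cnj (x (- g)) \<noteq> 0} = uminus ` {g. x g \<noteq> 0}"
    by (auto simp: image_iff) (metis minus_minus)
  ultimately show "finite {g. cnj (x (- g)) \<noteq> 0}" by simp
qed

abbreviation (input) "pm_sum x \<equiv> \<Sum>g\<in>pm_keys x. pm_single g (pm_at x g)"

lemma pm_expand: "x = pm_sum x"
proof (rule poly_mapping_eqI)
  fix k
  have "pm_at (pm_sum x) k =
      (\<Sum>g\<in>pm_keys x. if g = k then pm_at x g else 0)"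
    by (simp add: Poly_Mapping.lookup_sum lookup_single when_def)
  also have "\<dots> = pm_at x k" by (auto simp: in_keys_iff)
  finally show "pm_at x k = pm_at (pm_sum x) k" by simp
qed

lemma pm_star_add: "pm_star (x + y) = pm_star x + pm_star y"
  by (rule poly_mapping_eqI) (simp add: pm_star.rep_eq Poly_Mapping.lookup_add)

lemma pm_star_sum: "pm_star (\<Sum>i\<in>I. f i) = (\<Sum>i\<in>I. pm_star (f i))"
proof -
  have "pm_star 0 = 0" by (rule poly_mapping_eqI) (simp add: pm_star.rep_eq)
  then show ?thesis by (induction I rule: infinite_finite_induct) (simp_all add: pm_star_add)
qed

lemma pm_star_single: "pm_star (pm_single g c) = pm_single (- g) (cnj c)"
  by (rule poly_mapping_eqI) (auto simp: pm_star.rep_eq lookup_single when_def)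

lemma pm_mult_expand:
  "x * y = (\<Sum>g\<in>pm_keys x. \<Sum>h\<in>pm_keys y. pm_single (g + h) (pm_at x g * pm_at y h))"
proof -
  have "x * y = (pm_sum x) * (pm_sum y)"
    by (simp only: pm_expand[symmetric])
  then show ?thesis by (simp only: sum_product mult_single)
qed

lemma pm_star_mult: "pm_star (x * y) = pm_star y * pm_star x"
proof -
  have "pm_star (x * y) = (\<Sum>g\<in>pm_keys x. \<Sum>h\<in>pm_keys y. pm_single (- h + - g) (cnj (pm_at x g) * cnj (pm_at y h)))"
    by (subst pm_mult_expand) (simp add: pm_star_sum pm_star_single minus_add)
  also have "\<dots> = (\<Sum>h\<in>pm_keys y. \<Sum>g\<in>pm_keys x. pm_star (pm_single h (pm_at y h)) * pm_star (pm_single g (pm_at x g)))"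
    by (subst sum.swap) (simp add: pm_star_single mult_single mult.commute)
  also have "\<dots> = pm_star (pm_sum y) * pm_star (pm_sum x)"
    by (simp only: pm_star_sum sum_product)
  also have "\<dots> = pm_star y * pm_star x" by (simp only: pm_expand[symmetric])
  finally show ?thesis .
qed

lemma pm_star_star: "pm_star (pm_star x) = x"
  by (rule poly_mapping_eqI) (simp add: pm_star.rep_eq)

lemma pm_single_0_commute: "pm_single 0 c * x = x * pm_single 0 (c::complex)"
proof -
  have "pm_single 0 c * (pm_sum x) =
     (pm_sum x) * pm_single 0 c"
    by (simp only: sum_distrib_left sum_distrib_right mult_single) (simp add: mult.commute)
  then show ?thesis by (simp only: pm_expand[symmetric])
qed

text \<open>The coefficient of \<open>pm_star x * x\<close> at the identity is the sum of the
  squared moduli of the coefficients of \<open>x\<close>.\<close>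

lemma pm_star_mult_self:
  assumes "pm_star x * x = 0"
  shows "x = 0"
proof -
  have "pm_star x * x = pm_star (pm_sum x) * (pm_sum x)"
    by (simp only: pm_expand[symmetric])
  also have "\<dots> = (\<Sum>g\<in>pm_keys x. \<Sum>h\<in>pm_keys x. pm_single (- g + h) (cnj (pm_at x g) * pm_at x h))"
    by (simp only: pm_star_sum sum_product pm_star_single mult_single)
  finally have "pm_at (\<Sum>g\<in>pm_keys x. \<Sum>h\<in>pm_keys x. pm_single (- g + h) (cnj (pm_at x g) * pm_at x h)) 0 = 0"
    using assms by (simp add: Poly_Mapping.lookup_zero)
  then have "(\<Sum>g\<in>pm_keys x. \<Sum>h\<in>pm_keys x. if h = g then cnj (pm_at x g) * pm_at x h else 0) = 0"
    by (simp add: Poly_Mapping.lookup_sum lookup_single when_def neg_eq_iff_add_eq_0[symmetric] eq_commute[of _ "- _"])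
  then have "(\<Sum>g\<in>pm_keys x. cnj (pm_at x g) * pm_at x g) = 0" by simp
  then have "(\<Sum>g\<in>pm_keys x. complex_of_real ((cmod (pm_at x g))\<^sup>2)) = 0"
    by (simp only: complex_norm_square) (simp only: mult.commute)
  then have "(\<Sum>g\<in>pm_keys x. (cmod (pm_at x g))\<^sup>2) = 0"
    by (metis (no_types, lifting) of_real_0 of_real_eq_iff of_real_sum sum.cong)
  then have "\<forall>g\<in>pm_keys x. pm_at x g = 0" by (simp add: sum_nonneg_eq_0_iff)
  then show "x = 0" by (intro poly_mapping_eqI) (metis in_keys_iff Poly_Mapping.lookup_zero)
qed

lemma star_algebra_pm: "star_algebra pm_scale pm_star"
proof
  fix a b :: complex and x y :: "'g::group_add \<Rightarrow>\<^sub>0 complex"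
  show "pm_scale a (x + y) = pm_scale a x + pm_scale a y" "pm_scale (a + b) x = pm_scale a x + pm_scale b x"
    by (simp_all add: pm_scale_def distrib_left distrib_right single_add)
  show "pm_scale a (pm_scale b x) = pm_scale (a * b) x"
    by (simp add: pm_scale_def mult_single flip: mult.assoc)
  show "pm_scale 1 x = x" by (simp add: pm_scale_def)
  show "pm_scale a x * y = pm_scale a (x * y)" by (simp add: pm_scale_def mult.assoc)
  show "x * pm_scale a y = pm_scale a (x * y)"
    by (metis pm_scale_def mult.assoc pm_single_0_commute)
  show "pm_star (x + y) = pm_star x + pm_star y" by (rule pm_star_add)
  show "pm_star (x * y) = pm_star y * pm_star x" by (rule pm_star_mult)
  show "pm_star (pm_star x) = x" by (rule pm_star_star)
  show "pm_star (pm_scale a x) = pm_scale (cnj a) (pm_star x)"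
    by (simp add: pm_scale_def pm_star_mult pm_star_single pm_single_0_commute)
  show "pm_star x * x = 0 \<Longrightarrow> x = 0" by (rule pm_star_mult_self)
qed

section \<open>The tower of symmetric groups\<close>

definition Sym :: "nat \<Rightarrow> nat perm set" where
  "Sym n = {p. affected p \<subseteq> {..<n}}"

text \<open>For \<open>j < n\<close>, \<open>coset_rep (Suc n) j\<close> is the product of the
  adjacent transpositions \<open>(j j+1)\<close>, ..., \<open>(n-1 n)\<close>, a cycle that sends
  \<open>n\<close> to \<open>j\<close>.\<close>

primrec coset_rep :: "nat \<Rightarrow> nat \<Rightarrow> nat perm" where
  "coset_rep 0 j = 1"
| "coset_rep (Suc n) j = (if j < n then coset_rep n j * Perm.swap (n - 1) n else 1)"

lemma Sym_mult: "p \<in> Sym n \<Longrightarrow> q \<in> Sym n \<Longrightarrow> p * q \<in> Sym n"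
  unfolding Sym_def using affected_times[of p q] by blast

lemma Sym_inverse: "p \<in> Sym n \<Longrightarrow> inverse p \<in> Sym n"
  by (simp add: Sym_def)

lemma Sym_1: "1 \<in> Sym n"
  by (simp add: Sym_def)

lemma Sym_0: "Sym 0 = {1}"
  by (auto simp: Sym_def)

lemma Sym_mono: "m \<le> n \<Longrightarrow> Sym m \<subseteq> Sym n"
  by (auto simp: Sym_def)

lemma Sym_apply: "p \<in> Sym n \<Longrightarrow> n \<le> i \<Longrightarrow> apply p i = i"
  by (metis Sym_def in_affected lessThan_iff mem_Collect_eq not_less subsetD)

lemma Sym_apply_less:
  assumes "p \<in> Sym n" "i < n"
  shows "apply p i < n"
proof (rule ccontr)
  assume "\<not> apply p i < n"
  then have "apply p (apply p i) = apply p i" using Sym_apply[OF assms(1)] by simp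
  then have "apply p i = i" by (simp add: apply_inj)
  then show False using assms \<open>\<not> _\<close> by simp
qed

lemma coset_rep_Sym: "j < n \<Longrightarrow> coset_rep n j \<in> Sym n"
proof (induction n)
  case (Suc n)
  show ?case
  proof (cases "j < n")
    case True
    then have "coset_rep n j \<in> Sym (Suc n)" using Suc.IH Sym_mono[of n "Suc n"] by auto
    moreover have "Perm.swap (n - 1) n \<in> Sym (Suc n)" using True by (simp add: Sym_def affected_swap)
    ultimately show ?thesis using True by (simp add: Sym_mult)
  qed (simp add: Sym_1)
qed simp

lemma coset_rep_apply: "j \<le> n \<Longrightarrow> apply (coset_rep (Suc n) j) n = j"
proof (induction n)
  case (Suc n)
  then show ?case
    by (cases "j = Suc n") (auto simp: apply_times simp del: coset_rep.simps(2)
        simp add: coset_rep.simps(2)[of "Suc n"])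
qed simp

text \<open>The image of the point \<open>n\<close> identifies the coset, since elements of
  \<open>Sym n\<close> fix \<open>n\<close> and \<open>coset_rep (Suc n) j\<close> sends it to
  \<open>j\<close>.\<close>

lemma Sym_Suc: "bij_betw (\<lambda>(j, h). coset_rep (Suc n) j * h) ({..<Suc n} \<times> Sym n) (Sym (Suc n))"
  unfolding bij_betw_def
proof
  have ap: "apply (coset_rep (Suc n) j * h) n = j" if "j < Suc n" "h \<in> Sym n" for j h
    using that coset_rep_apply[of j n] Sym_apply[of h n n]
    by (simp add: apply_times del: coset_rep.simps)
  show "inj_on (\<lambda>(j, h). coset_rep (Suc n) j * h) ({..<Suc n} \<times> Sym n)"
  proof (rule inj_onI, clarify)
    fix j h j' h' assume a: "j < Suc n" "h \<in> Sym n" "j' < Suc n" "h' \<in> Sym n"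
      and e: "coset_rep (Suc n) j * h = coset_rep (Suc n) j' * h'"
    then have "j = j'" using ap by metis
    moreover from this e have "h = h'" by (metis perm.left_cancel)
    ultimately show "j = j' \<and> h = h'" by blast
  qed
  show "(\<lambda>(j, h). coset_rep (Suc n) j * h) ` ({..<Suc n} \<times> Sym n) = Sym (Suc n)"
  proof
    show "(\<lambda>(j, h). coset_rep (Suc n) j * h) ` ({..<Suc n} \<times> Sym n) \<subseteq> Sym (Suc n)"
      using coset_rep_Sym[of _ "Suc n"] Sym_mono[of n "Suc n"]
      by (auto intro!: Sym_mult simp del: coset_rep.simps)
    show "Sym (Suc n) \<subseteq> (\<lambda>(j, h). coset_rep (Suc n) j * h) ` ({..<Suc n} \<times> Sym n)"
    proof
      fix g assume g: "g \<in> Sym (Suc n)"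
      define j where "j = apply g n"
      have j: "j < Suc n" using Sym_apply_less[OF g] by (simp add: j_def)
      define h where "h = inverse (coset_rep (Suc n) j) * g"
      have gh: "g = coset_rep (Suc n) j * h"
        by (simp add: h_def del: coset_rep.simps flip: mult.assoc)
      have "h \<in> Sym (Suc n)" unfolding h_def using g j coset_rep_Sym Sym_mult Sym_inverse by blast
      moreover have "apply h n = n"
      proof -
        have "apply (coset_rep (Suc n) j) (apply h n) = apply (coset_rep (Suc n) j) n"
          using coset_rep_apply[of j n] j gh by (metis apply_sequence j_def less_Suc_eq_le)
        then show ?thesis by (simp only: apply_inj)
      qed
      ultimately have "h \<in> Sym n"
        unfolding Sym_def using in_affected[of n h] by (auto simp: less_Suc_eq dest!: subsetD)
      then show "g \<in> (\<lambda>(j, h). coset_rep (Suc n) j * h) ` ({..<Suc n} \<times> Sym n)"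
        using j gh by (intro image_eqI[of _ _ "(j, h)"]) (auto simp del: coset_rep.simps)
    qed
  qed
qed

lemma finite_Sym: "finite (Sym n)" and card_Sym: "card (Sym n) = fact n"
proof -
  have "finite (Sym n) \<and> card (Sym n) = fact n"
  proof (induction n)
    case (Suc n)
    then show ?case
      using bij_betw_finite[OF Sym_Suc[of n]] bij_betw_same_card[OF Sym_Suc[of n]]
      by (simp add: card_cartesian_product)
  qed (simp add: Sym_0)
  then show "finite (Sym n)" "card (Sym n) = fact n" by auto
qed

abbreviation pm_delta :: "nat perm \<Rightarrow> (nat perm \<Rightarrow>\<^sub>0 complex)" where
  "pm_delta p \<equiv> pm_single p 1"

lemma pm_delta_mult: "pm_delta p * pm_delta q = pm_delta (p * q)"
  by (simp add: mult_single plus_perm_def)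

lemma inj_pm_delta: "inj_on pm_delta A"
  by (rule inj_onI) (metis lookup_single_eq lookup_single_not_eq zero_neq_one)

lemma group_tower_Sym:
  "group_tower pm_scale pm_star (\<lambda>n. pm_delta ` Sym n) (\<lambda>n. pm_delta (Perm.swap (n - 1) n))
     (\<lambda>n j. pm_delta (coset_rep n j))"
proof -
  interpret star_algebra "pm_scale :: complex \<Rightarrow> (nat perm \<Rightarrow>\<^sub>0 complex) \<Rightarrow> _" pm_star
    by (rule star_algebra_pm)
  have d1: "pm_delta 1 = 1" by (metis single_one zero_perm_def)
  show ?thesis
  proof (unfold_locales, goal_cases)
    case (1 n)
    then show ?case by (simp add: finite_Sym)
  next
    case 2
    then show ?case by (simp add: Sym_0 d1)
  next
    case (3 n)
    then show ?case using Sym_1 d1 by (metis image_eqI)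
  next
    case (4 g n h)
    then show ?case by (auto simp: pm_delta_mult Sym_mult)
  next
    case (5 g n)
    then show ?case by (auto simp: pm_star_single uminus_perm_def Sym_inverse)
  next
    case (6 n)
    then show ?case by (auto simp: Sym_def affected_swap)
  next
    case (7 g n)
    then obtain p where p: "p \<in> Sym n" "g = pm_delta p" by blast
    have "p * Perm.swap n (Suc n) = Perm.swap n (Suc n) * p"
      using p by (intro perm_mult_commute) (auto simp: Sym_def affected_swap)
    then show ?case by (simp add: p pm_delta_mult)
  next
    case (8 n)
    then show ?case by (simp add: d1)
  next
    case (9 j n)
    then show ?case by (simp add: pm_delta_mult)
  next
    case (10 n)
    have "bij_betw (map_prod id pm_delta) ({..<Suc n} \<times> Sym n) ({..<Suc n} \<times> pm_delta ` Sym n)"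
      by (intro bij_betw_imageI map_prod_inj_on inj_pm_delta) (auto simp: image_iff)
    moreover have "bij_betw (pm_delta \<circ> (\<lambda>(j, h). coset_rep (Suc n) j * h)) ({..<Suc n} \<times> Sym n) (pm_delta ` Sym (Suc n))"
      using Sym_Suc inj_on_imp_bij_betw[OF inj_pm_delta] by (rule bij_betw_trans)
    moreover have "pm_delta \<circ> (\<lambda>(j, h). coset_rep (Suc n) j * h) =
        (\<lambda>(j, h). pm_delta (coset_rep (Suc n) j) * h) \<circ> map_prod id pm_delta"
      by (auto simp: pm_delta_mult fun_eq_iff simp del: coset_rep.simps)
    ultimately show ?case
      using bij_betw_comp_iff[of "map_prod id pm_delta" "{..<Suc n} \<times> Sym n" "{..<Suc n} \<times> pm_delta ` Sym n"
          "\<lambda>(j, h). pm_delta (coset_rep (Suc n) j) * h" "pm_delta ` Sym (Suc n)"]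
      by (simp only:)
  qed
qed

text \<open>
  The functions \<open>D n x y\<close> with \<open>lab n x = lab n y\<close> are the matrix entries of a complete set of
  irreducible representations of the symmetric group.
\<close>

locale sym_coefficients =
  fixes X :: "nat \<Rightarrow> 'x set" and lab :: "nat \<Rightarrow> 'x \<Rightarrow> 'l" and D :: "nat \<Rightarrow> 'x \<Rightarrow> 'x \<Rightarrow> nat perm \<Rightarrow> complex"
  assumes finX: "finite (X n)"
    and D_mult: "x \<in> X n \<Longrightarrow> y \<in> X n \<Longrightarrow> p \<in> Sym n \<Longrightarrow> q \<in> Sym n \<Longrightarrow>
      D n x y (p * q) = (\<Sum>w\<in>X n. D n x w p * D n w y q)"
    and D_lab: "x \<in> X n \<Longrightarrow> y \<in> X n \<Longrightarrow> p \<in> Sym n \<Longrightarrow> lab n x \<noteq> lab n y \<Longrightarrow> D n x y p = 0"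
    and D_surj: "(\<And>x y. x \<in> X n \<Longrightarrow> y \<in> X n \<Longrightarrow> lab n x \<noteq> lab n y \<Longrightarrow> c x y = 0) \<Longrightarrow>
      \<exists>a. \<forall>x\<in>X n. \<forall>y\<in>X n. (\<Sum>p\<in>Sym n. a p * D n x y p) = c x y"
    and D_inj: "(\<And>x y. x \<in> X n \<Longrightarrow> y \<in> X n \<Longrightarrow> lab n x = lab n y \<Longrightarrow> (\<Sum>p\<in>Sym n. a p * D n x y p) = 0) \<Longrightarrow>
      p \<in> Sym n \<Longrightarrow> a p = 0"

text \<open>The tower is hidden here: the later sections see only functions \<open>D\<close> on
  permutations together with the cost of summing against them.\<close>

lemma Sym_matrix_coefficients:
  obtains X :: "nat \<Rightarrow> (nat perm \<Rightarrow>\<^sub>0 complex) list set" and lab :: "nat \<Rightarrow> _ \<Rightarrow> nat perm \<Rightarrow>\<^sub>0 complex"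
    and D :: "nat \<Rightarrow> _ \<Rightarrow> _ \<Rightarrow> nat perm \<Rightarrow> complex"
  where "sym_coefficients X lab D"
    and "\<And>(S :: ('s, 'm) monoid_scheme) n z V. (\<And>p. p \<in> Sym n \<Longrightarrow> z p \<in> V) \<Longrightarrow>
      ext_cost S (n ^ 3 * fact n) V
        ((\<lambda>(x, y) f. \<Sum>p\<in>Sym n. D n x y p * z p f) ` {(x, y). x \<in> X n \<and> y \<in> X n \<and> lab n x = lab n y})"
proof -
  interpret group_tower pm_scale pm_star "\<lambda>n. pm_delta ` Sym n" "\<lambda>n. pm_delta (Perm.swap (n - 1) n)"
     "\<lambda>n j. pm_delta (coset_rep n j)"
    by (rule group_tower_Sym)
  obtain \<Lambda> E src tgt u v where b: "bratteli pm_scale pm_star (\<lambda>n. pm_delta ` Sym n) (\<lambda>n. pm_delta (Perm.swap (n - 1) n))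
     (\<lambda>n j. pm_delta (coset_rep n j)) \<Lambda> E src tgt u v"
    using bratteli_exists by blast
  interpret bratteli pm_scale pm_star "\<lambda>n. pm_delta ` Sym n" "\<lambda>n. pm_delta (Perm.swap (n - 1) n)"
     "\<lambda>n j. pm_delta (coset_rep n j)" \<Lambda> E src tgt u v
    by (rule b)
  let ?D = "\<lambda>n x y p. coef n x y (pm_delta p)"
  have dB: "pm_delta p \<in> B n" if "p \<in> Sym n" for p n
    using that by (intro G_subset_B) auto
  have cfs: "(\<Sum>p\<in>Sym n. a p * ?D n x y p) = coef n x y (\<Sum>p\<in>Sym n. pm_scale (a p) (pm_delta p))"
    if "x \<in> X n" "y \<in> X n" for x y n and a :: "nat perm \<Rightarrow> complex"
    using that dB by (intro coef_sum[symmetric]) auto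
  have lk: "pm_at (\<Sum>p\<in>Sym n. pm_scale (a p) (pm_delta p)) q = a q" if "q \<in> Sym n" for a n q
  proof -
    have "pm_at (\<Sum>p\<in>Sym n. pm_scale (a p) (pm_delta p)) q = (\<Sum>p\<in>Sym n. if p = q then a p else 0)"
      by (simp add: Poly_Mapping.lookup_sum pm_scale_def mult_single lookup_single when_def)
    then show ?thesis using that finite_Sym by simp
  qed
  have "sym_coefficients X lab ?D"
  proof (unfold_locales, goal_cases)
    case (1 n)
    show ?case by (rule finite_X)
  next
    case (2 x n y p q)
    then show ?case using coef_mult[of x n y "pm_delta p" "pm_delta q"] dB by (simp add: pm_delta_mult)
  next
    case (3 x n y p)
    then show ?case using coef_lab_neq dB by blast
  next
    case (4 n c)
    obtain z where z: "z \<in> B n" "\<forall>x\<in>X n. \<forall>y\<in>X n. coef n x y z = c x y"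
      using coef_surjective[of n c] 4 by blast
    have "\<exists>a. z = (\<Sum>p\<in>Sym n. pm_scale (a p) (pm_delta p))"
    proof -
      have "\<exists>a. z = (\<Sum>w\<in>pm_delta ` Sym n. pm_scale (a w) w)"
        using z(1) unfolding B_def span_finite[OF finite_imageI[OF finite_Sym]] by blast
      then show ?thesis by (auto simp: sum.reindex[OF inj_pm_delta])
    qed
    then obtain a where a: "z = (\<Sum>p\<in>Sym n. pm_scale (a p) (pm_delta p))" by blast
    then have "\<forall>x\<in>X n. \<forall>y\<in>X n. (\<Sum>p\<in>Sym n. a p * ?D n x y p) = c x y"
      using z(2) cfs by simp
    then show ?case by blast
  next
    case (5 n a p)
    let ?z = "\<Sum>p\<in>Sym n. pm_scale (a p) (pm_delta p)"
    have "?z \<in> B n" using dB by (intro B_sum B_scl)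
    moreover have "coef n x y ?z = 0" if "x \<in> X n" "y \<in> X n" "lab n x = lab n y" for x y
      using 5(1)[OF that] cfs[OF that(1,2)] by simp
    ultimately have "?z = 0" by (rule coef_faithful)
    then show ?case using lk[OF 5(2), of a] by simp
  qed
  moreover have "ext_cost S (n ^ 3 * fact n) V
      ((\<lambda>(x, y) f. \<Sum>p\<in>Sym n. ?D n x y p * z p f) ` {(x, y). x \<in> X n \<and> y \<in> X n \<and> lab n x = lab n y})"
    if "\<And>p. p \<in> Sym n \<Longrightarrow> z p \<in> V" for S :: "('s, 'm) monoid_scheme" and n z V
  proof -
    have "ext_cost S (n ^ 3 * fact n) V
      ((\<lambda>(a, b) f. \<Sum>g\<in>pm_delta ` Sym n. coef n a b g * (\<lambda>g. z (the_inv_into (Sym n) pm_delta g)) g f) `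
         {(a, b). a \<in> X n \<and> b \<in> X n \<and> lab n a = lab n b})"
      using that by (intro fft_cost) (auto simp: the_inv_into_f_f[OF inj_pm_delta])
    then show ?thesis
      by (simp add: sum.reindex[OF inj_pm_delta] the_inv_into_f_f[OF inj_pm_delta])
  qed
  ultimately show thesis by (rule that)
qed


subsection \<open>Complete sets of irreducible representations from matrix coefficients\<close>

text \<open>The axioms say that the semigroup algebra is isomorphic, through the functions
  \<open>M i j\<close>, to the algebra of block-diagonal matrices with one block for each
  label.\<close>

locale matrix_coefficients =
  fixes S :: "('s, 'm) monoid_scheme" and I :: "'i set" and lab :: "'i \<Rightarrow> 'l"
    and M :: "'i \<Rightarrow> 'i \<Rightarrow> 's \<Rightarrow> complex"
  assumes finite_S: "finite (carrier S)" and finite_I: "finite I"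
    and closed: "s \<in> carrier S \<Longrightarrow> s' \<in> carrier S \<Longrightarrow> s \<otimes>\<^bsub>S\<^esub> s' \<in> carrier S"
    and M_mult: "i \<in> I \<Longrightarrow> j \<in> I \<Longrightarrow> s \<in> carrier S \<Longrightarrow> s' \<in> carrier S \<Longrightarrow>
      M i j (s \<otimes>\<^bsub>S\<^esub> s') = (\<Sum>k\<in>I. M i k s * M k j s')"
    and M_lab: "i \<in> I \<Longrightarrow> j \<in> I \<Longrightarrow> s \<in> carrier S \<Longrightarrow> lab i \<noteq> lab j \<Longrightarrow> M i j s = 0"
    and M_surj: "(\<And>i j. i \<in> I \<Longrightarrow> j \<in> I \<Longrightarrow> lab i \<noteq> lab j \<Longrightarrow> c i j = 0) \<Longrightarrow>
      \<exists>a. \<forall>i\<in>I. \<forall>j\<in>I. (\<Sum>s\<in>carrier S. a s * M i j s) = c i j"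
    and M_inj: "(\<And>i j. i \<in> I \<Longrightarrow> j \<in> I \<Longrightarrow> lab i = lab j \<Longrightarrow> (\<Sum>s\<in>carrier S. a s * M i j s) = 0) \<Longrightarrow>
      s \<in> carrier S \<Longrightarrow> a s = 0"
begin

definition mc :: "'i \<Rightarrow> 'i \<Rightarrow> ('s \<Rightarrow> complex) \<Rightarrow> complex" where
  "mc i j a = (\<Sum>s\<in>carrier S. a s * M i j s)"

lemma mc_add: "mc i j (\<lambda>x. a x + b x) = mc i j a + mc i j b"
  by (simp add: mc_def distrib_right sum.distrib)

lemma mc_scale: "mc i j (\<lambda>x. c * a x) = c * mc i j a"
  by (simp add: mc_def sum_distrib_left mult.assoc)

lemma mc_sum: "mc i j (\<lambda>x. \<Sum>k\<in>K. c k * a k x) = (\<Sum>k\<in>K. c k * mc i j (a k))"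
  unfolding mc_def sum_distrib_right sum_distrib_left by (subst sum.swap) (simp add: mult.assoc)

lemma mc_basis: "s \<in> carrier S \<Longrightarrow> mc i j (salg_basis s) = M i j s"
  using finite_S by (simp add: mc_def salg_basis_def if_distrib[of "\<lambda>x. x * _"] cong: if_cong)

lemma mc_lab: "i \<in> I \<Longrightarrow> j \<in> I \<Longrightarrow> lab i \<noteq> lab j \<Longrightarrow> mc i j a = 0"
  unfolding mc_def by (intro sum.neutral) (simp add: M_lab)

lemma salg_mult_carrier: "salg_mult S a b \<in> salg_carrier S"
proof -
  have "salg_mult S a b x = 0" if "x \<notin> carrier S" for x
    unfolding salg_mult_def by (rule sum.neutral) (use that closed in auto)
  then show ?thesis by (simp add: salg_carrier_def)
qed

lemma mc_mult:
  assumes "i \<in> I" "j \<in> I"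
  shows "mc i j (salg_mult S a b) = (\<Sum>k\<in>I. mc i k a * mc k j b)"
proof -
  let ?C = "carrier S"
  have "mc i j (salg_mult S a b) =
      (\<Sum>x\<in>?C. \<Sum>w\<in>{w \<in> ?C \<times> ?C. fst w \<otimes>\<^bsub>S\<^esub> snd w = x}. a (fst w) * b (snd w) * M i j (fst w \<otimes>\<^bsub>S\<^esub> snd w))"
    unfolding mc_def salg_mult_def
  proof (rule sum.cong[OF refl])
    fix x
    have eq: "{(s, t). s \<in> ?C \<and> t \<in> ?C \<and> s \<otimes>\<^bsub>S\<^esub> t = x} = {w \<in> ?C \<times> ?C. fst w \<otimes>\<^bsub>S\<^esub> snd w = x}"
      by auto
    show "(\<Sum>(s, t)\<in>{(s, t). s \<in> ?C \<and> t \<in> ?C \<and> s \<otimes>\<^bsub>S\<^esub> t = x}. a s * b t) * M i j x =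
        (\<Sum>w\<in>{w \<in> ?C \<times> ?C. fst w \<otimes>\<^bsub>S\<^esub> snd w = x}. a (fst w) * b (snd w) * M i j (fst w \<otimes>\<^bsub>S\<^esub> snd w))"
      unfolding sum_distrib_right by (rule sum.cong[OF eq]) (auto simp: case_prod_unfold)
  qed
  also have "\<dots> = (\<Sum>w\<in>?C \<times> ?C. a (fst w) * b (snd w) * M i j (fst w \<otimes>\<^bsub>S\<^esub> snd w))"
    using finite_S closed by (intro sum.group) auto
  also have "\<dots> = (\<Sum>s\<in>?C. \<Sum>t\<in>?C. a s * b t * M i j (s \<otimes>\<^bsub>S\<^esub> t))"
    by (simp only: sum.cartesian_product case_prod_unfold)
  also have "\<dots> = (\<Sum>s\<in>?C. \<Sum>t\<in>?C. \<Sum>k\<in>I. (a s * M i k s) * (b t * M k j t))"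
    by (intro sum.cong refl) (simp add: M_mult[OF assms] sum_distrib_left mult.assoc mult.left_commute)
  also have "\<dots> = (\<Sum>s\<in>?C. \<Sum>k\<in>I. \<Sum>t\<in>?C. (a s * M i k s) * (b t * M k j t))"
    by (intro sum.cong refl sum.swap)
  also have "\<dots> = (\<Sum>k\<in>I. \<Sum>s\<in>?C. \<Sum>t\<in>?C. (a s * M i k s) * (b t * M k j t))"
    by (rule sum.swap)
  also have "\<dots> = (\<Sum>k\<in>I. mc i k a * mc k j b)"
    by (simp add: mc_def sum_product)
  finally show ?thesis .
qed

lemma salg_eqI:
  assumes "a \<in> salg_carrier S" "b \<in> salg_carrier S"
    and "\<And>i j. i \<in> I \<Longrightarrow> j \<in> I \<Longrightarrow> lab i = lab j \<Longrightarrow> mc i j a = mc i j b"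
  shows "a = b"
proof
  fix s
  have "(\<lambda>s. a s - b s) s = 0" if "s \<in> carrier S"
  proof (rule M_inj[OF _ that])
    fix i j assume "i \<in> I" "j \<in> I" "lab i = lab j"
    then show "(\<Sum>s\<in>carrier S. (a s - b s) * M i j s) = 0"
      using assms(3)[of i j] by (simp add: mc_def left_diff_distrib sum_subtractf)
  qed
  then show "a s = b s" using assms(1,2) by (cases "s \<in> carrier S") (auto simp: salg_carrier_def)
qed

lemma mc_surj:
  assumes "\<And>i j. i \<in> I \<Longrightarrow> j \<in> I \<Longrightarrow> lab i \<noteq> lab j \<Longrightarrow> c i j = 0"
  obtains a where "a \<in> salg_carrier S" "\<And>i j. i \<in> I \<Longrightarrow> j \<in> I \<Longrightarrow> mc i j a = c i j"
proof -
  obtain a where a: "\<forall>i\<in>I. \<forall>j\<in>I. (\<Sum>s\<in>carrier S. a s * M i j s) = c i j"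
    using M_surj[of c] assms by blast
  let ?a = "\<lambda>s. if s \<in> carrier S then a s else 0"
  have "mc i j ?a = c i j" if "i \<in> I" "j \<in> I" for i j
    using a that by (auto simp: mc_def intro: sum.cong)
  then show thesis using that[of ?a] by (simp add: salg_carrier_def)
qed

section \<open>The representation attached to a label, and its irreducibility\<close>

definition ldim :: "'l \<Rightarrow> nat" where
  "ldim l = card {i \<in> I. lab i = l}"

definition lenum :: "'l \<Rightarrow> nat \<Rightarrow> 'i" where
  "lenum l = (SOME e. bij_betw e {0..<ldim l} {i \<in> I. lab i = l})"

lemma lenum_bij: "bij_betw (lenum l) {0..<ldim l} {i \<in> I. lab i = l}"
  unfolding lenum_def
  by (rule someI_ex[of "\<lambda>e. bij_betw e {0..<ldim l} {i \<in> I. lab i = l}"])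
    (use finite_I in \<open>auto simp: ldim_def intro: ex_bij_betw_nat_finite\<close>)

lemma lenum_I: "p < ldim l \<Longrightarrow> lenum l p \<in> I" and lenum_lab: "p < ldim l \<Longrightarrow> lab (lenum l p) = l"
  using bij_betw_apply[OF lenum_bij[of l], of p] by auto

lemma lenum_eq_iff: "p < ldim l \<Longrightarrow> q < ldim l \<Longrightarrow> lenum l p = lenum l q \<longleftrightarrow> p = q"
  using lenum_bij[of l] by (auto simp: bij_betw_def inj_on_def)

lemma lenum_surj: "i \<in> I \<Longrightarrow> \<exists>p<ldim (lab i). lenum (lab i) p = i"
  using lenum_bij[of "lab i"] by (force simp: bij_betw_def)

lemma sum_lenum:
  assumes "\<And>i. i \<in> I \<Longrightarrow> lab i \<noteq> l \<Longrightarrow> f i = 0"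
  shows "(\<Sum>i\<in>I. f i) = (\<Sum>p = 0..<ldim l. f (lenum l p))"
proof -
  have "(\<Sum>i\<in>I. f i) = (\<Sum>i\<in>{i \<in> I. lab i = l}. f i)"
    using assms finite_I by (intro sum.mono_neutral_right) auto
  also have "\<dots> = (\<Sum>p = 0..<ldim l. f (lenum l p))"
    by (rule sum.reindex_bij_betw[OF lenum_bij, symmetric])
  finally show ?thesis .
qed

definition rho :: "'l \<Rightarrow> 's rep" where
  "rho l a = mat (ldim l) (ldim l) (\<lambda>(p, q). mc (lenum l p) (lenum l q) a)"

lemma rep_dim_rho [simp]: "rep_dim (rho l) = ldim l"
  by (simp add: rep_dim_def rho_def)

lemma rho_carrier: "rho l a \<in> carrier_mat (ldim l) (ldim l)"
  by (simp add: rho_def)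

lemma representation_rho: "representation S (rho l)"
  unfolding representation_def
proof (intro conjI ballI allI)
  fix a b
  show "rho l (salg_mult S a b) = rho l a * rho l b"
  proof (rule eq_matI)
    fix p q assume "p < dim_row (rho l a * rho l b)" "q < dim_col (rho l a * rho l b)"
    then have pq: "p < ldim l" "q < ldim l" by (simp_all add: rho_def)
    have "rho l (salg_mult S a b) $$ (p, q) = (\<Sum>k\<in>I. mc (lenum l p) k a * mc k (lenum l q) b)"
      using pq by (simp add: rho_def mc_mult lenum_I)
    also have "\<dots> = (\<Sum>r = 0..<ldim l. mc (lenum l p) (lenum l r) a * mc (lenum l r) (lenum l q) b)"
      using pq by (intro sum_lenum) (auto simp: mc_lab lenum_I lenum_lab)
    also have "\<dots> = (rho l a * rho l b) $$ (p, q)"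
      using pq by (simp add: rho_def scalar_prod_def)
    finally show "rho l (salg_mult S a b) $$ (p, q) = (rho l a * rho l b) $$ (p, q)" .
  qed (simp_all add: rho_def)
qed (auto simp: rho_def mc_add mc_scale)

text \<open>The blocks are independent: a matrix can be prescribed in one block with zero in all
  others. Transitivity of each block and inequivalence of different blocks both rest on
  this.\<close>

lemma rho_surj:
  assumes "A \<in> carrier_mat (ldim l) (ldim l)"
  obtains a where "a \<in> salg_carrier S" "rho l a = A" "\<And>l'. l' \<noteq> l \<Longrightarrow> rho l' a = 0\<^sub>m (ldim l') (ldim l')"
proof -
  define ix where "ix i = (THE p. p < ldim l \<and> lenum l p = i)" for i
  have ix: "ix (lenum l p) = p" if "p < ldim l" for p
    unfolding ix_def using that lenum_eq_iff by (intro the_equality) auto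
  obtain a where a: "a \<in> salg_carrier S"
    "\<And>i j. i \<in> I \<Longrightarrow> j \<in> I \<Longrightarrow> mc i j a = (if lab i = l \<and> lab j = l then A $$ (ix i, ix j) else 0)"
    by (rule mc_surj[of "\<lambda>i j. if lab i = l \<and> lab j = l then A $$ (ix i, ix j) else 0"]) auto
  have "rho l a = A"
    using assms by (intro eq_matI) (auto simp: rho_def a lenum_I lenum_lab ix)
  moreover have "rho l' a = 0\<^sub>m (ldim l') (ldim l')" if "l' \<noteq> l" for l'
    using that by (intro eq_matI) (auto simp: rho_def a lenum_I lenum_lab)
  ultimately show thesis using a(1) that by blast
qed

lemma ldim_pos: "l \<in> lab ` I \<Longrightarrow> ldim l > 0"
  using finite_I by (auto simp: ldim_def card_gt_0_iff)

lemma transitive_mat: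
  assumes w: "w \<in> carrier_vec n" "w \<noteq> 0\<^sub>v n" and v: "v \<in> carrier_vec n"
  obtains A :: "complex mat" where "A \<in> carrier_mat n n" "A *\<^sub>v w = v"
proof -
  obtain q where q: "q < n" "w $ q \<noteq> 0" using w by (metis carrier_vecD eq_vecI index_zero_vec)
  let ?A = "mat n n (\<lambda>(i, j). if j = q then v $ i / w $ q else 0)"
  have "?A *\<^sub>v w = v"
  proof (rule eq_vecI)
    fix i assume "i < dim_vec v"
    then have i: "i < n" using v by simp
    have "(?A *\<^sub>v w) $ i = (\<Sum>j = 0..<n. (if j = q then v $ i / w $ q else 0) * w $ j)"
      using i w by (simp add: scalar_prod_def)
    also have "\<dots> = (\<Sum>j = 0..<n. if j = q then v $ i else 0)"
      using q by (intro sum.cong) auto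
    finally have "(?A *\<^sub>v w) $ i = \<dots>" .
    then show "(?A *\<^sub>v w) $ i = v $ i" using q by simp
  qed (use v in simp)
  then show thesis using that[of ?A] by simp
qed

lemma irreducible_rho:
  assumes l: "l \<in> lab ` I"
  shows "irreducible_rep S (rho l)"
  unfolding irreducible_rep_def
proof (intro conjI allI impI)
  show "representation S (rho l)" by (rule representation_rho)
  obtain a where "a \<in> salg_carrier S" "rho l a = 1\<^sub>m (ldim l)" using rho_surj[OF one_carrier_mat] by metis
  moreover have "1\<^sub>m (ldim l) $$ (0, 0) \<noteq> (0\<^sub>m (ldim l) (ldim l) :: complex mat) $$ (0, 0)"
    using ldim_pos[OF l] by simp
  then have "1\<^sub>m (ldim l) \<noteq> (0\<^sub>m (ldim l) (ldim l) :: complex mat)" by metis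
  ultimately show "\<exists>a\<in>salg_carrier S. rho l a \<noteq> 0\<^sub>m (rep_dim (rho l)) (rep_dim (rho l))" by auto
  fix W assume W: "rep_submodule S (rho l) W"
  show "W = {0\<^sub>v (rep_dim (rho l))} \<or> W = carrier_vec (rep_dim (rho l))"
  proof (cases "W = {0\<^sub>v (ldim l)}")
    case False
    then obtain w where w: "w \<in> W" "w \<noteq> 0\<^sub>v (ldim l)" "w \<in> carrier_vec (ldim l)"
      using W by (auto simp: rep_submodule_def)
    have "v \<in> W" if v: "v \<in> carrier_vec (ldim l)" for v
    proof -
      obtain A where "A \<in> carrier_mat (ldim l) (ldim l)" "A *\<^sub>v w = v"
        using transitive_mat[OF w(3,2) v] by blast
      then show ?thesis using rho_surj W w(1) unfolding rep_submodule_def by metis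
    qed
    then show ?thesis using W by (auto simp: rep_submodule_def)
  qed simp
qed

section \<open>Every irreducible representation is equivalent to exactly one of these\<close>

lemma rep_sum:
  assumes \<tau>: "representation S \<tau>" and "finite K" and "\<And>k. k \<in> K \<Longrightarrow> a k \<in> salg_carrier S"
    and "p < rep_dim \<tau>" "q < rep_dim \<tau>"
  shows "\<tau> (\<lambda>x. \<Sum>k\<in>K. c k * a k x) $$ (p, q) = (\<Sum>k\<in>K. c k * \<tau> (a k) $$ (p, q))"
  using assms(2,3)
proof (induction K rule: finite_induct)
  case empty
  have z: "(\<lambda>_. 0) \<in> salg_carrier S" by (simp add: salg_carrier_def)
  have "\<forall>c. \<forall>a\<in>salg_carrier S. \<tau> (\<lambda>x. c * a x) = c \<cdot>\<^sub>m \<tau> a"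
    using \<tau> unfolding representation_def by blast
  from this[rule_format, OF z, of 0]
  have "\<tau> (\<lambda>_. 0) = 0 \<cdot>\<^sub>m \<tau> (\<lambda>_. 0)" by simp
  moreover have "\<tau> (\<lambda>_. 0) \<in> carrier_mat (rep_dim \<tau>) (rep_dim \<tau>)"
    using \<tau> z unfolding representation_def by blast
  ultimately
  have "\<tau> (\<lambda>_. 0) $$ (p, q) = 0" using assms(4,5) by (metis carrier_matD index_smult_mat(1) mult_zero_left)
  then show ?case by simp
next
  case (insert k K)
  let ?s = "\<lambda>x. \<Sum>k\<in>K. c k * a k x"
  have c: "a k \<in> salg_carrier S" "(\<lambda>x. c k * a k x) \<in> salg_carrier S" "?s \<in> salg_carrier S"
    using insert.prems by (auto simp: salg_carrier_def)
  have e: "\<tau> (\<lambda>x. c k * a k x + ?s x) = c k \<cdot>\<^sub>m \<tau> (a k) + \<tau> ?s"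
  proof -
    have add: "\<forall>a\<in>salg_carrier S. \<forall>b\<in>salg_carrier S. \<tau> (\<lambda>x. a x + b x) = \<tau> a + \<tau> b"
      and scale: "\<forall>c. \<forall>a\<in>salg_carrier S. \<tau> (\<lambda>x. c * a x) = c \<cdot>\<^sub>m \<tau> a"
      using \<tau> unfolding representation_def by blast+
    show ?thesis
      using add[rule_format, OF c(2,3)] scale[rule_format, OF c(1), of "c k"] by simp
  qed
  have "\<tau> ?s \<in> carrier_mat (rep_dim \<tau>) (rep_dim \<tau>)" "\<tau> (a k) \<in> carrier_mat (rep_dim \<tau>) (rep_dim \<tau>)"
    using \<tau> c unfolding representation_def by blast+
  then show ?case using insert e assms(4,5) by simp
qed

text \<open>Some matrix unit acts nontrivially under \<open>\<tau>\<close>. The matrix units in its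
  column span a left ideal isomorphic to the module of \<open>rho l\<close>, and applying them to a
  basis vector gives a nonzero intertwiner \<open>P\<close>. Irreducibility of \<open>\<tau>\<close>
  makes \<open>P\<close> onto, transitivity of \<open>rho l\<close> makes it injective.\<close>

lemma irreducible_equivalent_rho:
  assumes \<tau>: "irreducible_rep S \<tau>"
  obtains l where "l \<in> lab ` I" "equivalent_reps S \<tau> (rho l)"
proof -
  define N where "N = rep_dim \<tau>"
  have rep: "representation S \<tau>" using \<tau> by (simp add: irreducible_rep_def)
  have carr: "\<tau> a \<in> carrier_mat N N" if "a \<in> salg_carrier S" for a
    using rep that by (simp add: representation_def N_def)
  have mul: "\<tau> (salg_mult S a b) = \<tau> a * \<tau> b" if "a \<in> salg_carrier S" "b \<in> salg_carrier S" for a b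
    using rep that by (simp add: representation_def)
  let ?unit = "\<lambda>i j e. e \<in> salg_carrier S \<and> (i \<in> I \<longrightarrow> j \<in> I \<longrightarrow> lab i = lab j \<longrightarrow>
      (\<forall>i'\<in>I. \<forall>j'\<in>I. mc i' j' e = (if i' = i \<and> j' = j then 1 else 0)))"
  have "\<exists>e. ?unit i j e" for i j
  proof (cases "lab i = lab j")
    case True
    show ?thesis
      by (rule mc_surj[of "\<lambda>i' j'. if i' = i \<and> j' = j then 1 else 0"]) (use True in auto)
  next
    case False
    then show ?thesis by (intro exI[of _ "\<lambda>_. 0"]) (simp add: salg_carrier_def)
  qed
  then obtain e where "\<forall>i j. ?unit i j (e i j)" by metis
  then have e: "\<And>i j. e i j \<in> salg_carrier S"
    "\<And>i j i' j'. i \<in> I \<Longrightarrow> j \<in> I \<Longrightarrow> lab i = lab j \<Longrightarrow> i' \<in> I \<Longrightarrow> j' \<in> I \<Longrightarrow>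
        mc i' j' (e i j) = (if i' = i \<and> j' = j then 1 else 0)" by blast+
  let ?K = "{(i, j). i \<in> I \<and> j \<in> I \<and> lab i = lab j}"
  have finK: "finite ?K" by (rule finite_subset[of _ "I \<times> I"]) (use finite_I in auto)
  obtain a where a: "a \<in> salg_carrier S" "\<tau> a \<noteq> 0\<^sub>m N N"
    using \<tau> by (auto simp: irreducible_rep_def N_def)
  let ?a' = "\<lambda>x. \<Sum>k\<in>?K. mc (fst k) (snd k) a * e (fst k) (snd k) x"
  have a_exp: "a = ?a'"
  proof (rule salg_eqI[OF a(1)])
    show "?a' \<in> salg_carrier S"
      using e(1) by (auto simp: salg_carrier_def intro!: sum.neutral)
    fix i j assume ij: "i \<in> I" "j \<in> I" "lab i = lab j"
    have "mc i j ?a' =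
       (\<Sum>k\<in>?K. mc (fst k) (snd k) a * mc i j (e (fst k) (snd k)))" by (rule mc_sum)
    also have "\<dots> = (\<Sum>k\<in>?K. if k = (i, j) then mc i j a else 0)"
      using ij by (intro sum.cong) (auto simp: e(2) split: if_splits)
    also have "\<dots> = mc i j a" using ij finK by simp
    finally show "mc i j a = mc i j ?a'" ..
  qed
  have "\<exists>k\<in>?K. \<exists>p<N. \<exists>q<N. \<tau> (e (fst k) (snd k)) $$ (p, q) \<noteq> 0"
  proof (rule ccontr)
    assume no: "\<not> ?thesis"
    have "\<tau> a $$ (p, q) = 0" if pq: "p < N" "q < N" for p q
    proof -
      have "\<tau> a $$ (p, q) = (\<Sum>k\<in>?K. mc (fst k) (snd k) a * \<tau> (e (fst k) (snd k)) $$ (p, q))"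
        using rep_sum[OF rep finK, of "\<lambda>k. e (fst k) (snd k)" p q "\<lambda>k. mc (fst k) (snd k) a"] e(1) pq
        by (subst a_exp) (simp add: N_def)
      also have "\<dots> = 0"
      proof (rule sum.neutral, rule ballI)
        fix k assume "k \<in> ?K"
        then have "\<tau> (e (fst k) (snd k)) $$ (p, q) = 0" using no pq by blast
        then show "mc (fst k) (snd k) a * \<tau> (e (fst k) (snd k)) $$ (p, q) = 0" by simp
      qed
      finally show ?thesis .
    qed
    then have "\<tau> a = 0\<^sub>m N N" using carr[OF a(1)] by (intro eq_matI) auto
    then show False using a(2) by simp
  qed
  then obtain i0 j0 p0 r0 where k0: "i0 \<in> I" "j0 \<in> I" "lab i0 = lab j0" "p0 < N" "r0 < N"
      "\<tau> (e i0 j0) $$ (p0, r0) \<noteq> 0" by auto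
  define l where "l = lab i0"
  let ?d = "ldim l"
  \<comment> \<open>Column \<open>q\<close> of \<open>P\<close> is the image of the basis vector
    \<open>r0\<close> under the matrix unit in row \<open>lenum l q\<close> and column
    \<open>j0\<close>.\<close>
  define P where "P = mat N ?d (\<lambda>(p, q). \<tau> (e (lenum l q) j0) $$ (p, r0))"
  have Pc: "P \<in> carrier_mat N ?d" by (simp add: P_def)
  have inter: "\<tau> b * P = P * rho l b" if b: "b \<in> salg_carrier S" for b
  proof (rule eq_matI)
    fix p q assume "p < dim_row (P * rho l b)" "q < dim_col (P * rho l b)"
    then have pq: "p < N" "q < ?d" by (simp_all add: P_def rho_def)
    \<comment> \<open>Left multiplication by \<open>b\<close> acts on the matrix units of one column
      by the matrix \<open>rho l b\<close>.\<close>
    have be: "salg_mult S b (e (lenum l q) j0) = (\<lambda>x. \<Sum>r = 0..<?d. mc (lenum l r) (lenum l q) b * e (lenum l r) j0 x)"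
    proof (rule salg_eqI[OF salg_mult_carrier])
      show "(\<lambda>x. \<Sum>r = 0..<?d. mc (lenum l r) (lenum l q) b * e (lenum l r) j0 x) \<in> salg_carrier S"
        using e(1) by (auto simp: salg_carrier_def)
      fix i j assume ij: "i \<in> I" "j \<in> I" "lab i = lab j"
      have "mc i j (salg_mult S b (e (lenum l q) j0)) = (\<Sum>k\<in>I. mc i k b * mc k j (e (lenum l q) j0))"
        using mc_mult ij by blast
      also have "\<dots> = (\<Sum>k\<in>I. if k = lenum l q then (if j = j0 then mc i k b else 0) else 0)"
        using ij pq k0 by (intro sum.cong) (auto simp: e(2) lenum_I lenum_lab l_def)
      also have "\<dots> = (if j = j0 then mc i (lenum l q) b else 0)"
        using finite_I lenum_I[OF pq(2)] by simp
      finally have 1: "mc i j (salg_mult S b (e (lenum l q) j0)) = \<dots>" .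
      have "mc i j (\<lambda>x. \<Sum>r = 0..<?d. mc (lenum l r) (lenum l q) b * e (lenum l r) j0 x) =
        (\<Sum>r = 0..<?d. mc (lenum l r) (lenum l q) b * mc i j (e (lenum l r) j0))" by (rule mc_sum)
      also have "\<dots> = (\<Sum>r = 0..<?d. if i = lenum l r \<and> j = j0 then mc i (lenum l q) b else 0)"
        using ij k0 by (intro sum.cong) (auto simp: e(2) lenum_I lenum_lab l_def)
      also have "\<dots> = (\<Sum>k\<in>I. if i = k \<and> j = j0 then mc i (lenum l q) b else 0)"
        using ij k0 by (intro sum_lenum[symmetric]) (auto simp: l_def)
      also have "\<dots> = (if j = j0 then mc i (lenum l q) b else 0)"
        using finite_I ij(1) by (cases "j = j0") simp_all
      finally show "mc i j (salg_mult S b (e (lenum l q) j0)) =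
         mc i j (\<lambda>x. \<Sum>r = 0..<?d. mc (lenum l r) (lenum l q) b * e (lenum l r) j0 x)" using 1 by simp
    qed
    have "(\<tau> b * P) $$ (p, q) = (\<tau> b * \<tau> (e (lenum l q) j0)) $$ (p, r0)"
      using pq k0 carr[OF b] carr[OF e(1), of "lenum l q" j0] by (auto simp: P_def scalar_prod_def)
    also have "\<dots> = \<tau> (salg_mult S b (e (lenum l q) j0)) $$ (p, r0)" by (simp add: mul b e(1))
    also have "\<dots> = (\<Sum>r = 0..<?d. mc (lenum l r) (lenum l q) b * \<tau> (e (lenum l r) j0) $$ (p, r0))"
      unfolding be using pq k0 e(1) by (intro rep_sum[OF rep]) (simp_all add: N_def)
    also have "\<dots> = (P * rho l b) $$ (p, q)"
      using pq by (simp add: P_def rho_def scalar_prod_def mult.commute)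
    finally show "(\<tau> b * P) $$ (p, q) = (P * rho l b) $$ (p, q)" .
  qed (use carr[OF b] in \<open>simp_all add: P_def rho_def\<close>)
  obtain q0 where q0: "q0 < ?d" "lenum l q0 = i0" using lenum_surj[OF k0(1)] l_def by auto
  define w where "w = P *\<^sub>v unit_vec ?d q0"
  have "P $$ (p0, q0) \<noteq> 0" using q0 k0 by (simp add: P_def)
  moreover have "w $ p0 = P $$ (p0, q0)" using q0 k0 by (simp add: w_def P_def)
  ultimately have w0: "w \<noteq> 0\<^sub>v N" using k0 by auto
  have act: "\<tau> b *\<^sub>v (P *\<^sub>v x) = P *\<^sub>v (rho l b *\<^sub>v x)"
    if "b \<in> salg_carrier S" "x \<in> carrier_vec ?d" for b x
    using assoc_mult_mat_vec[OF carr[OF that(1)] Pc that(2)]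
      assoc_mult_mat_vec[OF Pc rho_carrier that(2)] inter[OF that(1)] by metis
  define W where "W = (\<lambda>x. P *\<^sub>v x) ` carrier_vec ?d"
  have "rep_submodule S \<tau> W"
    unfolding rep_submodule_def N_def[symmetric]
  proof (intro conjI ballI allI)
    show "W \<subseteq> carrier_vec N" unfolding W_def using Pc by auto
    have "P *\<^sub>v 0\<^sub>v ?d = 0\<^sub>v N" using Pc by (intro eq_vecI) (auto simp: scalar_prod_def)
    then show "0\<^sub>v N \<in> W" unfolding W_def by (metis image_eqI zero_carrier_vec)
  next
    fix v v' assume "v \<in> W" "v' \<in> W"
    then obtain x x' where "v = P *\<^sub>v x" "v' = P *\<^sub>v x'" "x \<in> carrier_vec ?d" "x' \<in> carrier_vec ?d"
      by (auto simp: W_def)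
    moreover from this have "v + v' = P *\<^sub>v (x + x')" using mult_add_distrib_mat_vec[OF Pc] by simp
    ultimately show "v + v' \<in> W" unfolding W_def by (metis add_carrier_vec image_eqI)
  next
    fix c v assume "v \<in> W"
    then obtain x where "v = P *\<^sub>v x" "x \<in> carrier_vec ?d" by (auto simp: W_def)
    moreover from this have "c \<cdot>\<^sub>v v = P *\<^sub>v (c \<cdot>\<^sub>v x)" using mult_mat_vec[OF Pc] by simp
    ultimately show "c \<cdot>\<^sub>v v \<in> W" unfolding W_def by (metis smult_carrier_vec image_eqI)
  next
    fix b v assume "b \<in> salg_carrier S" "v \<in> W"
    then obtain x where "v = P *\<^sub>v x" "x \<in> carrier_vec ?d" by (auto simp: W_def)
    then have "\<tau> b *\<^sub>v v = P *\<^sub>v (rho l b *\<^sub>v x)" "rho l b *\<^sub>v x \<in> carrier_vec ?d"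
      using act[OF \<open>b \<in> _\<close>] mult_mat_vec_carrier[OF rho_carrier] by auto
    then show "\<tau> b *\<^sub>v v \<in> W" unfolding W_def by blast
  qed
  then have "W = {0\<^sub>v N} \<or> W = carrier_vec N" using \<tau> by (auto simp: irreducible_rep_def N_def)
  moreover have "w \<in> W" unfolding W_def w_def by auto
  ultimately have W: "W = carrier_vec N" using w0 by auto
  \<comment> \<open>If \<open>P\<close> killed a nonzero \<open>x\<close>, then some
    \<open>b\<close> would carry \<open>x\<close> to the unit vector of \<open>q0\<close>, and
    intertwining would give \<open>w = 0\<close>.\<close>
  have inj: "x = 0\<^sub>v ?d" if x: "x \<in> carrier_vec ?d" "P *\<^sub>v x = 0\<^sub>v N" for x
  proof (rule ccontr)
    assume "x \<noteq> 0\<^sub>v ?d"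
    then obtain A where A: "A \<in> carrier_mat ?d ?d" "A *\<^sub>v x = unit_vec ?d q0"
      using transitive_mat[OF x(1), of "unit_vec ?d q0"] by auto
    obtain b where b: "b \<in> salg_carrier S" "rho l b = A" using rho_surj[OF A(1)] by blast
    have "w = \<tau> b *\<^sub>v (P *\<^sub>v x)" using act[OF b(1) x(1)] A(2) b(2) w_def by simp
    also have "\<dots> = 0\<^sub>v N" using x(2) carr[OF b(1)] by (intro eq_vecI) (auto simp: scalar_prod_def)
    finally show False using w0 by blast
  qed
  have "\<forall>i. \<exists>x\<in>carrier_vec ?d. P *\<^sub>v x = unit_vec N i"
    using W unfolding W_def by (metis image_iff unit_vec_carrier)
  then obtain X where X: "\<And>i. X i \<in> carrier_vec ?d" "\<And>i. P *\<^sub>v X i = unit_vec N i" by metis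
  define Q where "Q = mat ?d N (\<lambda>(q, p). X p $ q)"
  have Qc: "Q \<in> carrier_mat ?d N" by (simp add: Q_def)
  have colQ: "col Q i = X i" if "i < N" for i
    using that X(1)[of i] by (intro eq_vecI) (auto simp: Q_def)
  have PQ: "P * Q = 1\<^sub>m N"
  proof (rule eq_matI)
    fix p q assume "p < dim_row (1\<^sub>m N)" "q < dim_col (1\<^sub>m N)"
    then have pq: "p < N" "q < N" by auto
    have "(P * Q) $$ (p, q) = (P *\<^sub>v X q) $ p" using pq Pc Qc colQ by simp
    then show "(P * Q) $$ (p, q) = 1\<^sub>m N $$ (p, q)" using pq X(2) by simp
  qed (use Pc Qc in auto)
  have QP: "Q * P = 1\<^sub>m ?d"
  proof (rule eq_matI)
    fix p q assume "p < dim_row (1\<^sub>m ?d)" "q < dim_col (1\<^sub>m ?d)"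
    then have pq: "p < ?d" "q < ?d" by auto
    let ?x = "Q *\<^sub>v (P *\<^sub>v unit_vec ?d q) - unit_vec ?d q"
    have c: "P *\<^sub>v unit_vec ?d q \<in> carrier_vec N" "Q *\<^sub>v (P *\<^sub>v unit_vec ?d q) \<in> carrier_vec ?d"
      using Pc Qc by auto
    have "P *\<^sub>v ?x = P *\<^sub>v (Q *\<^sub>v (P *\<^sub>v unit_vec ?d q)) - P *\<^sub>v unit_vec ?d q"
      using Pc c(2) by (intro mult_minus_distrib_mat_vec) auto
    also have "P *\<^sub>v (Q *\<^sub>v (P *\<^sub>v unit_vec ?d q)) = (P * Q) *\<^sub>v (P *\<^sub>v unit_vec ?d q)"
      using assoc_mult_mat_vec[OF Pc Qc c(1)] by simp
    also have "\<dots> = P *\<^sub>v unit_vec ?d q" using PQ c(1) by simp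
    also have "\<dots> - P *\<^sub>v unit_vec ?d q = 0\<^sub>v N" using c(1) by simp
    finally have "?x = 0\<^sub>v ?d" using inj c(2) by simp
    then have "?x $ p = 0" using pq by simp
    then have "(Q *\<^sub>v (P *\<^sub>v unit_vec ?d q)) $ p = unit_vec ?d q $ p" using pq c(2) by simp
    also have "Q *\<^sub>v (P *\<^sub>v unit_vec ?d q) = (Q * P) *\<^sub>v unit_vec ?d q"
      using assoc_mult_mat_vec[OF Qc Pc] by simp
    finally have 1: "((Q * P) *\<^sub>v unit_vec ?d q) $ p = unit_vec ?d q $ p" .
    have "(A *\<^sub>v unit_vec ?d q) $ p = A $$ (p, q)" if "A \<in> carrier_mat ?d ?d" for A :: "complex mat"
      using that pq by simp
    from this[of "Q * P"] 1 show "(Q * P) $$ (p, q) = 1\<^sub>m ?d $$ (p, q)"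
      using pq Pc Qc by (auto simp: mult_carrier_mat)
  qed (use Pc Qc in auto)
  \<comment> \<open>The identity matrices \<open>P * Q\<close> and \<open>Q * P\<close> have equal
    traces.\<close>
  have N: "N = ?d"
  proof -
    have "of_nat N = (\<Sum>p = 0..<N. (P * Q) $$ (p, p))" using PQ by simp
    also have "\<dots> = (\<Sum>p = 0..<N. \<Sum>q = 0..<?d. P $$ (p, q) * Q $$ (q, p))"
      using Pc Qc by (intro sum.cong) (auto simp: scalar_prod_def)
    also have "\<dots> = (\<Sum>q = 0..<?d. \<Sum>p = 0..<N. Q $$ (q, p) * P $$ (p, q))"
      by (subst sum.swap) (simp add: mult.commute)
    also have "\<dots> = (\<Sum>q = 0..<?d. (Q * P) $$ (q, q))"
      using Pc Qc by (intro sum.cong) (auto simp: scalar_prod_def)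
    also have "\<dots> = of_nat ?d" using QP by simp
    finally show ?thesis using of_nat_eq_iff by blast
  qed
  have "similar_mat_wit (\<tau> b) (rho l b) P Q" if b: "b \<in> salg_carrier S" for b
  proof -
    have "P * rho l b * Q = \<tau> b * P * Q" using inter[OF b] by simp
    also have "\<dots> = \<tau> b * (P * Q)" using carr[OF b] Pc Qc by simp
    also have "\<dots> = \<tau> b" using PQ carr[OF b] by simp
    finally have "\<tau> b = P * rho l b * Q" ..
    then show ?thesis
      unfolding similar_mat_wit_def Let_def using carr[OF b] Pc Qc PQ QP rho_carrier N by auto
  qed
  then have "equivalent_reps S \<tau> (rho l)" unfolding equivalent_reps_def by blast
  then show thesis using that k0(1) l_def by blast
qed

text \<open>An element that is the identity in block \<open>l\<close> and zero in block
  \<open>l'\<close> would act under \<open>\<tau>\<close> both as the identity and as zero.\<close>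

lemma equivalent_rho_unique:
  assumes "representation S \<tau>" "equivalent_reps S \<tau> (rho l)" "equivalent_reps S \<tau> (rho l')" "l \<in> lab ` I"
  shows "l = l'"
proof (rule ccontr)
  assume "l \<noteq> l'"
  obtain a where a: "a \<in> salg_carrier S" "rho l a = 1\<^sub>m (ldim l)" "rho l' a = 0\<^sub>m (ldim l') (ldim l')"
    using rho_surj[OF one_carrier_mat, of l] \<open>l \<noteq> l'\<close> by metis
  obtain P Q where s: "similar_mat_wit (\<tau> a) (rho l a) P Q"
    using assms(2) a(1) unfolding equivalent_reps_def by blast
  note D = similar_mat_witD[OF refl s]
  have n: "dim_row (\<tau> a) = ldim l" using D(5) rho_carrier[of l a] by auto
  have P: "P \<in> carrier_mat (ldim l) (ldim l)" using D(6) n by simp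
  have "\<tau> a = P * 1\<^sub>m (ldim l) * Q" using D(3) unfolding a(2) .
  then have 1: "\<tau> a = 1\<^sub>m (ldim l)" using right_mult_one_mat[OF P] D(1) n by simp
  obtain P' Q' where s': "similar_mat_wit (\<tau> a) (rho l' a) P' Q'"
    using assms(3) a(1) unfolding equivalent_reps_def by blast
  note D' = similar_mat_witD[OF refl s']
  have n': "ldim l' = ldim l" using D'(5) rho_carrier[of l' a] n by auto
  have P': "P' \<in> carrier_mat (ldim l) (ldim l)" "Q' \<in> carrier_mat (ldim l) (ldim l)" using D'(6,7) n by auto
  have "\<tau> a = P' * 0\<^sub>m (ldim l) (ldim l) * Q'" using D'(3) n' by (simp add: a)
  also have "\<dots> = 0\<^sub>m (ldim l) (ldim l)" using P' by simp
  finally have "1\<^sub>m (ldim l) = (0\<^sub>m (ldim l) (ldim l) :: complex mat)" using 1 by simp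
  then have "1\<^sub>m (ldim l) $$ (0, 0) = (0\<^sub>m (ldim l) (ldim l) :: complex mat) $$ (0, 0)" by simp
  then show False using ldim_pos[OF assms(4)] by simp
qed

lemma complete_irreps_rho: "complete_irreps S (rho ` lab ` I)"
  unfolding complete_irreps_def
proof (intro conjI ballI allI impI)
  fix \<tau> assume \<tau>: "irreducible_rep S \<tau>"
  obtain l where l: "l \<in> lab ` I" "equivalent_reps S \<tau> (rho l)"
    using irreducible_equivalent_rho[OF \<tau>] .
  show "\<exists>!\<sigma>. \<sigma> \<in> rho ` lab ` I \<and> equivalent_reps S \<tau> \<sigma>"
  proof (rule ex1I[of _ "rho l"])
    show "rho l \<in> rho ` lab ` I \<and> equivalent_reps S \<tau> (rho l)" using l by blast
    fix \<sigma> assume "\<sigma> \<in> rho ` lab ` I \<and> equivalent_reps S \<tau> \<sigma>"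
    then obtain l' where "\<sigma> = rho l'" "equivalent_reps S \<tau> (rho l')" by blast
    moreover have "representation S \<tau>" using \<tau> by (simp add: irreducible_rep_def)
    ultimately show "\<sigma> = rho l" using equivalent_rho_unique l by metis
  qed
qed (use irreducible_rho in blast)

lemma ft_complexity_le:
  assumes "ext_cost S c ((\<lambda>s f. f s) ` carrier S)
    ((\<lambda>(i, j) f. \<Sum>s\<in>carrier S. f s * M i j s) ` {(i, j). i \<in> I \<and> j \<in> I \<and> lab i = lab j})"
  shows "ft_complexity S \<le> enat c"
proof -
  have "ft_cost S (rho ` lab ` I) \<le> enat c"
  proof (rule ft_cost_le[OF assms])
    fix \<rho> p q assume \<rho>: "\<rho> \<in> rho ` lab ` I" and p: "p < rep_dim \<rho>" and q: "q < rep_dim \<rho>"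
    then obtain l where l: "\<rho> = rho l" by blast
    have "fourier_transform S (rho ` lab ` I) f \<rho> $$ (p, q) =
        (\<Sum>s\<in>carrier S. f s * (\<rho> (salg_basis s) $$ (p, q)))" for f
      unfolding fourier_transform_def restrict_apply'[OF \<rho>] using p q by simp
    then have "(\<lambda>f. fourier_transform S (rho ` lab ` I) f \<rho> $$ (p, q)) =
       (\<lambda>f. \<Sum>s\<in>carrier S. f s * M (lenum l p) (lenum l q) s)"
      using p q unfolding l by (auto simp: rho_def mc_basis intro!: sum.cong)
    then show "(\<lambda>f. fourier_transform S (rho ` lab ` I) f \<rho> $$ (p, q)) \<in>
      (\<lambda>(i, j) f. \<Sum>s\<in>carrier S. f s * M i j s) ` {(i, j). i \<in> I \<and> j \<in> I \<and> lab i = lab j}"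
      using p q l lenum_I lenum_lab by (auto intro!: image_eqI[of _ _ "(lenum l p, lenum l q)"])
  qed
  then show ?thesis
    unfolding ft_complexity_def using complete_irreps_rho by (meson INF_lower2 mem_Collect_eq)
qed

end


subsection \<open>Zeta transforms\<close>

text \<open>The zeta matrix is unitriangular with respect to \<open>rk\<close>. In a downward
  induction on the rank, all strictly larger terms have vanished already, so the sum reduces to
  \<open>a r\<close>.\<close>

lemma zeta_injective:
  fixes a :: "'a \<Rightarrow> complex" and sub :: "'a \<Rightarrow> 'a \<Rightarrow> bool" and rk :: "'a \<Rightarrow> nat"
  assumes fin: "finite C" and rfl: "\<And>r. r \<in> C \<Longrightarrow> sub r r"
    and rk: "\<And>r s. r \<in> C \<Longrightarrow> s \<in> C \<Longrightarrow> sub r s \<Longrightarrow> r \<noteq> s \<Longrightarrow> rk r < rk s"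
    and zero: "\<And>r. r \<in> C \<Longrightarrow> (\<Sum>s\<in>{s \<in> C. sub r s}. a s) = 0"
    and r: "r \<in> C"
  shows "a r = 0"
  using r
proof (induction "Max (rk ` C) - rk r" arbitrary: r rule: less_induct)
  case less
  have "a s = 0" if s: "s \<in> {s \<in> C. sub r s} - {r}" for s
  proof -
    have "rk r < rk s" "rk s \<le> Max (rk ` C)" using rk less.prems s fin by auto
    then show ?thesis using less.hyps[of s] s by auto
  qed
  then have "(\<Sum>s\<in>{s \<in> C. sub r s} - {r}. a s) = 0" by (intro sum.neutral) blast
  moreover have "(\<Sum>s\<in>{s \<in> C. sub r s}. a s) = a r + (\<Sum>s\<in>{s \<in> C. sub r s} - {r}. a s)"
    using less.prems rfl fin by (intro sum.remove) auto
  ultimately show ?case using zero[OF less.prems] by simp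
qed

text \<open>The values of \<open>a\<close> are fixed rank by rank from the top. Since
  \<open>N\<close> exceeds every rank, the induction starts with a vacuous condition and after
  \<open>N\<close> rounds covers all of \<open>C\<close>.\<close>

lemma zeta_surjective:
  fixes b :: "'a \<Rightarrow> complex" and sub :: "'a \<Rightarrow> 'a \<Rightarrow> bool" and rk :: "'a \<Rightarrow> nat"
  assumes fin: "finite C" and rfl: "\<And>r. r \<in> C \<Longrightarrow> sub r r"
    and rk: "\<And>r s. r \<in> C \<Longrightarrow> s \<in> C \<Longrightarrow> sub r s \<Longrightarrow> r \<noteq> s \<Longrightarrow> rk r < rk s"
  shows "\<exists>a. \<forall>r\<in>C. (\<Sum>s\<in>{s \<in> C. sub r s}. a s) = b r"
proof -
  define N where "N = Suc (Max (insert 0 (rk ` C)))"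
  have N: "rk r < N" if "r \<in> C" for r
    using that fin by (simp add: N_def less_Suc_eq_le)
  have "\<exists>a. \<forall>r\<in>C. N - k \<le> rk r \<longrightarrow> (\<Sum>s\<in>{s \<in> C. sub r s}. a s) = b r" if "k \<le> N" for k
    using that
  proof (induction k)
    case 0
    then show ?case using N by (metis diff_zero not_less)
  next
    case (Suc k)
    then obtain a where a: "\<forall>r\<in>C. N - k \<le> rk r \<longrightarrow> (\<Sum>s\<in>{s \<in> C. sub r s}. a s) = b r" by auto
    \<comment> \<open>Only the values of rank \<open>N - Suc k\<close> are corrected; the sums at
      higher rank do not see them.\<close>
    define a' where "a' r = (if rk r = N - Suc k then b r - (\<Sum>s\<in>{s \<in> C. sub r s} - {r}. a s) else a r)" for r
    have "(\<Sum>s\<in>{s \<in> C. sub r s}. a' s) = b r" if r: "r \<in> C" "N - Suc k \<le> rk r" for r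
    proof -
      have tail: "(\<Sum>s\<in>{s \<in> C. sub r s} - {r}. a' s) = (\<Sum>s\<in>{s \<in> C. sub r s} - {r}. a s)"
      proof (rule sum.cong[OF refl])
        fix s assume "s \<in> {s \<in> C. sub r s} - {r}"
        then have "rk r < rk s" using rk r by auto
        then show "a' s = a s" using r by (simp add: a'_def)
      qed
      have "(\<Sum>s\<in>{s \<in> C. sub r s}. g s) = g r + (\<Sum>s\<in>{s \<in> C. sub r s} - {r}. g s)" for g :: "'a \<Rightarrow> complex"
        using r rfl fin by (intro sum.remove) auto
      note split = this
      show ?thesis
      proof (cases "rk r = N - Suc k")
        case True
        then show ?thesis unfolding split[of a'] tail by (simp add: a'_def)
      next
        case False
        then have "N - k \<le> rk r" using r Suc.prems by linarith
        moreover have "a' r = a r" using False by (simp add: a'_def)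
        ultimately show ?thesis using a r(1) split[of a] unfolding split[of a'] tail by simp
      qed
    qed
    then show ?case by blast
  qed
  from this[of N] show ?thesis by simp
qed


subsection \<open>The rook monoid as a union of symmetric groups\<close>

definition enum_set :: "nat set \<Rightarrow> nat \<Rightarrow> nat" where
  "enum_set A = (SOME e. bij_betw e {..<card A} A)"

text \<open>
  Fixed enumerations of all finite sets identify the bijections \<open>A \<rightarrow> B\<close> with permutations of
  \<open>{..<card A}\<close>.
\<close>

definition block_map :: "nat set \<Rightarrow> nat set \<Rightarrow> nat perm \<Rightarrow> (nat \<rightharpoonup> nat)" where
  "block_map A B p = (\<lambda>x. if x \<in> A then Some (enum_set B (apply p (inv_into {..<card A} (enum_set A) x))) else None)"

lemma enum_set_bij: "finite A \<Longrightarrow> bij_betw (enum_set A) {..<card A} A"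
  unfolding enum_set_def
  by (rule someI_ex[of "\<lambda>e. bij_betw e {..<card A} A"])
    (use ex_bij_betw_nat_finite[of A] in \<open>simp add: atLeast0LessThan\<close>)

lemma enum_set_in: "finite A \<Longrightarrow> i < card A \<Longrightarrow> enum_set A i \<in> A"
  using enum_set_bij[of A] by (auto simp: bij_betw_def)

lemma enum_set_eq_iff: "finite A \<Longrightarrow> i < card A \<Longrightarrow> j < card A \<Longrightarrow> enum_set A i = enum_set A j \<longleftrightarrow> i = j"
  using enum_set_bij[of A] by (auto simp: bij_betw_def inj_on_def)

lemma enum_set_surj: "finite A \<Longrightarrow> x \<in> A \<Longrightarrow> \<exists>i<card A. x = enum_set A i"
  using enum_set_bij[of A] by (force simp: bij_betw_def)

lemma dom_block_map: "dom (block_map A B p) = A"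
  by (auto simp: block_map_def split: if_splits)

lemma block_map_cen: "finite A \<Longrightarrow> i < card A \<Longrightarrow> block_map A B p (enum_set A i) = Some (enum_set B (apply p i))"
  using enum_set_bij[of A] by (auto simp: block_map_def enum_set_in bij_betw_def inv_into_f_f)

lemma block_map_le_iff:
  assumes "finite A"
  shows "block_map A B p \<subseteq>\<^sub>m s \<longleftrightarrow> (\<forall>i<card A. s (enum_set A i) = Some (enum_set B (apply p i)))"
  unfolding map_le_def dom_block_map
  using block_map_cen[OF assms] enum_set_in[OF assms] enum_set_surj[OF assms] by metis

lemma ran_block_map:
  assumes "finite A" "finite B" "card A = card B" "p \<in> Sym (card A)"
  shows "ran (block_map A B p) = B"
proof
  show "ran (block_map A B p) \<subseteq> B"
  proof
    fix y assume "y \<in> ran (block_map A B p)"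
    then obtain x where x: "block_map A B p x = Some y" by (auto simp: ran_def)
    then have "x \<in> A" using dom_block_map by (metis domI)
    then obtain i where i: "i < card A" "x = enum_set A i" using enum_set_surj assms by blast
    then have "y = enum_set B (apply p i)" using x block_map_cen[OF assms(1)] by simp
    then show "y \<in> B" using enum_set_in assms Sym_apply_less i by simp
  qed
  show "B \<subseteq> ran (block_map A B p)"
  proof
    fix y assume "y \<in> B"
    then obtain j where j: "j < card B" "y = enum_set B j" using enum_set_surj assms by blast
    define i where "i = apply (inverse p) j"
    have "i < card A" unfolding i_def using Sym_apply_less Sym_inverse assms j by metis
    moreover have "apply p i = j" unfolding i_def by (simp add: apply_sequence)
    ultimately have "block_map A B p (enum_set A i) = Some y" using block_map_cen[OF assms(1)] j by simp
    then show "y \<in> ran (block_map A B p)" by (rule ranI)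
  qed
qed

text \<open>The restriction of \<open>s\<close> to \<open>A\<close> determines its range, and then
  the permutation on the points below \<open>card A\<close>; all other points are fixed.\<close>

lemma block_map_le_unique:
  assumes "finite A" "finite B" "finite B'" "card A = card B" "card A = card B'"
    and "p \<in> Sym (card A)" "p' \<in> Sym (card A)" "block_map A B p \<subseteq>\<^sub>m s" "block_map A B' p' \<subseteq>\<^sub>m s"
  shows "B = B' \<and> p = p'"
proof -
  have eq: "block_map A B p = block_map A B' p'"
  proof
    fix x show "block_map A B p x = block_map A B' p' x"
      using assms(8,9) dom_block_map unfolding map_le_def by (cases "x \<in> A") (auto simp: block_map_def)
  qed
  then have B: "B = B'" using ran_block_map assms by metis
  have "apply p i = apply p' i" for i
  proof (cases "i < card A")
    case True
    then have "enum_set B (apply p i) = enum_set B (apply p' i)"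
      using block_map_cen[OF assms(1) True] eq B by (metis option.inject)
    then show ?thesis using enum_set_eq_iff[OF assms(2)] Sym_apply_less assms True by metis
  next
    case False
    then show ?thesis using Sym_apply assms by simp
  qed
  then show ?thesis using B by (simp add: perm_eq_iff)
qed

text \<open>This is where the multiplicativity of the block matrices comes from: once
  \<open>t\<close> carries \<open>A\<close> to \<open>B\<close> by \<open>p\<close>, restrictions of
  \<open>s\<close> from \<open>B\<close> to \<open>C\<close> and of the composite from
  \<open>A\<close> to \<open>C\<close> correspond by \<open>q \<mapsto> q * p\<close>.\<close>

lemma block_map_comp_le_iff:
  assumes "finite A" "finite B" "card A = card B" "p \<in> Sym (card A)" and le: "block_map A B p \<subseteq>\<^sub>m t"
  shows "block_map A C (q * p) \<subseteq>\<^sub>m s \<circ>\<^sub>m t \<longleftrightarrow> block_map B C q \<subseteq>\<^sub>m s"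
proof -
  have t: "t (enum_set A i) = Some (enum_set B (apply p i))" if "i < card A" for i
    using le that block_map_le_iff[OF assms(1)] by blast
  have "block_map A C (q * p) \<subseteq>\<^sub>m s \<circ>\<^sub>m t \<longleftrightarrow> (\<forall>i<card A. s (enum_set B (apply p i)) = Some (enum_set C (apply q (apply p i))))"
    unfolding block_map_le_iff[OF assms(1)] by (auto simp: t map_comp_def apply_times)
  also have "\<dots> \<longleftrightarrow> (\<forall>j<card B. s (enum_set B j) = Some (enum_set C (apply q j)))"
  proof
    assume *: "\<forall>i<card A. s (enum_set B (apply p i)) = Some (enum_set C (apply q (apply p i)))"
    show "\<forall>j<card B. s (enum_set B j) = Some (enum_set C (apply q j))"
    proof (intro allI impI)
      fix j assume "j < card B"
      then have "apply (inverse p) j < card A" using Sym_apply_less Sym_inverse assms by metis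
      from *[rule_format, OF this] show "s (enum_set B j) = Some (enum_set C (apply q j))"
        by (simp add: apply_sequence)
    qed
  next
    assume "\<forall>j<card B. s (enum_set B j) = Some (enum_set C (apply q j))"
    then show "\<forall>i<card A. s (enum_set B (apply p i)) = Some (enum_set C (apply q (apply p i)))"
      using Sym_apply_less assms by metis
  qed
  finally show ?thesis using block_map_le_iff[OF assms(2)] by blast
qed

section \<open>Elements of the rook monoid, their restrictions, and lower bounds for their
  number\<close>

abbreviation rooks :: "nat \<Rightarrow> (nat \<rightharpoonup> nat) set" where
  "rooks n \<equiv> carrier (rook_monoid n)"

lemma rook_carrier:
  "g \<in> rooks n \<longleftrightarrow> dom g \<subseteq> {1..n} \<and> ran g \<subseteq> {1..n} \<and> inj_on g (dom g)"
  by (simp add: rook_monoid_def)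

lemma rook_mult: "mult (rook_monoid n) g h = g \<circ>\<^sub>m h"
  by (simp add: rook_monoid_def)

lemma finite_rook: "finite (rooks n)"
proof (rule finite_subset)
  show "rooks n \<subseteq> (\<Union>A\<in>Pow {1..n}. {g. dom g = A \<and> ran g \<subseteq> {1..n}})"
  proof
    fix g assume "g \<in> rooks n"
    then have "dom g \<in> Pow {1..n}" "ran g \<subseteq> {1..n}" by (simp_all add: rook_carrier)
    then show "g \<in> (\<Union>A\<in>Pow {1..n}. {g. dom g = A \<and> ran g \<subseteq> {1..n}})" by (intro UN_I[of "dom g"]) simp_all
  qed
  show "finite (\<Union>A\<in>Pow {1..n}. {g::nat \<rightharpoonup> nat. dom g = A \<and> ran g \<subseteq> {1..n}})"
    by (intro finite_UN_I finite_set_of_finite_maps) (auto intro: finite_subset)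
qed

lemma rook_closed:
  assumes "g \<in> rooks n" "h \<in> rooks n"
  shows "g \<circ>\<^sub>m h \<in> rooks n"
proof -
  have "x = y" if e: "(g \<circ>\<^sub>m h) x = Some b" "(g \<circ>\<^sub>m h) y = Some b" for x y b
  proof -
    obtain x' y' where h: "h x = Some x'" "h y = Some y'" and g: "g x' = Some b" "g y' = Some b"
      using e by (auto simp: map_comp_Some_iff)
    have inj: "inj_on g (dom g)" "inj_on h (dom h)" using assms by (simp_all add: rook_carrier)
    have "x' = y'" using inj_onD[OF inj(1), of x' y'] g by (simp add: domI)
    then show ?thesis using inj_onD[OF inj(2), of x y] h by (simp add: domI)
  qed
  then have "inj_on (g \<circ>\<^sub>m h) (dom (g \<circ>\<^sub>m h))"
    unfolding inj_on_def by (metis domD)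
  moreover have "dom (g \<circ>\<^sub>m h) \<subseteq> dom h" "ran (g \<circ>\<^sub>m h) \<subseteq> ran g"
    by (auto simp: map_comp_Some_iff ran_def)
  ultimately show ?thesis using assms unfolding rook_carrier by blast
qed

lemma rook_subset: "A \<subseteq> {1..n} \<Longrightarrow> finite A \<and> card A \<le> n"
  using card_mono[of "{1..n}" A] finite_subset[of A "{1..n}"] by auto

lemma block_map_rook:
  assumes A: "A \<subseteq> {1..n}" and B: "B \<subseteq> {1..n}" and "card A = card B" "p \<in> Sym (card A)"
  shows "block_map A B p \<in> rooks n"
proof -
  have fin: "finite A" "finite B" using rook_subset A B by auto
  have "inj_on (block_map A B p) A"
  proof (rule inj_onI)
    fix x y assume xy: "x \<in> A" "y \<in> A" "block_map A B p x = block_map A B p y"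
    then obtain i j where ij: "i < card A" "x = enum_set A i" "j < card A" "y = enum_set A j"
      using enum_set_surj fin by metis
    then have "enum_set B (apply p i) = enum_set B (apply p j)" using xy block_map_cen[OF fin(1)] by simp
    then have "apply p i = apply p j" using enum_set_eq_iff[OF fin(2)] Sym_apply_less assms ij by metis
    then show "x = y" using ij by (simp add: apply_inj)
  qed
  then show ?thesis using A B ran_block_map[OF fin assms(3,4)] by (simp add: rook_carrier dom_block_map)
qed

lemma block_map_exists:
  assumes t: "t \<in> rooks n" and A: "A \<subseteq> dom t"
  obtains B p where "B \<subseteq> {1..n}" "card A = card B" "p \<in> Sym (card A)" "block_map A B p \<subseteq>\<^sub>m t"
proof -
  have A1: "A \<subseteq> {1..n}" using t A unfolding rook_carrier by blast
  then have fin: "finite A" using rook_subset by blast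
  define B where "B = (\<lambda>x. the (t x)) ` A"
  have tt: "t x = Some (the (t x))" if "x \<in> A" for x using that A by auto
  have inj: "inj_on (\<lambda>x. the (t x)) A"
    using t A tt unfolding rook_carrier inj_on_def by (metis subsetD)
  have B1: "B \<subseteq> {1..n}" using t tt unfolding B_def rook_carrier by (auto intro: ranI)
  have cAB: "card A = card B" unfolding B_def using card_image[OF inj] by simp
  have finB: "finite B" using fin B_def by simp
  let ?k = "card A"
  let ?f = "\<lambda>i. inv_into {..<?k} (enum_set B) (the (t (enum_set A i)))"
  have bf: "bij_betw ?f {..<?k} {..<?k}"
  proof -
    have "bij_betw (\<lambda>x. the (t x)) A B" using inj by (simp add: bij_betw_def B_def)
    from bij_betw_trans[OF bij_betw_trans[OF enum_set_bij[OF fin] this] bij_betw_inv_into[OF enum_set_bij[OF finB]]]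
    show ?thesis by (simp add: o_def cAB)
  qed
  \<comment> \<open>The bijection of indices is extended by the identity to a permutation of all
    natural numbers.\<close>
  define f where "f i = (if i < ?k then ?f i else i)" for i
  have "bij_betw f {..<?k} {..<?k}" using bf by (rule bij_betw_cong[THEN iffD1, rotated]) (simp add: f_def)
  moreover have "bij_betw f (- {..<?k}) (- {..<?k})" by (rule bij_betw_cong[THEN iffD1, rotated, OF bij_betw_id]) (simp add: f_def)
  ultimately have "bij_betw f ({..<?k} \<union> - {..<?k}) ({..<?k} \<union> - {..<?k})"
    by (rule bij_betw_combine) auto
  moreover have "{..<?k} \<union> - {..<?k} = UNIV" by blast
  ultimately have "bij f" by (simp only:)
  moreover have sub: "{i. f i \<noteq> i} \<subseteq> {..<?k}" by (auto simp: f_def)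
  ultimately have ap: "apply (Perm f) = f" by (intro Perm_inverse) (auto intro: finite_subset)
  have "Perm f \<in> Sym ?k" unfolding Sym_def using sub by (auto simp: in_affected ap)
  moreover have "block_map A B (Perm f) \<subseteq>\<^sub>m t"
    unfolding block_map_le_iff[OF fin] ap
  proof (intro allI impI)
    fix i assume i: "i < ?k"
    then have x: "enum_set A i \<in> A" using enum_set_in fin by blast
    then have "the (t (enum_set A i)) \<in> enum_set B ` {..<?k}"
      using enum_set_bij[OF finB] cAB by (simp add: bij_betw_def B_def)
    then have "enum_set B (?f i) = the (t (enum_set A i))" by (rule f_inv_into_f)
    then show "t (enum_set A i) = Some (enum_set B (f i))" using tt[OF x] i by (simp add: f_def)
  qed
  ultimately show thesis using that B1 cAB by blast
qed

lemma map_le_card_dom: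
  assumes "s \<in> rooks n" "r \<subseteq>\<^sub>m s" "r \<noteq> s"
  shows "card (dom r) < card (dom s)"
proof -
  have "finite (dom s)" using assms(1) rook_subset unfolding rook_carrier by blast
  moreover have "dom r \<subseteq> dom s" using assms(2) by (rule map_le_implies_dom_le)
  moreover have "dom r \<noteq> dom s"
  proof
    assume eq: "dom r = dom s"
    have "r = s"
    proof
      fix x show "r x = s x"
        using assms(2) eq unfolding map_le_def by (metis domIff)
    qed
    then show False using assms(3) by simp
  qed
  ultimately show ?thesis by (intro psubset_card_mono) auto
qed

definition rook_pairs :: "nat \<Rightarrow> (nat set \<times> nat set) set" where
  "rook_pairs n = {(A, B). A \<subseteq> {1..n} \<and> B \<subseteq> {1..n} \<and> card A = card B}"

lemma finite_rook_pairs: "finite (rook_pairs n)"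
  by (rule finite_subset[of _ "Pow {1..n} \<times> Pow {1..n}"]) (auto simp: rook_pairs_def)

lemma rook_eq_block_map:
  assumes "r \<in> rooks n"
  obtains A B p where "(A, B) \<in> rook_pairs n" "p \<in> Sym (card A)" "r = block_map A B p"
proof -
  obtain B p where B: "B \<subseteq> {1..n}" "card (dom r) = card B" "p \<in> Sym (card (dom r))" "block_map (dom r) B p \<subseteq>\<^sub>m r"
    using block_map_exists[OF assms, of "dom r"] by blast
  have "block_map (dom r) B p = r" using map_le_card_dom[OF assms B(4)] by (auto simp: dom_block_map)
  then show thesis using that B assms by (auto simp: rook_pairs_def rook_carrier)
qed

text \<open>Different triples \<open>(A, B, p)\<close> give different rooks. This converts the total
  cost of the transforms on the blocks into a multiple of the size of the rook monoid.\<close>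

lemma card_rook_ge: "(\<Sum>(A, B)\<in>rook_pairs n. fact (card A)) \<le> card (rooks n)"
proof -
  let ?T = "SIGMA w:rook_pairs n. Sym (card (fst w))"
  let ?f = "\<lambda>(w, p). block_map (fst w) (snd w) p"
  have "inj_on ?f ?T"
  proof (rule inj_onI)
    fix v w assume v: "v \<in> ?T" and w: "w \<in> ?T" and e: "?f v = ?f w"
    obtain A B p A' B' p' where vw: "v = ((A, B), p)" "w = ((A', B'), p')" by (metis prod.exhaust)
    have e': "block_map A B p = block_map A' B' p'" using e vw by simp
    then have A: "A = A'" using dom_block_map by metis
    have "finite A" "finite B" "finite B'" "card A = card B" "card A = card B'" "p \<in> Sym (card A)" "p' \<in> Sym (card A)"
      using v w vw A rook_subset by (auto simp: rook_pairs_def)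
    then have "B = B' \<and> p = p'" using block_map_le_unique[of A B B' p p' "block_map A B p"] e' A by simp
    then show "v = w" using vw A by simp
  qed
  then have "card ?T = card (?f ` ?T)" by (simp add: card_image)
  also have "\<dots> \<le> card (rooks n)"
    by (intro card_mono finite_rook) (auto simp: rook_pairs_def intro!: block_map_rook)
  also have "card ?T = (\<Sum>(A, B)\<in>rook_pairs n. fact (card A))"
    using finite_rook_pairs finite_Sym by (simp add: card_Sym case_prod_unfold)
  finally show ?thesis .
qed

text \<open>The maps \<open>block_map A A 1\<close> are partial identities, one for each
  domain.\<close>

lemma card_rook_ge_power: "2 ^ n \<le> card (rooks n)"
proof -
  have "inj_on (\<lambda>A. block_map A A 1) (Pow {1..n})" by (rule inj_onI) (metis dom_block_map)
  then have "card ((\<lambda>A. block_map A A 1) ` Pow {1..n}) = 2 ^ n" by (simp add: card_image card_Pow)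
  moreover have "(\<lambda>A. block_map A A 1) ` Pow {1..n} \<subseteq> rooks n"
    by (auto intro!: block_map_rook simp: Sym_1)
  ultimately show ?thesis using card_mono[OF finite_rook, of "(\<lambda>A. block_map A A 1) ` Pow {1..n}" n] by simp
qed


subsection \<open>Fast zeta transform on the rook monoid\<close>

text \<open>
  The partial sums over the extensions of \<open>r\<close> that add only points of \<open>{1..m}\<close> to its domain; for
  \<open>m = n\<close> these are all extensions. Passing from \<open>m\<close> to \<open>Suc m\<close> treats one point of the domain.
\<close>

definition zeta :: "nat \<Rightarrow> nat \<Rightarrow> (nat \<rightharpoonup> nat) \<Rightarrow> ((nat \<rightharpoonup> nat) \<Rightarrow> complex) \<Rightarrow> complex" where
  "zeta n m r f = (\<Sum>s\<in>{s \<in> rooks n. r \<subseteq>\<^sub>m s \<and> dom s - dom r \<subseteq> {1..m}}. f s)"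

lemma zeta_0: "r \<in> rooks n \<Longrightarrow> zeta n 0 r f = f r"
proof -
  assume r: "r \<in> rooks n"
  have "s = r" if "s \<in> rooks n" "r \<subseteq>\<^sub>m s" "dom s \<subseteq> dom r" for s
    using map_le_card_dom[OF that(1,2)] that(3) r rook_subset unfolding rook_carrier
    by (metis card_mono not_less)
  then have "{s \<in> rooks n. r \<subseteq>\<^sub>m s \<and> dom s - dom r \<subseteq> {1..0}} = {r}"
    using r by auto
  then show ?thesis by (simp add: zeta_def)
qed

lemma zeta_full: "zeta n n r f = (\<Sum>s\<in>{s \<in> rooks n. r \<subseteq>\<^sub>m s}. f s)"
  unfolding zeta_def by (rule sum.cong) (auto simp: rook_carrier)

text \<open>An extension of \<open>r\<close> either stays undefined at \<open>Suc m\<close> or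
  extends \<open>r(Suc m \<mapsto> j)\<close> for exactly one \<open>j\<close>, and injectivity
  keeps \<open>j\<close> out of \<open>ran r\<close>. In both cases the remaining freedom lies in
  \<open>{1..m}\<close>.\<close>

lemma zeta_Suc:
  assumes r: "r \<in> rooks n" and m: "m < n"
  shows "zeta n (Suc m) r f = zeta n m r f +
    (\<Sum>j\<in>(if Suc m \<in> dom r then {} else {1..n} - ran r). zeta n m (r(Suc m \<mapsto> j)) f)"
proof (cases "Suc m \<in> dom r")
  case True
  have "{1..Suc m} = insert (Suc m) {1..m}" by auto
  then have "{s \<in> rooks n. r \<subseteq>\<^sub>m s \<and> dom s - dom r \<subseteq> {1..Suc m}} =
     {s \<in> rooks n. r \<subseteq>\<^sub>m s \<and> dom s - dom r \<subseteq> {1..m}}"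
    using True by (simp only:) blast
  then show ?thesis using True by (simp add: zeta_def)
next
  case False
  let ?C = "rooks n"
  let ?J = "{1..n} - ran r"
  let ?S = "{s \<in> ?C. r \<subseteq>\<^sub>m s \<and> dom s - dom r \<subseteq> {1..Suc m}}"
  let ?keep = "{s \<in> ?C. r \<subseteq>\<^sub>m s \<and> dom s - dom r \<subseteq> {1..m}}"
  let ?ext = "\<lambda>j. {s \<in> ?C. r(Suc m \<mapsto> j) \<subseteq>\<^sub>m s \<and> dom s - dom (r(Suc m \<mapsto> j)) \<subseteq> {1..m}}"
  have rN: "r (Suc m) = None" using False by auto
  have le_upd: "r(Suc m \<mapsto> j) \<subseteq>\<^sub>m s \<longleftrightarrow> r \<subseteq>\<^sub>m s \<and> s (Suc m) = Some j" for s j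
    using False unfolding map_le_def by auto
  have Sj: "?ext j = {s \<in> ?S. s (Suc m) = Some j}" for j
  proof -
    have "A - insert a B \<subseteq> C \<longleftrightarrow> A - B \<subseteq> insert a C" for a and A B C :: "nat set" by blast
    moreover have "{1..Suc m} = insert (Suc m) {1..m}" by auto
    ultimately have "\<And>s :: nat \<rightharpoonup> nat. dom s - dom (r(Suc m \<mapsto> j)) \<subseteq> {1..m} \<longleftrightarrow> dom s - dom r \<subseteq> {1..Suc m}" by simp
    then show ?thesis unfolding le_upd by (simp only: mem_Collect_eq conj_ac)
  qed
  have S0: "?keep = {s \<in> ?S. s (Suc m) = None}"
  proof -
    have "Suc m \<notin> {1..m}" by simp
    then show ?thesis using False by (auto simp: le_Suc_eq domIff)
  qed
  have inJ: "j \<in> ?J" if s: "s \<in> ?S" "s (Suc m) = Some j" for s j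
  proof -
    have "j \<in> {1..n}" using s by (auto simp: rook_carrier intro: ranI)
    moreover have "j \<notin> ran r"
    proof
      assume "j \<in> ran r"
      then obtain x where x: "r x = Some j" by (auto simp: ran_def)
      then have sx: "s x = Some j" using s unfolding map_le_def by force
      have "inj_on s (dom s)" using s(1) by (simp add: rook_carrier)
      from inj_onD[OF this, of x "Suc m"] have "x = Suc m" using sx s(2) by (simp add: domI)
      then show False using x rN by simp
    qed
    ultimately show ?thesis by simp
  qed
  have S: "?S = ?keep \<union> (\<Union>j\<in>?J. ?ext j)"
  proof (rule subset_antisym; rule subsetI)
    fix s assume s: "s \<in> ?S"
    show "s \<in> ?keep \<union> (\<Union>j\<in>?J. ?ext j)"
      using s inJ[OF s] unfolding S0 Sj by (cases "s (Suc m)") auto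
  next
    fix s assume "s \<in> ?keep \<union> (\<Union>j\<in>?J. ?ext j)"
    then show "s \<in> ?S" unfolding S0 Sj by blast
  qed
  have fin: "finite ?keep" "finite (\<Union>j\<in>?J. ?ext j)" "\<And>j. finite (?ext j)"
    using finite_rook by auto
  have "(\<Sum>s\<in>?S. f s) = (\<Sum>s\<in>?keep. f s) + (\<Sum>s\<in>(\<Union>j\<in>?J. ?ext j). f s)"
    by (subst S, rule sum.union_disjoint[OF fin(1,2)]) (unfold S0 Sj, auto)
  also have "(\<Sum>s\<in>(\<Union>j\<in>?J. ?ext j). f s) = (\<Sum>j\<in>?J. \<Sum>s\<in>?ext j. f s)"
  proof (rule sum.UNION_disjoint)
    show "\<forall>i\<in>?J. \<forall>j\<in>?J. i \<noteq> j \<longrightarrow> ?ext i \<inter> ?ext j = {}" unfolding Sj by auto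
  qed (use fin(3) in auto)
  finally show ?thesis using False by (simp add: zeta_def)
qed

text \<open>Each stage is carried out for all rooks at once, so the values for the one-point
  extensions are already there. An output then has one term for \<open>r\<close> itself and at most
  \<open>n\<close> terms for its extensions.\<close>

lemma zeta_cost:
  assumes "m \<le> n"
  shows "ext_cost (rook_monoid n) (m * (Suc n * card (rooks n)))
    ((\<lambda>s f. f s) ` rooks n) (zeta n m ` rooks n)"
  using assms
proof (induction m)
  case 0
  have "zeta n 0 r = (\<lambda>f. f r)" if "r \<in> rooks n" for r
    using zeta_0[OF that] by blast
  then show ?case by (intro ext_cost_subset) auto
next
  case (Suc m)
  let ?C = "rooks n"
  let ?V = "(\<lambda>s f. f s) ` ?C \<union> zeta n m ` ?C"
  have IH: "ext_cost (rook_monoid n) (m * (Suc n * card ?C)) ((\<lambda>s f. f s) ` ?C) (zeta n m ` ?C)"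
    using Suc by simp
  have "ext_cost (rook_monoid n) (Suc n) ?V {zeta n (Suc m) r}" if r: "r \<in> ?C" for r
  proof -
    let ?K = "if Suc m \<in> dom r then {} else {1..n} - ran r"
    let ?J = "insert None (Some ` ?K)"
    let ?v = "\<lambda>w. case w of None \<Rightarrow> zeta n m r | Some j \<Rightarrow> zeta n m (r(Suc m \<mapsto> j))"
    have finK: "finite ?K" by simp
    have upd: "r(Suc m \<mapsto> j) \<in> ?C" if j: "j \<in> ?K" for j
    proof -
      have nd: "Suc m \<notin> dom r" and j': "j \<in> {1..n}" "j \<notin> ran r" using j by (auto split: if_splits)
      have "inj_on (r(Suc m \<mapsto> j)) (dom (r(Suc m \<mapsto> j)))"
      proof (rule inj_onI)
        fix x y assume xy: "x \<in> dom (r(Suc m \<mapsto> j))" "(r(Suc m \<mapsto> j)) x = (r(Suc m \<mapsto> j)) y"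
        have "inj_on r (dom r)" using r by (simp add: rook_carrier)
        moreover have "r z \<noteq> Some j" for z using j'(2) by (auto simp: ran_def)
        ultimately show "x = y"
          using xy by (auto split: if_splits dest: inj_onD) (metis inj_onD domI)
      qed
      then show ?thesis using r nd j' Suc.prems unfolding rook_carrier by (auto simp: ran_def split: if_splits)
    qed
    have "ext_cost (rook_monoid n) (card ?J) ?V {\<lambda>f. \<Sum>w\<in>?J. 1 * ?v w f}"
      using r upd finK by (intro ext_cost_lincomb) auto
    also have "(\<lambda>f. \<Sum>w\<in>?J. 1 * ?v w f) = zeta n (Suc m) r"
    proof
      fix f
      have "(\<Sum>w\<in>?J. 1 * ?v w f) = zeta n m r f + (\<Sum>j\<in>?K. zeta n m (r(Suc m \<mapsto> j)) f)"
        using finK by (subst sum.insert) (auto simp: sum.reindex)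
      then show "(\<Sum>w\<in>?J. 1 * ?v w f) = zeta n (Suc m) r f"
        using zeta_Suc[OF r, of m f] Suc.prems by simp
    qed
    finally have *: "ext_cost (rook_monoid n) (card ?J) ?V {zeta n (Suc m) r}" .
    have "card ?K \<le> card {1..n}" by (rule card_mono) auto
    moreover have "card ?J = Suc (card ?K)" using finK by (simp add: card_image)
    ultimately have "card ?J \<le> Suc n" by simp
    with * show ?thesis by (auto intro: ext_cost_mono)
  qed
  then have "ext_cost (rook_monoid n) (\<Sum>r\<in>?C. Suc n) ?V (\<Union>r\<in>?C. {zeta n (Suc m) r})"
    by (intro ext_cost_UN finite_rook)
  from ext_cost_trans[OF IH this] show ?case
    by (rule ext_cost_mono) auto
qed


subsection \<open>The Fourier transform on the rook monoid\<close>

definition rook_index :: "(nat \<Rightarrow> 'x set) \<Rightarrow> nat \<Rightarrow> (nat set \<times> 'x) set" where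
  "rook_index X n = (SIGMA A:Pow {1..n}. X (card A))"

definition rook_label :: "(nat \<Rightarrow> 'x \<Rightarrow> 'l) \<Rightarrow> nat set \<times> 'x \<Rightarrow> nat \<times> 'l" where
  "rook_label lab i = (card (fst i), lab (card (fst i)) (snd i))"

text \<open>
  The block at row \<open>B\<close> and column \<open>A\<close> is the matrix of the permutation induced by the restriction of
  \<open>s\<close> to a bijection from \<open>A\<close> to \<open>B\<close>, and zero if there is none: the sum has at most one term.
\<close>

definition rook_coeff :: "(nat \<Rightarrow> 'x \<Rightarrow> 'x \<Rightarrow> nat perm \<Rightarrow> complex) \<Rightarrow> nat set \<times> 'x \<Rightarrow> nat set \<times> 'x \<Rightarrow>
    (nat \<rightharpoonup> nat) \<Rightarrow> complex" where
  "rook_coeff D i j s = (if card (fst j) = card (fst i) then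
     (\<Sum>p\<in>{p \<in> Sym (card (fst j)). block_map (fst j) (fst i) p \<subseteq>\<^sub>m s}. D (card (fst j)) (snd i) (snd j) p) else 0)"

text \<open>After exchanging the sums, a block of the Fourier transform on the rook monoid is a
  Fourier transform on a symmetric group, applied to the zeta transform of the input.\<close>

lemma rook_coeff_sum:
  assumes "card A = card B"
  shows "(\<Sum>s\<in>rooks n. a s * rook_coeff D (B, x) (A, y) s) =
     (\<Sum>p\<in>Sym (card A). D (card A) x y p * zeta n n (block_map A B p) a)"
proof -
  let ?C = "rooks n"
  have "(\<Sum>s\<in>?C. a s * rook_coeff D (B, x) (A, y) s) =
     (\<Sum>s\<in>?C. \<Sum>p\<in>Sym (card A). if block_map A B p \<subseteq>\<^sub>m s then a s * D (card A) x y p else 0)"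
    using assms finite_Sym by (simp add: rook_coeff_def sum_distrib_left sum.inter_filter if_distrib[of "times _"] cong: if_cong)
  also have "\<dots> = (\<Sum>p\<in>Sym (card A). \<Sum>s\<in>?C. if block_map A B p \<subseteq>\<^sub>m s then a s * D (card A) x y p else 0)"
    by (rule sum.swap)
  also have "\<dots> = (\<Sum>p\<in>Sym (card A). D (card A) x y p * zeta n n (block_map A B p) a)"
    using finite_rook by (simp add: zeta_full sum_distrib_left sum.inter_filter if_distrib[of "times _"] mult.commute cong: if_cong)
  finally show ?thesis .
qed

text \<open>Injectivity and surjectivity are inherited from the symmetric groups block by block,
  since the zeta transform between them is invertible. Multiplicativity holds because in each block
  column a partial injection has at most one nonzero block.\<close>

lemma (in sym_coefficients) rook_matrix_coefficients:
  "matrix_coefficients (rook_monoid n) (rook_index X n) (rook_label lab) (rook_coeff D)"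
proof
  let ?C = "rooks n"
  show "finite ?C" by (rule finite_rook)
  show "finite (rook_index X n)" unfolding rook_index_def using finX by auto
  show "s \<otimes>\<^bsub>rook_monoid n\<^esub> s' \<in> ?C" if "s \<in> ?C" "s' \<in> ?C" for s s'
    using rook_closed that by (simp add: rook_mult)
  show "rook_coeff D i j s = 0" if "i \<in> rook_index X n" "j \<in> rook_index X n" "s \<in> ?C"
      "rook_label lab i \<noteq> rook_label lab j" for i j s
    using that D_lab by (auto simp: rook_coeff_def rook_index_def rook_label_def intro!: sum.neutral)
  show "rook_coeff D i j (s \<otimes>\<^bsub>rook_monoid n\<^esub> t) =
      (\<Sum>k\<in>rook_index X n. rook_coeff D i k s * rook_coeff D k j t)"
    if i: "i \<in> rook_index X n" and j: "j \<in> rook_index X n" and s: "s \<in> ?C" and t: "t \<in> ?C" for i j s t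
  proof -
    obtain C x A y where ij: "i = (C, x)" "j = (A, y)" by fastforce
    have CA: "C \<subseteq> {1..n}" "A \<subseteq> {1..n}" "x \<in> X (card C)" "y \<in> X (card A)"
      using i j ij by (auto simp: rook_index_def)
    have fin: "finite C" "finite A" using CA rook_subset by auto
    show ?thesis
    proof (cases "A \<subseteq> dom t")
      \<comment> \<open>If \<open>t\<close> is not defined on all of \<open>A\<close>, then neither
        is the composite, so both sides vanish.\<close>
      case False
      have no: "\<not> block_map A B p \<subseteq>\<^sub>m t" for B p
      proof
        assume "block_map A B p \<subseteq>\<^sub>m t"
        from map_le_implies_dom_le[OF this] show False using False by (simp add: dom_block_map)
      qed
      have no': "\<not> block_map A C p \<subseteq>\<^sub>m s \<circ>\<^sub>m t" for p
      proof
        assume "block_map A C p \<subseteq>\<^sub>m s \<circ>\<^sub>m t"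
        from map_le_implies_dom_le[OF this] have "A \<subseteq> dom (s \<circ>\<^sub>m t)" by (simp add: dom_block_map)
        moreover have "dom (s \<circ>\<^sub>m t) \<subseteq> dom t" by (auto simp: map_comp_Some_iff)
        ultimately show False using False by blast
      qed
      have "rook_coeff D k j t = 0" for k
        unfolding rook_coeff_def ij fst_conv snd_conv by (simp add: no)
      moreover have "rook_coeff D i j (s \<circ>\<^sub>m t) = 0"
        unfolding rook_coeff_def ij fst_conv snd_conv by (simp add: no')
      ultimately show ?thesis by (simp add: rook_mult)
    next
      case True
      obtain B p where B: "B \<subseteq> {1..n}" "card A = card B" "p \<in> Sym (card A)" "block_map A B p \<subseteq>\<^sub>m t"
        using block_map_exists[OF t True] .
      have finB: "finite B" using B rook_subset by blast
      have uniq: "block_map A B' p' \<subseteq>\<^sub>m t \<longleftrightarrow> B' = B \<and> p' = p"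
        if "B' \<subseteq> {1..n}" "card A = card B'" "p' \<in> Sym (card A)" for B' p'
      proof
        have "finite B'" using that(1) rook_subset by blast
        moreover assume "block_map A B' p' \<subseteq>\<^sub>m t"
        ultimately show "B' = B \<and> p' = p"
          using block_map_le_unique[OF fin(2) _ finB that(2) B(2) that(3) B(3) _ B(4)] by simp
      qed (use B(4) in simp)
      \<comment> \<open>In column \<open>A\<close> the only nonzero block of \<open>t\<close> sits
        at row \<open>B\<close>, the image of \<open>A\<close>, so a single set survives in the sum
        over \<open>k\<close>.\<close>
      have Mt: "rook_coeff D (B', w) (A, y) t = (if B' = B then D (card A) w y p else 0)"
        if "B' \<subseteq> {1..n}" for B' w
      proof (cases "card A = card B'")
        case True
        have "{p' \<in> Sym (card A). block_map A B' p' \<subseteq>\<^sub>m t} = (if B' = B then {p} else {})"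
          using uniq[OF that True] B(3) by auto
        then show ?thesis using True by (simp add: rook_coeff_def)
      next
        case False
        then show ?thesis using B(2) by (auto simp: rook_coeff_def)
      qed
      have "(\<Sum>k\<in>rook_index X n. rook_coeff D i k s * rook_coeff D k j t) =
        (\<Sum>B'\<in>Pow {1..n}. \<Sum>w\<in>X (card B'). rook_coeff D i (B', w) s * rook_coeff D (B', w) (A, y) t)"
        unfolding rook_index_def ij using finX by (simp add: sum.Sigma case_prod_unfold)
      also have "\<dots> = (\<Sum>B'\<in>Pow {1..n}. if B' = B then
          (\<Sum>w\<in>X (card B). rook_coeff D i (B, w) s * D (card A) w y p) else 0)"
        by (intro sum.cong refl) (auto simp: Mt)
      also have "\<dots> = (\<Sum>w\<in>X (card A). rook_coeff D (C, x) (B, w) s * D (card A) w y p)"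
        using B ij by simp
      finally have R: "(\<Sum>k\<in>rook_index X n. rook_coeff D i k s * rook_coeff D k j t) = \<dots>" .
      show ?thesis
      proof (cases "card A = card C")
        case False
        then show ?thesis using R B(2) by (simp add: rook_coeff_def rook_mult ij)
      next
        case True
        let ?k = "card A"
        have x: "x \<in> X ?k" and y: "y \<in> X ?k" using CA True by auto
        have "(\<Sum>w\<in>X ?k. rook_coeff D (C, x) (B, w) s * D ?k w y p) =
          (\<Sum>w\<in>X ?k. \<Sum>q\<in>{q \<in> Sym ?k. block_map B C q \<subseteq>\<^sub>m s}. D ?k x w q * D ?k w y p)"
          using True B(2) by (simp add: rook_coeff_def sum_distrib_right)
        also have "\<dots> = (\<Sum>q\<in>{q \<in> Sym ?k. block_map B C q \<subseteq>\<^sub>m s}. \<Sum>w\<in>X ?k. D ?k x w q * D ?k w y p)"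
          by (rule sum.swap)
        also have "\<dots> = (\<Sum>q\<in>{q \<in> Sym ?k. block_map B C q \<subseteq>\<^sub>m s}. D ?k x y (q * p))"
          using D_mult[OF x y _ B(3)] by (intro sum.cong) auto
        also have "\<dots> = (\<Sum>r\<in>{r \<in> Sym ?k. block_map A C r \<subseteq>\<^sub>m s \<circ>\<^sub>m t}. D ?k x y r)"
        proof (rule sum.reindex_bij_witness[of _ "\<lambda>r. r * inverse p" "\<lambda>q. q * p"])
          fix q assume "q \<in> {q \<in> Sym ?k. block_map B C q \<subseteq>\<^sub>m s}"
          then show "q * p \<in> {r \<in> Sym ?k. block_map A C r \<subseteq>\<^sub>m s \<circ>\<^sub>m t}"
            using block_map_comp_le_iff[OF fin(2) finB B(2,3,4)] B(3) Sym_mult by simp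
        next
          fix r assume r: "r \<in> {r \<in> Sym ?k. block_map A C r \<subseteq>\<^sub>m s \<circ>\<^sub>m t}"
          have "r * inverse p * p = r" by (simp add: mult.assoc)
          then show "r * inverse p \<in> {q \<in> Sym ?k. block_map B C q \<subseteq>\<^sub>m s}"
            using r block_map_comp_le_iff[OF fin(2) finB B(2,3,4), of C "r * inverse p" s] B(3) Sym_mult Sym_inverse by simp
        qed (simp_all add: mult.assoc)
        also have "\<dots> = rook_coeff D i j (s \<otimes>\<^bsub>rook_monoid n\<^esub> t)"
          using True by (simp add: rook_coeff_def rook_mult ij)
        finally show ?thesis using R by simp
      qed
    qed
  qed
  show "a s = 0"
    if 0: "\<And>i j. i \<in> rook_index X n \<Longrightarrow> j \<in> rook_index X n \<Longrightarrow> rook_label lab i = rook_label lab j \<Longrightarrow>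
      (\<Sum>s\<in>?C. a s * rook_coeff D i j s) = 0" and s: "s \<in> ?C" for a s
  \<comment> \<open>Every rook is some \<open>block_map A B p\<close>, so \<open>D_inj\<close> on
    the block \<open>(A, B)\<close> makes the zeta transform of \<open>a\<close> vanish
    everywhere.\<close>
  proof (rule zeta_injective[where C = ?C and sub = "(\<subseteq>\<^sub>m)" and rk = "\<lambda>r. card (dom r)"])
    show "finite ?C" by (rule finite_rook)
    show "s \<in> ?C" by fact
    show "card (dom r) < card (dom s)" if "r \<in> ?C" "s \<in> ?C" "r \<subseteq>\<^sub>m s" "r \<noteq> s" for r s
      by (rule map_le_card_dom[OF that(2-4)])
    fix r assume r: "r \<in> ?C"
    show "r \<subseteq>\<^sub>m r" by simp
    obtain A B p where AB: "(A, B) \<in> rook_pairs n" "p \<in> Sym (card A)" "r = block_map A B p"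
      using rook_eq_block_map[OF r] .
    have c: "card A = card B" "A \<subseteq> {1..n}" "B \<subseteq> {1..n}" using AB(1) by (auto simp: rook_pairs_def)
    have "(\<lambda>p. zeta n n (block_map A B p) a) p = 0"
    proof (rule D_inj[OF _ AB(2)])
      fix x y assume "x \<in> X (card A)" "y \<in> X (card A)" "lab (card A) x = lab (card A) y"
      then have "(\<Sum>s\<in>?C. a s * rook_coeff D (B, x) (A, y) s) = 0"
        using c by (intro 0) (auto simp: rook_index_def rook_label_def)
      then show "(\<Sum>p\<in>Sym (card A). zeta n n (block_map A B p) a * D (card A) x y p) = 0"
        unfolding rook_coeff_sum[OF c(1)] by (simp add: mult.commute)
    qed
    then show "(\<Sum>s\<in>{s \<in> ?C. r \<subseteq>\<^sub>m s}. a s) = 0" using AB(3) by (simp add: zeta_full)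
  qed
  show "\<exists>a. \<forall>i\<in>rook_index X n. \<forall>j\<in>rook_index X n. (\<Sum>s\<in>?C. a s * rook_coeff D i j s) = c i j"
    if c0: "\<And>i j. i \<in> rook_index X n \<Longrightarrow> j \<in> rook_index X n \<Longrightarrow> rook_label lab i \<noteq> rook_label lab j \<Longrightarrow> c i j = 0"
    for c
  proof -
    have "\<exists>\<alpha>. \<forall>x\<in>X (card A). \<forall>y\<in>X (card A). (\<Sum>p\<in>Sym (card A). \<alpha> p * D (card A) x y p) = c (B, x) (A, y)"
      if "(A, B) \<in> rook_pairs n" for A B
      using that by (intro D_surj c0) (auto simp: rook_pairs_def rook_index_def rook_label_def)
    then have "\<forall>w. \<exists>\<alpha>. w \<in> rook_pairs n \<longrightarrow> (\<forall>x\<in>X (card (fst w)). \<forall>y\<in>X (card (fst w)).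
        (\<Sum>p\<in>Sym (card (fst w)). \<alpha> p * D (card (fst w)) x y p) = c (snd w, x) (fst w, y))"
      by (metis prod.collapse)
    from choice[OF this] obtain \<alpha> where \<alpha>0: "\<forall>w. w \<in> rook_pairs n \<longrightarrow> (\<forall>x\<in>X (card (fst w)).
        \<forall>y\<in>X (card (fst w)). (\<Sum>p\<in>Sym (card (fst w)). \<alpha> w p * D (card (fst w)) x y p) = c (snd w, x) (fst w, y))" ..
    have \<alpha>: "(\<Sum>p\<in>Sym (card A). \<alpha> (A, B) p * D (card A) x y p) = c (B, x) (A, y)"
      if "(A, B) \<in> rook_pairs n" "x \<in> X (card A)" "y \<in> X (card A)" for A B x y
      using spec[OF \<alpha>0, of "(A, B)"] that by simp
    \<comment> \<open>The solutions \<open>\<alpha>\<close> on the separate blocks glue to one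
      function on the rook monoid, because \<open>block_map\<close> determines \<open>A\<close>,
      \<open>B\<close> and \<open>p\<close>. Any \<open>a\<close> with zeta transform
      \<open>b\<close> is then the required function.\<close>
    define b where "b r = \<alpha> (dom r, ran r) (THE p. p \<in> Sym (card (dom r)) \<and> block_map (dom r) (ran r) p = r)" for r
    have b: "b (block_map A B p) = \<alpha> (A, B) p" if AB: "(A, B) \<in> rook_pairs n" and p: "p \<in> Sym (card A)" for A B p
    proof -
      have AB': "finite A" "finite B" "card A = card B" using AB rook_subset by (auto simp: rook_pairs_def)
      have "(THE p'. p' \<in> Sym (card A) \<and> block_map A B p' = block_map A B p) = p"
      proof (rule the_equality)
        fix p' assume "p' \<in> Sym (card A) \<and> block_map A B p' = block_map A B p"
        then show "p' = p"
          using block_map_le_unique[OF AB'(1,2,2,3,3), of p' p "block_map A B p"] p by simp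
      qed (use p in simp)
      then show ?thesis unfolding b_def dom_block_map ran_block_map[OF AB' p] by simp
    qed
    have "\<exists>a. \<forall>r\<in>?C. (\<Sum>s\<in>{s \<in> ?C. r \<subseteq>\<^sub>m s}. a s) = b r"
    proof (rule zeta_surjective[where rk = "\<lambda>r. card (dom r)"])
      show "card (dom r) < card (dom s)" if "r \<in> ?C" "s \<in> ?C" "r \<subseteq>\<^sub>m s" "r \<noteq> s" for r s
        by (rule map_le_card_dom[OF that(2-4)])
    qed (simp_all add: finite_rook)
    then obtain a where a: "\<forall>r\<in>?C. (\<Sum>s\<in>{s \<in> ?C. r \<subseteq>\<^sub>m s}. a s) = b r" ..
    have "(\<Sum>s\<in>?C. a s * rook_coeff D i j s) = c i j" if i: "i \<in> rook_index X n" and j: "j \<in> rook_index X n" for i j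
    proof -
      obtain B x A y where ij: "i = (B, x)" "j = (A, y)" by fastforce
      show ?thesis
      proof (cases "card A = card B")
        case True
        then have AB: "(A, B) \<in> rook_pairs n" and xy: "x \<in> X (card A)" "y \<in> X (card A)"
          using i j ij by (auto simp: rook_pairs_def rook_index_def)
        have "zeta n n (block_map A B p) a = \<alpha> (A, B) p" if p: "p \<in> Sym (card A)" for p
        proof -
          have "block_map A B p \<in> ?C" using AB p by (auto simp: rook_pairs_def intro!: block_map_rook)
          then show ?thesis using a b[OF AB p] by (simp add: zeta_full)
        qed
        then show ?thesis unfolding ij rook_coeff_sum[OF True] using \<alpha>[OF AB xy] by (simp add: mult.commute)
      next
        case False
        then have "c i j = 0" using c0[OF i j] ij by (simp add: rook_label_def)
        then show ?thesis using False by (simp add: rook_coeff_def ij)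
      qed
    qed
    then show ?thesis by blast
  qed
qed

text \<open>The constant 3 is made up of 2 for the zeta transform, by
  \<open>n * Suc n \<le> 2 * n ^ 3\<close>, and 1 for the transforms on all blocks together, by
  \<open>card_rook_ge\<close>.\<close>

lemma ft_complexity_rook_le:
  "ft_complexity (rook_monoid n) \<le> enat (3 * n ^ 3 * card (rooks n))"
proof (rule Sym_matrix_coefficients[where 's = "nat \<rightharpoonup> nat" and 'm = unit])
  let ?S = "rook_monoid n"
  let ?C = "carrier ?S"
  fix X :: "nat \<Rightarrow> (nat perm \<Rightarrow>\<^sub>0 complex) list set" and lab :: "nat \<Rightarrow> _ \<Rightarrow> nat perm \<Rightarrow>\<^sub>0 complex"
    and D :: "nat \<Rightarrow> _ \<Rightarrow> _ \<Rightarrow> nat perm \<Rightarrow> complex"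
  assume coefs: "sym_coefficients X lab D"
    and cost: "\<And>(S :: (nat \<rightharpoonup> nat) monoid) n z V. (\<And>p. p \<in> Sym n \<Longrightarrow> z p \<in> V) \<Longrightarrow>
      ext_cost S (n ^ 3 * fact n) V
        ((\<lambda>(x, y) f. \<Sum>p\<in>Sym n. D n x y p * z p f) ` {(x, y). x \<in> X n \<and> y \<in> X n \<and> lab n x = lab n y})"
  interpret matrix_coefficients ?S "rook_index X n" "rook_label lab" "rook_coeff D"
    by (rule sym_coefficients.rook_matrix_coefficients[OF coefs])
  let ?out = "(\<lambda>(i, j) f. \<Sum>s\<in>?C. f s * rook_coeff D i j s) `
      {(i, j). i \<in> rook_index X n \<and> j \<in> rook_index X n \<and> rook_label lab i = rook_label lab j}"
  let ?fft = "\<Sum>w\<in>rook_pairs n. card (fst w) ^ 3 * fact (card (fst w))"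
  let ?in = "(\<lambda>s f. f s) ` ?C"
  let ?Z = "zeta n n ` ?C"
  let ?W = "\<lambda>(A, B). (\<lambda>(x, y) f. \<Sum>p\<in>Sym (card A). D (card A) x y p * zeta n n (block_map A B p) f) `
     {(x, y). x \<in> X (card A) \<and> y \<in> X (card A) \<and> lab (card A) x = lab (card A) y}"
  have "ext_cost ?S ?fft (?in \<union> ?Z) (\<Union>w\<in>rook_pairs n. ?W w)"
  proof (rule ext_cost_UN[OF finite_rook_pairs])
    fix w assume w: "w \<in> rook_pairs n"
    obtain A B where AB: "w = (A, B)" by fastforce
    have "ext_cost ?S (card A ^ 3 * fact (card A)) (?in \<union> ?Z) (?W (A, B))"
      unfolding prod.case
      by (rule cost, rule UnI2, rule imageI, rule block_map_rook) (use w AB in \<open>auto simp: rook_pairs_def\<close>)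
    then show "ext_cost ?S (card (fst w) ^ 3 * fact (card (fst w))) (?in \<union> ?Z) (?W w)"
      by (simp add: AB)
  qed
  from ext_cost_trans[OF zeta_cost[OF order_refl] this]
  have "ext_cost ?S (3 * n ^ 3 * card ?C) ?in ?out"
  proof (rule ext_cost_mono)
    have "?fft \<le> (\<Sum>w\<in>rook_pairs n. n ^ 3 * fact (card (fst w)))"
      using rook_subset by (intro sum_mono mult_le_mono1 power_mono) (auto simp: rook_pairs_def)
    also have "\<dots> \<le> n ^ 3 * card ?C"
      using card_rook_ge[of n] by (simp add: sum_distrib_left[symmetric] case_prod_unfold)
    finally have "n * (Suc n * card ?C) + ?fft
        \<le> (n * Suc n + n ^ 3) * card ?C" by (simp add: algebra_simps)
    also have "n * Suc n \<le> 2 * n ^ 3"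
      by (cases n) (simp_all add: power3_eq_cube algebra_simps)
    then have "(n * Suc n + n ^ 3) * card ?C \<le> 3 * n ^ 3 * card ?C" by (intro mult_le_mono1) simp
    finally show "n * (Suc n * card ?C) + ?fft \<le> 3 * n ^ 3 * card ?C" .
    show "?out \<subseteq> ?in \<union> ?Z \<union> (\<Union>w\<in>rook_pairs n. ?W w)"
    proof
      fix g assume "g \<in> ?out"
      then obtain B x A y where g: "g = (\<lambda>f. \<Sum>s\<in>?C. f s * rook_coeff D (B, x) (A, y) s)"
        and ij: "(B, x) \<in> rook_index X n" "(A, y) \<in> rook_index X n" "rook_label lab (B, x) = rook_label lab (A, y)"
        by auto
      have AB: "(A, B) \<in> rook_pairs n" "card A = card B" "x \<in> X (card A)" "y \<in> X (card A)" "lab (card A) x = lab (card A) y"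
        using ij by (auto simp: rook_pairs_def rook_index_def rook_label_def)
      have "g = (\<lambda>f. \<Sum>p\<in>Sym (card A). D (card A) x y p * zeta n n (block_map A B p) f)"
        unfolding g by (intro ext rook_coeff_sum[OF AB(2)])
      then have "g \<in> ?W (A, B)" using AB(3-5) by auto
      then show "g \<in> ?in \<union> ?Z \<union> (\<Union>w\<in>rook_pairs n. ?W w)" using AB(1) by blast
    qed
  qed simp
  then show "ft_complexity ?S \<le> enat (3 * n ^ 3 * card ?C)" by (rule ft_complexity_le)
qed

theorem theorem5p5:
  shows "(\<forall>n. ft_complexity (rook_monoid n) \<noteq> \<infinity>) \<and>
    (\<lambda>n. real (the_enat (ft_complexity (rook_monoid n)))) \<in>
      O(\<lambda>n. real (card (carrier (rook_monoid n))) *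
            ln (real (card (carrier (rook_monoid n)))) ^ 3)"
proof
  let ?c = "\<lambda>n. card (carrier (rook_monoid n))"
  show fin: "\<forall>n. ft_complexity (rook_monoid n) \<noteq> \<infinity>"
    using ft_complexity_rook_le by (metis enat_ord_simps(5) infinity_ileE)
  \<comment> \<open>Cubing \<open>n * ln 2 \<le> ln |R_n|\<close> replaces \<open>n ^ 3\<close> at
    the price of the factor \<open>1 / ln 2 ^ 3\<close>. The bound holds for every \<open>n\<close>;
    at \<open>n = 0\<close> both sides are 0.\<close>
  have "norm (real (the_enat (ft_complexity (rook_monoid n)))) \<le>
      3 / ln 2 ^ 3 * norm (real (?c n) * ln (real (?c n)) ^ 3)" for n
  proof -
    obtain k where k: "ft_complexity (rook_monoid n) = enat k" using fin by auto
    have "k \<le> 3 * n ^ 3 * ?c n" using ft_complexity_rook_le[of n] by (simp add: k)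
    then have "real k \<le> real (3 * n ^ 3 * ?c n)" by (simp only: of_nat_le_iff)
    then have k_le: "real k \<le> 3 * real n ^ 3 * real (?c n)" by simp
    have "2 ^ n \<le> real (?c n)" using card_rook_ge_power[of n] by (metis of_nat_le_iff of_nat_numeral of_nat_power)
    then have "ln (2 ^ n) \<le> ln (real (?c n))" by (subst ln_le_cancel_iff) (auto intro: less_le_trans[of 0 "2 ^ n"])
    then have l: "real n * ln 2 \<le> ln (real (?c n))" by (simp add: ln_realpow)
    have "real n ^ 3 * ln 2 ^ 3 \<le> ln (real (?c n)) ^ 3"
      using power_mono[OF l, of 3] by (simp add: power_mult_distrib)
    then have "real n ^ 3 \<le> ln (real (?c n)) ^ 3 / ln 2 ^ 3" by (simp add: pos_le_divide_eq)
    then have "3 * real n ^ 3 * real (?c n) \<le> 3 * (ln (real (?c n)) ^ 3 / ln 2 ^ 3) * real (?c n)"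
      by (intro mult_right_mono mult_left_mono) auto
    moreover have "0 \<le> ln (real (?c n))" using l by (meson ln_ge_zero mult_nonneg_nonneg of_nat_0_le_iff one_le_numeral order_trans)
    ultimately show ?thesis using k_le by (simp add: k mult_ac)
  qed
  then show "(\<lambda>n. real (the_enat (ft_complexity (rook_monoid n)))) \<in>
      O(\<lambda>n. real (?c n) * ln (real (?c n)) ^ 3)"
    by (intro bigoI[of _ "3 / ln 2 ^ 3"] always_eventually allI)
qed

end
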